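(* Let $G$ be a finite simple connected graph. If $\beth^{i}(K^{h(G)})=\beth^{i}(G)$ for some $i\in\{1,2,3\}$, then $G$ belongs to the Hadwiger class $\mathcal{H}$, i.e. $\chi(G)\le h(G)$.
   Context: All graphs are finite and simple. $K^{t}$ is the complete graph on $t$ vertices, $\chi(G)$ is the chromatic number, and the Hadwiger number $h(G)$ is the maximum $t$ such that $K^{t}$ is a minor of $G$. The Hadwiger class $\mathcal{H}$ is the collection of finite connected simple graphs $G$ with $\chi(G)\le h(G)$. $C(G)$ is the set of all induced cycles in $G$ (of length at least 3). Solid graphs are the graphs of the following four kinds. (1) Pyramid: a graph consisting of a cycle $C$ and a vertex $w\notin V(C)$ together with at least three edges between $w$ and $C$. (2) Trihedron: the union of three paths $P_1,P_2,P_3$, each of length at least 2, having the same two (distinct) endpoints, such that no interior vertex of any of the paths is used in another of the paths. (3) Stamp: the union of a triangle $T$ and three paths $P_1,P_2,P_3$ of length $\ge 1$ that start at the three different vertices of $T$ and all end at the same vertex $x\notin V(T)$, such that the $P_i-x$ are pairwise vertex-disjoint and each $P_i$ meets $T$ only in its starting vertex. (4) Prism: $T\cup T'\cup P_1\cup P_2\cup P_3$ where $T,T'$ are vertex-disjoint triangles with vertices $x_1,x_2,x_3$ and $y_1,y_2,y_3$ respectively, and the $P_i$ are pairwise vertex-disjoint paths from $x_i$ to $y_i$ (so $P_i$ meets $T\cup T'$ only in $x_i,y_i$). A solid in $G$ is an induced subgraph of $G$ that is isomorphic to a solid graph; $S(G)$ is the set of all solids in $G$. The three graph characteristics of a connected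 graph $G$ are $\beth^{1}(G)=|E(G)|-|V(G)|$, $\beth^{2}(G)=|C(G)|-|E(G)|+|V(G)|$, and $\beth^{3}(G)=|S(G)|-|C(G)|+|E(G)|-|V(G)|$. *)

theory Defs
  imports Main "HOL-Library.Disjoint_Sets"
begin

section \<open>Simple graphs\<close>

record 'a ugraph =
  vertices :: "'a set"
  edges :: "'a set set"

definition simple_graph :: "'a ugraph \<Rightarrow> bool" where
  "simple_graph G \<longleftrightarrow>
     finite (vertices G) \<and> (\<forall>e\<in>edges G. e \<subseteq> vertices G \<and> card e = 2)"

definition graph_connected :: "'a ugraph \<Rightarrow> bool" where
  "graph_connected G \<longleftrightarrow>
     vertices G \<noteq> {} \<and>
     (\<forall>u\<in>vertices G. \<forall>v\<in>vertices G. (u, v) \<in> {(x, y). {x, y} \<in> edges G}\<^sup>*)"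

definition induced_on :: "'a ugraph \<Rightarrow> 'a set \<Rightarrow> 'a ugraph" where
  "induced_on G X = \<lparr>vertices = X, edges = {e \<in> edges G. e \<subseteq> X}\<rparr>"

definition is_induced_subgraph :: "'a ugraph \<Rightarrow> 'a ugraph \<Rightarrow> bool" where
  "is_induced_subgraph H G \<longleftrightarrow> (\<exists>X\<subseteq>vertices G. H = induced_on G X)"

definition graph_isomorphic :: "'a ugraph \<Rightarrow> 'b ugraph \<Rightarrow> bool" where
  "graph_isomorphic G H \<longleftrightarrow>
     (\<exists>f. bij_betw f (vertices G) (vertices H) \<and>
          (\<forall>u\<in>vertices G. \<forall>v\<in>vertices G. {u, v} \<in> edges G \<longleftrightarrow> {f u, f v} \<in> edges H))"

definition graph_union :: "'a ugraph \<Rightarrow> 'a ugraph \<Rightarrow> 'a ugraph" where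
  "graph_union G H = \<lparr>vertices = vertices G \<union> vertices H, edges = edges G \<union> edges H\<rparr>"

definition complete_graph :: "nat \<Rightarrow> nat ugraph" where
  "complete_graph t = \<lparr>vertices = {..<t}, edges = {{i, j} | i j. i < t \<and> j < t \<and> i \<noteq> j}\<rparr>"

section \<open>Chromatic number and Hadwiger number\<close>

definition proper_coloring :: "'a ugraph \<Rightarrow> nat \<Rightarrow> ('a \<Rightarrow> nat) \<Rightarrow> bool" where
  "proper_coloring G k c \<longleftrightarrow>
     c ` vertices G \<subseteq> {..<k} \<and> (\<forall>u v. {u, v} \<in> edges G \<longrightarrow> c u \<noteq> c v)"

definition chromatic_number :: "'a ugraph \<Rightarrow> nat" where
  "chromatic_number G = (LEAST k. \<exists>c. proper_coloring G k c)"

text \<open>\<open>B v\<close> is the branch set that is contracted to the vertex \<open>v\<close> of the minor.\<close>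

definition is_minor :: "'b ugraph \<Rightarrow> 'a ugraph \<Rightarrow> bool" where
  "is_minor H G \<longleftrightarrow>
     (\<exists>B. disjoint_family_on B (vertices H) \<and>
          (\<forall>v\<in>vertices H. B v \<subseteq> vertices G \<and> graph_connected (induced_on G (B v))) \<and>
          (\<forall>u v. {u, v} \<in> edges H \<longrightarrow> (\<exists>x\<in>B u. \<exists>y\<in>B v. {x, y} \<in> edges G)))"

definition hadwiger_number :: "'a ugraph \<Rightarrow> nat" where
  "hadwiger_number G = Max {t. is_minor (complete_graph t) G}"

definition hadwiger_class :: "'a ugraph set" where
  "hadwiger_class =
     {G. simple_graph G \<and> graph_connected G \<and> chromatic_number G \<le> hadwiger_number G}"

section \<open>Paths and cycles\<close>

text \<open>Paths and cycles are given by the list of their vertices in order, without repetition. A path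
  of length \<open>l\<close> has \<open>l + 1\<close> vertices, a cycle of length \<open>l\<close> has \<open>l\<close> vertices.\<close>

definition is_path :: "'a \<Rightarrow> 'a list \<Rightarrow> 'a \<Rightarrow> bool" where
  "is_path x p y \<longleftrightarrow> p \<noteq> [] \<and> distinct p \<and> hd p = x \<and> last p = y"

definition path_graph :: "'a list \<Rightarrow> 'a ugraph" where
  "path_graph p = \<lparr>vertices = set p, edges = {{p ! i, p ! Suc i} | i. Suc i < length p}\<rparr>"

definition path_length :: "'a list \<Rightarrow> nat" where
  "path_length p = length p - 1"

definition is_cycle :: "'a list \<Rightarrow> bool" where
  "is_cycle c \<longleftrightarrow> distinct c \<and> 3 \<le> length c"

definition cycle_graph :: "'a list \<Rightarrow> 'a ugraph" where
  "cycle_graph c =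
     \<lparr>vertices = set c, edges = {{c ! i, c ! (Suc i mod length c)} | i. i < length c}\<rparr>"

definition induced_cycles :: "'a ugraph \<Rightarrow> 'a ugraph set" where
  "induced_cycles G = {H. is_induced_subgraph H G \<and> (\<exists>c. is_cycle c \<and> H = cycle_graph c)}"

section \<open>Solids\<close>

text \<open>A pyramid has no edges other than those of the cycle \<open>c\<close> and the edges from the apex \<open>w\<close> to
  the set \<open>X\<close>.\<close>

definition is_pyramid :: "'a ugraph \<Rightarrow> bool" where
  "is_pyramid G \<longleftrightarrow>
     (\<exists>c w X. is_cycle c \<and> w \<notin> set c \<and> X \<subseteq> set c \<and> 3 \<le> card X \<and>
        G = graph_union (cycle_graph c) \<lparr>vertices = insert w X, edges = {{w, x} | x. x \<in> X}\<rparr>)"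

text \<open>In the following three definitions the triples of paths and of triangle vertices are indexed
  by \<open>0, 1, 2\<close>. For a path from \<open>a\<close> to \<open>b\<close> the interior vertices are those
  other than \<open>a\<close> and \<open>b\<close>.\<close>

definition is_trihedron :: "'a ugraph \<Rightarrow> bool" where
  "is_trihedron G \<longleftrightarrow>
     (\<exists>a b P. a \<noteq> b \<and>
        (\<forall>i<3. is_path a (P i) b \<and> 2 \<le> path_length (P i)) \<and>
        (\<forall>i<3. \<forall>j<3. i \<noteq> j \<longrightarrow> (set (P i) - {a, b}) \<inter> set (P j) = {}) \<and>
        G = graph_union (path_graph (P (0::nat)))
              (graph_union (path_graph (P 1)) (path_graph (P 2))))"

definition is_stamp :: "'a ugraph \<Rightarrow> bool" where
  "is_stamp G \<longleftrightarrow>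
     (\<exists>t x P. is_cycle [t 0, t 1, t 2] \<and> x \<notin> {t 0, t 1, t 2} \<and>
        (\<forall>i<3. is_path (t i) (P i) x \<and> 1 \<le> path_length (P i)) \<and>
        (\<forall>i<3. \<forall>j<3. i \<noteq> j \<longrightarrow> (set (P i) - {x}) \<inter> (set (P j) - {x}) = {}) \<and>
        (\<forall>i<3. set (P i) \<inter> {t 0, t 1, t 2} = {t i}) \<and>
        G = graph_union (cycle_graph [t 0, t 1, t 2])
              (graph_union (path_graph (P (0::nat)))
                (graph_union (path_graph (P 1)) (path_graph (P 2)))))"

definition is_prism :: "'a ugraph \<Rightarrow> bool" where
  "is_prism G \<longleftrightarrow>
     (\<exists>x y P. is_cycle [x 0, x 1, x 2] \<and> is_cycle [y 0, y 1, y 2] \<and>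
        {x 0, x 1, x 2} \<inter> {y 0, y 1, y 2} = {} \<and>
        (\<forall>i<3. is_path (x i) (P i) (y i)) \<and>
        (\<forall>i<3. \<forall>j<3. i \<noteq> j \<longrightarrow> set (P i) \<inter> set (P j) = {}) \<and>
        G = graph_union (graph_union (cycle_graph [x 0, x 1, x 2]) (cycle_graph [y 0, y 1, y 2]))
              (graph_union (path_graph (P (0::nat)))
                (graph_union (path_graph (P 1)) (path_graph (P 2)))))"

definition is_solid_graph :: "'a ugraph \<Rightarrow> bool" where
  "is_solid_graph G \<longleftrightarrow> is_pyramid G \<or> is_trihedron G \<or> is_stamp G \<or> is_prism G"

text \<open>Quantifying over solid graphs on the vertex type of \<open>G\<close> loses nothing: a solid graph
  isomorphic to a subgraph of \<open>G\<close> can be transported to the vertex set of that subgraph.\<close>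

definition solids :: "'a ugraph \<Rightarrow> 'a ugraph set" where
  "solids G =
     {H. is_induced_subgraph H G \<and> (\<exists>S :: 'a ugraph. is_solid_graph S \<and> graph_isomorphic H S)}"

section \<open>The three characteristics\<close>

definition beth1 :: "'a ugraph \<Rightarrow> int" where
  "beth1 G = int (card (edges G)) - int (card (vertices G))"

definition beth2 :: "'a ugraph \<Rightarrow> int" where
  "beth2 G = int (card (induced_cycles G)) - int (card (edges G)) + int (card (vertices G))"

definition beth3 :: "'a ugraph \<Rightarrow> int" where
  "beth3 G = int (card (solids G)) - int (card (induced_cycles G))
     + int (card (edges G)) - int (card (vertices G))"

end

theory Submission
  imports Defs
begin

text \<open>
  Every nonempty graph has a vertex \<open>v\<close> any two of whose neighbours are joined by an induced path
  whose interior avoids the closed neighbourhood of \<open>v\<close>. Remove such a vertex, of degree \<open>d\<close>.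
  For each pair of neighbours of \<open>v\<close> at least one induced cycle through \<open>v\<close> is lost; if the pair
  lies on \<open>m\<close> induced cycles through \<open>v\<close>, at least \<open>m - 1\<close> solids meet the neighbourhood of \<open>v\<close> in
  exactly this pair, and for each triple of neighbours some solid meets it in exactly this triple.
  In a complete graph all these counts are attained. The removal keeps a connected graph connected,
  and the chromatic number \<open>k\<close> drops only if \<open>d \<ge> k - 1\<close>, so summing up gives
  \<open>beth\<^sup>i(G) \<ge> beth\<^sup>i(K\<^sup>k)\<close> for every connected graph \<open>G\<close> of chromatic number \<open>k\<close>. Since
  \<open>beth\<^sup>i(K\<^sup>t)\<close> increases strictly for \<open>t \<ge> 4\<close>, the hypothesis excludes \<open>k > h(G) \<ge> 4\<close>, and
  \<open>k > h(G)\<close> forces \<open>h(G) \<ge> 4\<close> by the small cases of Hadwiger's conjecture.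
\<close>

section \<open>Induced paths and connected sets\<close>

text \<open>The number \<open>m\<close> of induced cycles through a fixed pair of neighbours is
  uncontrolled, and cycles count negatively in the third characteristic. The bound
  \<open>m - 1\<close> for solids cancels it: a step at degree \<open>d\<close> changes the three
  characteristics by at least \<open>d - 1\<close>, \<open>(d choose 2) - d + 1\<close> and
  \<open>(d choose 3) - (d choose 2) + d - 1\<close>, whatever the cycles are. These are exactly the
  increments from \<open>K\<^sup>d\<close> to the next complete graph. For \<open>d \<ge> 1\<close>
  they are nonnegative, so steps that keep the chromatic number do no harm, and nondecreasing, so a
  degree larger than necessary does none either. The threshold 4 comes from the third
  characteristic, which is -1 on each of the complete graphs with one to four vertices and separates
  complete graphs only from there on.\<close>

fun path_edges :: "'a list \<Rightarrow> 'a set set" where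
  "path_edges [] = {}"
| "path_edges [x] = {}"
| "path_edges (x # y # zs) = insert {x, y} (path_edges (y # zs))"

lemma path_edges_subset: "e \<in> path_edges p \<Longrightarrow> e \<subseteq> set p"
  by (induction p rule: path_edges.induct) auto

lemma path_edges_append:
  "xs \<noteq> [] \<Longrightarrow> ys \<noteq> [] \<Longrightarrow>
    path_edges (xs @ ys) = insert {last xs, hd ys} (path_edges xs \<union> path_edges ys)"
proof (induction xs rule: path_edges.induct)
  case (2 x)
  then show ?case by (cases ys) auto
qed auto

lemma path_edges_Cons: "ys \<noteq> [] \<Longrightarrow> path_edges (x # ys) = insert {x, hd ys} (path_edges ys)"
  by (cases ys) auto

lemma path_edges_rev [simp]: "path_edges (rev p) = path_edges p"
proof (induction p rule: path_edges.induct)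
  case (3 x y zs)
  then show ?case
    using path_edges_append[of "rev (y # zs)" "[x]"] by (auto simp: insert_commute)
qed auto

lemma path_edges_conv_nth: "path_edges p = {{p ! i, p ! Suc i} | i. Suc i < length p}"
proof (induction p rule: path_edges.induct)
  case (3 x y zs)
  have "{{(x # y # zs) ! i, (x # y # zs) ! Suc i} | i. Suc i < length (x # y # zs)} =
    insert {x, y} {{(y # zs) ! i, (y # zs) ! Suc i} | i. Suc i < length (y # zs)}" (is "?L = ?R")
  proof (intro equalityI subsetI)
    fix e assume "e \<in> ?L"
    then obtain i where "e = {(x # y # zs) ! i, (x # y # zs) ! Suc i}" "Suc i < length (x # y # zs)"
      by blast
    then show "e \<in> ?R" by (cases i) auto
  next
    fix e assume "e \<in> ?R"
    then consider "e = {x, y}"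
      | i where "e = {(y # zs) ! i, (y # zs) ! Suc i}" "Suc i < length (y # zs)" by blast
    then show "e \<in> ?L"
    proof cases
      case 1
      then show ?thesis by (intro CollectI exI[of _ 0]) auto
    next
      case (2 i)
      then show ?thesis by (intro CollectI exI[of _ "Suc i"]) auto
    qed
  qed
  then show ?case using 3 by simp
qed auto

lemma edges_path_graph: "edges (path_graph p) = path_edges p"
  by (simp add: path_graph_def path_edges_conv_nth)

lemma edges_cycle_graph:
  assumes "c \<noteq> []" shows "edges (cycle_graph c) = insert {last c, hd c} (path_edges c)"
proof -
  have "{{c ! i, c ! (Suc i mod length c)} | i. i < length c} =
    insert {last c, hd c} {{c ! i, c ! Suc i} | i. Suc i < length c}" (is "?L = ?R")
  proof (intro equalityI subsetI)
    fix e assume "e \<in> ?L"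
    then obtain i where i: "e = {c ! i, c ! (Suc i mod length c)}" "i < length c" by blast
    show "e \<in> ?R"
    proof (cases "Suc i < length c")
      case True
      then show ?thesis using i by auto
    next
      case False
      then have "Suc i = length c" using i by simp
      then have "i = length c - 1" by simp
      then show ?thesis using i assms False by (auto simp: last_conv_nth hd_conv_nth)
    qed
  next
    fix e assume "e \<in> ?R"
    then consider "e = {last c, hd c}"
      | i where "e = {c ! i, c ! Suc i}" "Suc i < length c" by blast
    then show "e \<in> ?L"
    proof cases
      case 1
      then show ?thesis using assms
        by (intro CollectI exI[of _ "length c - 1"]) (auto simp: last_conv_nth hd_conv_nth)
    next
      case (2 i)
      then show ?thesis by (intro CollectI exI[of _ i]) auto
    qed
  qed
  then show ?thesis by (simp add: cycle_graph_def path_edges_conv_nth)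
qed

locale sgraph =
  fixes G :: "'a ugraph"
  assumes simple: "simple_graph G"
begin

definition adj :: "'a \<Rightarrow> 'a \<Rightarrow> bool" where
  "adj x y \<longleftrightarrow> {x, y} \<in> edges G"

definition edges_in :: "'a set \<Rightarrow> 'a set set" where
  "edges_in X = {e \<in> edges G. e \<subseteq> X}"

lemma finite_vertices: "finite (vertices G)"
  using simple by (simp add: simple_graph_def)

lemma adj_sym: "adj x y \<longleftrightarrow> adj y x"
  by (simp add: adj_def insert_commute)

lemma adj_irrefl [simp]: "\<not> adj x x"
  using simple by (auto simp: adj_def simple_graph_def)

lemma adj_vertices: assumes "adj x y" shows "x \<in> vertices G" "y \<in> vertices G"
  using simple assms by (auto simp: adj_def simple_graph_def)

lemma edge_cases: assumes "e \<in> edges G" obtains x y where "e = {x, y}" "adj x y"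
proof -
  have "card e = 2" using simple assms by (auto simp: simple_graph_def)
  then obtain x y where "e = {x, y}" by (auto simp: card_2_iff)
  then show ?thesis using that assms by (simp add: adj_def)
qed

lemma edges_in_iff: "e \<in> edges_in X \<longleftrightarrow> (\<exists>x\<in>X. \<exists>y\<in>X. e = {x, y} \<and> adj x y)"
proof
  assume "e \<in> edges_in X"
  then have "e \<in> edges G" "e \<subseteq> X" by (auto simp: edges_in_def)
  then show "\<exists>x\<in>X. \<exists>y\<in>X. e = {x, y} \<and> adj x y" by (metis edge_cases insert_subset)
next
  assume "\<exists>x\<in>X. \<exists>y\<in>X. e = {x, y} \<and> adj x y"
  then show "e \<in> edges_in X" by (auto simp: edges_in_def adj_def)
qed

lemma edges_in_doubleton: "{x, y} \<in> edges_in X \<longleftrightarrow> x \<in> X \<and> y \<in> X \<and> adj x y"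
  by (auto simp: edges_in_def adj_def)

lemma edges_in_Un:
  "edges_in (X \<union> Y) = edges_in X \<union> edges_in Y \<union> {{x, y} | x y. x \<in> X \<and> y \<in> Y \<and> adj x y}"
proof (intro set_eqI iffI)
  fix e assume "e \<in> edges_in (X \<union> Y)"
  then obtain x y where xy: "x \<in> X \<union> Y" "y \<in> X \<union> Y" "e = {x, y}" "e = {y, x}" "adj x y" "adj y x"
    using adj_sym by (auto simp: edges_in_iff insert_commute)
  then consider "x \<in> X" "y \<in> X" | "x \<in> Y" "y \<in> Y" | "x \<in> X" "y \<in> Y" | "y \<in> X" "x \<in> Y" by blast
  then show "e \<in> edges_in X \<union> edges_in Y \<union> {{x, y} | x y. x \<in> X \<and> y \<in> Y \<and> adj x y}"
    using xy by cases (auto simp: edges_in_doubleton)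
next
  fix e assume "e \<in> edges_in X \<union> edges_in Y \<union> {{x, y} | x y. x \<in> X \<and> y \<in> Y \<and> adj x y}"
  then show "e \<in> edges_in (X \<union> Y)" by (auto simp: edges_in_def adj_def)
qed

lemma edges_in_insert:
  "edges_in (insert x Y) = edges_in Y \<union> {{x, y} | y. y \<in> Y \<and> adj x y}"
proof -
  have "edges_in {x} = {}" by (auto simp: edges_in_iff)
  moreover have "edges_in (insert x Y) = edges_in ({x} \<union> Y)" by simp
  ultimately show ?thesis by (simp only: edges_in_Un) simp
qed

lemma edges_induced_on: "edges (induced_on G X) = edges_in X"
  by (simp add: induced_on_def edges_in_def)

text \<open>Chords are excluded whenever a vertex is prepended, so these are the induced paths. A
  one-element list always qualifies, even if its vertex is not in \<open>G\<close>; membership has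
  to be derived from an incident edge where it matters.\<close>

fun ipath :: "'a list \<Rightarrow> bool" where
  "ipath [] = False"
| "ipath [x] = True"
| "ipath (x # y # zs) =
    (adj x y \<and> x \<notin> set (y # zs) \<and> (\<forall>z\<in>set zs. \<not> adj x z) \<and> ipath (y # zs))"

lemma ipath_nonempty: "ipath p \<Longrightarrow> p \<noteq> []"
  by auto

lemma ipath_distinct: "ipath p \<Longrightarrow> distinct p"
  by (induction p rule: ipath.induct) auto

lemma ipath_Cons:
  "p \<noteq> [] \<Longrightarrow> ipath (x # p) \<longleftrightarrow> ipath p \<and> x \<notin> set p \<and> (\<forall>y\<in>set p. adj x y \<longleftrightarrow> y = hd p)"
  using ipath_distinct by (cases p) (auto, fastforce)

lemma ipath_append:
  "xs \<noteq> [] \<Longrightarrow> ys \<noteq> [] \<Longrightarrow> ipath (xs @ ys) \<longleftrightarrow> ipath xs \<and> ipath ys \<and>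
    set xs \<inter> set ys = {} \<and> (\<forall>x\<in>set xs. \<forall>y\<in>set ys. adj x y \<longleftrightarrow> x = last xs \<and> y = hd ys)"
proof (induction xs)
  case (Cons x xs)
  show ?case
  proof (cases "xs = []")
    case True
    then show ?thesis using Cons.prems by (auto simp: ipath_Cons)
  next
    case False
    have m: "hd (xs @ ys) = hd xs" "hd xs \<in> set xs" "last xs \<in> set xs" using False by auto
    have IH: "ipath (xs @ ys) \<longleftrightarrow> ipath xs \<and> ipath ys \<and> set xs \<inter> set ys = {} \<and>
        (\<forall>x\<in>set xs. \<forall>y\<in>set ys. adj x y \<longleftrightarrow> x = last xs \<and> y = hd ys)"
      using Cons.IH Cons.prems False by simp
    have L: "ipath ((x # xs) @ ys) \<longleftrightarrow> ipath (xs @ ys) \<and> x \<notin> set xs \<and> x \<notin> set ys \<and>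
        (\<forall>y\<in>set xs. adj x y \<longleftrightarrow> y = hd xs) \<and> (\<forall>y\<in>set ys. adj x y \<longleftrightarrow> y = hd xs)"
      using False m by (auto simp: ipath_Cons)
    have R: "ipath (x # xs) \<longleftrightarrow> ipath xs \<and> x \<notin> set xs \<and> (\<forall>y\<in>set xs. adj x y \<longleftrightarrow> y = hd xs)"
      "last (x # xs) = last xs"
      using False by (simp_all add: ipath_Cons)
    show ?thesis
    proof
      assume l: "ipath ((x # xs) @ ys)"
      then have "x \<notin> set ys" "set xs \<inter> set ys = {}" "\<forall>y\<in>set ys. adj x y \<longleftrightarrow> y = hd xs"
        using L IH by simp_all
      then have "\<not> adj x y \<and> x \<noteq> y" if "y \<in> set ys" for y
        using m(2) that by (metis disjoint_iff)
      then show "ipath (x # xs) \<and> ipath ys \<and> set (x # xs) \<inter> set ys = {} \<and>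
          (\<forall>z\<in>set (x # xs). \<forall>y\<in>set ys. adj z y \<longleftrightarrow> z = last (x # xs) \<and> y = hd ys)"
        using l L IH R m by auto
    next
      assume r: "ipath (x # xs) \<and> ipath ys \<and> set (x # xs) \<inter> set ys = {} \<and>
          (\<forall>z\<in>set (x # xs). \<forall>y\<in>set ys. adj z y \<longleftrightarrow> z = last (x # xs) \<and> y = hd ys)"
      then have "\<not> adj x y \<and> y \<noteq> hd xs" if "y \<in> set ys" for y
        using R m that by (metis Int_iff empty_iff list.set_intros)
      then show "ipath ((x # xs) @ ys)"
        using r L IH R by auto
    qed
  qed
qed simp

lemma ipath_rev [simp]: "ipath (rev p) \<longleftrightarrow> ipath p"
proof -
  have "ipath p \<Longrightarrow> ipath (rev p)" for p
  proof (induction p)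
    case (Cons x p)
    show ?case
    proof (cases "p = []")
      case False
      then have "ipath p \<and> x \<notin> set p \<and> (\<forall>y\<in>set p. adj x y \<longleftrightarrow> y = hd p)"
        using Cons.prems by (simp add: ipath_Cons)
      then show ?thesis using False Cons.IH
        by (simp add: ipath_append last_rev adj_sym[of _ x])
    qed simp
  qed simp
  from this[of p] this[of "rev p"] show ?thesis by auto
qed

lemma edges_in_ipath: "ipath p \<Longrightarrow> edges_in (set p) = path_edges p"
proof (induction p)
  case (Cons x p)
  show ?case
  proof (cases "p = []")
    case True
    then show ?thesis by (auto simp: edges_in_iff)
  next
    case False
    then show ?thesis using Cons
      by (auto simp: ipath_Cons edges_in_insert path_edges_Cons)
  qed
qed simp

text \<open>Serves to recover an induced path from a cycle that is presented as a list of
  vertices.\<close>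

lemma ipathI_edges:
  "distinct p \<Longrightarrow> p \<noteq> [] \<Longrightarrow> (\<And>x y. x \<in> set p \<Longrightarrow> y \<in> set p \<Longrightarrow> adj x y \<longleftrightarrow> {x, y} \<in> path_edges p)
    \<Longrightarrow> ipath p"
proof (induction p)
  case (Cons x p)
  show ?case
  proof (cases "p = []")
    case False
    have "adj y z \<longleftrightarrow> {y, z} \<in> path_edges p" if "y \<in> set p" "z \<in> set p" for y z
      using Cons.prems(1) Cons.prems(3)[of y z] that False
      by (auto simp: path_edges_Cons doubleton_eq_iff)
    then have "ipath p" using Cons False by auto
    moreover have "adj x y \<longleftrightarrow> y = hd p" if "y \<in> set p" for y
      using Cons.prems(1) Cons.prems(3)[of x y] that False path_edges_subset[of "{x, y}" p]
      by (auto simp: path_edges_Cons doubleton_eq_iff)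
    ultimately show ?thesis using Cons.prems(1) False by (simp add: ipath_Cons)
  qed simp
qed simp

lemma ipath_vertices: assumes "ipath p" "length p \<ge> 2" shows "set p \<subseteq> vertices G"
  using assms
proof (induction p rule: ipath.induct)
  case (3 x y zs)
  then show ?case by (cases zs) (auto dest: adj_vertices)
qed auto

section \<open>Connectivity through induced paths\<close>

text \<open>Induced paths replace walks in this notion of reachability, so every use of connectivity
  directly supplies a path that can become part of an induced cycle or of a solid.\<close>

definition joined :: "'a set \<Rightarrow> 'a \<Rightarrow> 'a \<Rightarrow> bool" where
  "joined X a b \<longleftrightarrow> (\<exists>p. ipath p \<and> hd p = a \<and> last p = b \<and> set p \<subseteq> X)"

lemma joined_refl: "a \<in> X \<Longrightarrow> joined X a a"
  unfolding joined_def by (intro exI[of _ "[a]"]) auto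

lemma joined_sym: "joined X a b \<Longrightarrow> joined X b a"
  unfolding joined_def by (metis hd_rev last_rev ipath_rev set_rev)

lemma joined_mono: "joined X a b \<Longrightarrow> X \<subseteq> Y \<Longrightarrow> joined Y a b"
  unfolding joined_def by blast

lemma ipath_prefix: "ipath (xs @ ys) \<Longrightarrow> xs \<noteq> [] \<Longrightarrow> ipath xs"
  by (cases "ys = []") (auto simp: ipath_append)

lemma ipath_suffix: "ipath (xs @ ys) \<Longrightarrow> ys \<noteq> [] \<Longrightarrow> ipath ys"
  by (cases "xs = []") (auto simp: ipath_append)

lemma ipath_snoc:
  "p \<noteq> [] \<Longrightarrow> ipath (p @ [x]) \<longleftrightarrow> ipath p \<and> x \<notin> set p \<and> (\<forall>y\<in>set p. adj x y \<longleftrightarrow> y = last p)"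
  by (auto simp: ipath_append adj_sym)

text \<open>Cutting the path at its first vertex that equals or sees \<open>z\<close> makes the
  extension by \<open>z\<close> chordless; the old end point need not survive.\<close>

lemma joined_step:
  assumes "joined X a y" "adj y z" "z \<in> X" shows "joined X a z"
proof -
  obtain p where p: "ipath p" "hd p = a" "last p = y" "set p \<subseteq> X"
    using assms by (auto simp: joined_def)
  have "y \<in> set p" using p ipath_nonempty by auto
  then have "\<exists>w\<in>set p. w = z \<or> adj w z" using assms by blast
  from split_list_first_prop[OF this] obtain xs w ys where w: "p = xs @ w # ys" "w = z \<or> adj w z"
    "\<forall>x\<in>set xs. \<not> (x = z \<or> adj x z)" by blast
  have i: "ipath (xs @ [w])" using p w ipath_prefix[of "xs @ [w]" ys] by simp
  have h: "hd (xs @ [w]) = a" using p w by (cases xs) auto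
  have hw: "hd (xs @ w # r) = a" for r using h by (cases xs) auto
  show ?thesis
  proof (cases "w = z")
    case True
    then show ?thesis using i h p w
      unfolding joined_def by (intro exI[of _ "xs @ [w]"]) auto
  next
    case False
    then have "ipath ((xs @ [w]) @ [z])" using i w by (subst ipath_snoc) (auto simp: adj_sym)
    then show ?thesis using hw[of "[z]"] p w assms
      unfolding joined_def by (intro exI[of _ "xs @ [w, z]"]) auto
  qed
qed

lemma joined_trans:
  assumes "joined X a b" "joined X b c" shows "joined X a c"
proof -
  obtain p where "ipath p" "hd p = b" "last p = c" "set p \<subseteq> X"
    using assms by (auto simp: joined_def)
  then show ?thesis using assms(1)
  proof (induction p arbitrary: b)
    case (Cons x p)
    show ?case
    proof (cases "p = []")
      case False
      then have "adj x (hd p)" "ipath p" "hd p \<in> X" using Cons.prems by (auto simp: ipath_Cons)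
      then have "joined X a (hd p)" using joined_step Cons.prems by auto
      then show ?thesis using Cons.IH[of "hd p"] Cons.prems False \<open>ipath p\<close> by auto
    qed (use Cons in auto)
  qed simp
qed

definition conn :: "'a set \<Rightarrow> bool" where
  "conn X \<longleftrightarrow> X \<noteq> {} \<and> (\<forall>a\<in>X. \<forall>b\<in>X. joined X a b)"

text \<open>Agreement with reachability by walks: a walk is turned into an induced path one edge at
  a time.\<close>

lemma joined_iff_rtrancl:
  assumes "a \<in> X"
  shows "joined X a b \<longleftrightarrow> (a, b) \<in> {(x, y). {x, y} \<in> edges (induced_on G X)}\<^sup>*"
proof
  assume "joined X a b"
  then obtain p where "ipath p" "hd p = a" "last p = b" "set p \<subseteq> X"
    by (auto simp: joined_def)
  then show "(a, b) \<in> {(x, y). {x, y} \<in> edges (induced_on G X)}\<^sup>*"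
  proof (induction p arbitrary: a)
    case (Cons x p)
    show ?case
    proof (cases "p = []")
      case False
      then have "adj x (hd p)" "ipath p" "hd p \<in> X" using Cons.prems by (auto simp: ipath_Cons)
      then have "(x, hd p) \<in> {(x, y). {x, y} \<in> edges (induced_on G X)}" 
        using Cons.prems by (auto simp: edges_induced_on edges_in_doubleton)
      moreover have "(hd p, b) \<in> {(x, y). {x, y} \<in> edges (induced_on G X)}\<^sup>*"
        using Cons.IH[of "hd p"] Cons.prems False \<open>ipath p\<close> by auto
      ultimately show ?thesis using Cons.prems by (auto intro: converse_rtrancl_into_rtrancl)
    qed (use Cons in auto)
  qed simp
next
  assume "(a, b) \<in> {(x, y). {x, y} \<in> edges (induced_on G X)}\<^sup>*"
  then show "joined X a b"
  proof (induction rule: rtrancl_induct)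
    case base
    then show ?case using assms joined_refl by simp
  next
    case (step y z)
    then show ?case using joined_step[of X a y z]
      by (auto simp: edges_induced_on edges_in_doubleton)
  qed
qed

lemma graph_connected_induced_on: "graph_connected (induced_on G X) \<longleftrightarrow> conn X"
proof -
  have "vertices (induced_on G X) = X" by (simp add: induced_on_def)
  then show ?thesis unfolding graph_connected_def conn_def using joined_iff_rtrancl by auto
qed

lemma induced_on_vertices: "induced_on G (vertices G) = G"
proof -
  have "{e \<in> edges G. e \<subseteq> vertices G} = edges G" using simple by (auto simp: simple_graph_def)
  then show ?thesis by (simp add: induced_on_def)
qed

lemma graph_connected_conn: "graph_connected G \<longleftrightarrow> conn (vertices G)"
  using graph_connected_induced_on[of "vertices G"] induced_on_vertices by simp

lemma connI:
  assumes "a \<in> X" "\<And>b. b \<in> X \<Longrightarrow> joined X a b" shows "conn X"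
  unfolding conn_def using assms joined_sym joined_trans by blast

lemma conn_ipath: assumes "ipath p" shows "conn (set p)"
  using assms
proof (induction p)
  case (Cons x p)
  show ?case
  proof (cases "p = []")
    case True
    then show ?thesis by (auto intro!: connI joined_refl)
  next
    case False
    then have h: "conn (set p)" "adj x (hd p)" "hd p \<in> set p" using Cons by (auto simp: ipath_Cons)
    show ?thesis
    proof (rule connI[of "hd p"])
      fix b assume "b \<in> set (x # p)"
      then consider "b = x" | "b \<in> set p" by auto
      then show "joined (set (x # p)) (hd p) b"
      proof cases
        case 1
        then show ?thesis
          using joined_step[OF joined_refl] h(2,3) by (simp add: adj_sym)
      next
        case 2
        then show ?thesis using h joined_mono[of "set p" "hd p" b "set (x # p)"]
          by (auto simp: conn_def)
      qed
    qed (use False in auto)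
  qed
qed simp

lemma conn_Un:
  assumes "conn A" "conn B" "x \<in> A" "y \<in> B" "x = y \<or> adj x y" shows "conn (A \<union> B)"
proof (rule connI[of x])
  have 1: "joined (A \<union> B) x b" if "b \<in> A" for b
    using assms that joined_mono[of A x b] by (auto simp: conn_def)
  have 2: "joined (A \<union> B) y b" if "b \<in> B" for b
    using assms that joined_mono[of B y b] by (auto simp: conn_def)
  have 3: "joined (A \<union> B) x y" using assms joined_step[OF 1[OF assms(3)], of y] 1 by auto
  show "joined (A \<union> B) x b" if "b \<in> A \<union> B" for b using 1 2 3 joined_trans that by blast
qed (use assms in auto)

section \<open>Vertices suitable for elimination\<close>

text \<open>The interior of the path avoids the closed neighbourhood of \<open>v\<close>, so the
  path closes up with \<open>v\<close> to an induced cycle whose only neighbours of \<open>v\<close>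
  are \<open>a\<close> and \<open>b\<close>. Adjacent neighbours satisfy the condition by their
  edge. It is relative to \<open>X\<close>, the vertices not yet eliminated.\<close>

definition nice :: "'a set \<Rightarrow> 'a \<Rightarrow> bool" where
  "nice X v \<longleftrightarrow> v \<in> X \<and> (\<forall>a\<in>X. \<forall>b\<in>X. adj v a \<longrightarrow> adj v b \<longrightarrow> a \<noteq> b \<longrightarrow>
    joined ({a, b} \<union> {x \<in> X. x \<noteq> v \<and> \<not> adj v x}) a b)"

lemma joined_adj: "adj a b \<Longrightarrow> {a, b} \<subseteq> X \<Longrightarrow> joined X a b"
  using joined_step[OF joined_refl] by auto

lemma conn_insert: assumes "conn D" "d \<in> D" "adj d s" shows "conn (insert s D)"
proof -
  have "conn {s}" by (auto intro!: connI joined_refl)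
  then show ?thesis using conn_Un[OF assms(1) _ assms(2), of "{s}" s] assms(3) by simp
qed

text \<open>Take a connected set \<open>D\<close> of maximal size that misses the closed neighbourhood of some vertex.
  By maximality each vertex of \<open>X\<close> that is neither in \<open>D\<close> nor adjacent to \<open>D\<close> is adjacent to the
  whole attachment of \<open>D\<close>, so a suitable vertex of this remainder is suitable for \<open>X\<close>.\<close>

lemma nice_exists:
  assumes "finite X" "X \<noteq> {}" shows "\<exists>v. nice X v"
  using assms
proof (induction "card X" arbitrary: X rule: less_induct)
  case less
  define P where "P D \<longleftrightarrow> conn D \<and> D \<subseteq> X \<and> (\<exists>v\<in>X. v \<notin> D \<and> (\<forall>d\<in>D. \<not> adj v d))" for D
  show ?case
  proof (cases "\<exists>D. P D")
    case False
    \<comment> \<open>Two nonadjacent vertices would supply such a set with one element, so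
      \<open>X\<close> is complete and each of its vertices will do.\<close>
    have "adj a b" if "a \<in> X" "b \<in> X" "a \<noteq> b" for a b
    proof (rule ccontr)
      assume "\<not> adj a b"
      then have "P {a}" using that by (auto simp: P_def adj_sym intro!: connI joined_refl)
      then show False using False by blast
    qed
    then have "nice X v" if "v \<in> X" for v using that by (auto simp: nice_def intro!: joined_adj)
    then show ?thesis using less by blast
  next
    case True
    have "\<forall>D. P D \<longrightarrow> card D \<le> card X" using less by (auto simp: P_def card_mono)
    then have "\<exists>D. P D \<and> (\<forall>D'. P D' \<longrightarrow> card D' \<le> card D)"
      using True
        by (elim exE) (rule ex_has_greatest_nat[where b = "Suc (card X)"], auto simp: less_Suc_eq_le)
    then obtain D where D: "P D" "\<And>D'. P D' \<Longrightarrow> card D' \<le> card D" by blast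
    define S where "S = {s \<in> X. s \<notin> D \<and> (\<exists>d\<in>D. adj d s)}"
    define R where "R = X - D - S"
    have cD: "conn D" "D \<subseteq> X" "finite D" using D less finite_subset by (auto simp: P_def)
    have R: "R = {u \<in> X. u \<notin> D \<and> (\<forall>d\<in>D. \<not> adj u d)}" by (auto simp: R_def S_def adj_sym)
    \<comment> \<open>Otherwise \<open>insert s D\<close> is a larger connected set that still
      misses the closed neighbourhood of \<open>u\<close>.\<close>
    have RS: "adj u s" if us: "u \<in> R" "s \<in> S" for u s
    proof (rule ccontr)
      assume a: "\<not> adj u s"
      obtain d where d: "d \<in> D" "adj d s" using us by (auto simp: S_def)
      have "u \<noteq> s" using us R S_def adj_sym by auto
      then have "P (insert s D)" using us a conn_insert[OF cD(1) d] cD R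
        unfolding P_def by (auto simp: S_def)
      then have "card (insert s D) \<le> card D" using D by blast
      then show False using cD us by (auto simp: S_def)
    qed
    have "R \<noteq> {}" using D R by (auto simp: P_def)
    moreover have "R \<subset> X" using cD by (auto simp: R_def conn_def)
    moreover have "finite R" using less by (auto simp: R_def)
    ultimately obtain u where u: "nice R u"
      using less(1)[of R] less(2) psubset_card_mono by blast
    have uR: "u \<in> R" using u by (simp add: nice_def)
    have "joined ({a, b} \<union> {x \<in> X. x \<noteq> u \<and> \<not> adj u x}) a b"
      if ab: "a \<in> X" "b \<in> X" "adj u a" "adj u b" "a \<noteq> b" for a b
    proof -
      have aD: "a \<notin> D" "b \<notin> D" using uR that by (auto simp: R)
      consider "a \<in> R" "b \<in> R" | "a \<in> S" "b \<in> R" | "a \<in> R" "b \<in> S" | "a \<in> S" "b \<in> S"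
        using ab aD by (auto simp: R_def)
      then show ?thesis
      proof cases
        case 1
        then have "joined ({a, b} \<union> {x \<in> R. x \<noteq> u \<and> \<not> adj u x}) a b"
          using u that by (auto simp: nice_def)
        then show ?thesis by (rule joined_mono) (auto simp: R_def)
      next
        case 2
        then show ?thesis using RS[of b a] by (auto simp: adj_sym intro: joined_adj)
      next
        case 3
        then show ?thesis using RS[of a b] by (auto intro: joined_adj)
      next
        case 4
        \<comment> \<open>Both neighbours attach to \<open>D\<close>, and \<open>u\<close> sees no
          vertex of \<open>D\<close>, so the connection is made inside \<open>D\<close>.\<close>
        then obtain c d where cd: "c \<in> D" "adj c a" "d \<in> D" "adj d b" by (auto simp: S_def)
        have "conn (insert b (insert a D))"
          using conn_insert[OF conn_insert[OF cD(1) cd(1,2)], of d b] cd by simp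
        then have "joined (insert b (insert a D)) a b" by (auto simp: conn_def)
        then show ?thesis by (rule joined_mono) (use cD uR in \<open>auto simp: R\<close>)
      qed
    qed
    then have "nice X u" using uR by (auto simp: nice_def R_def)
    then show ?thesis by blast
  qed
qed

end

section \<open>Constructing solids\<close>

lemma ugraph_eqI:
  fixes G H :: "'a ugraph"
  shows "vertices G = vertices H \<Longrightarrow> edges G = edges H \<Longrightarrow> G = H"
  by (cases G, cases H) simp

lemma vertices_induced_on [simp]: "vertices (induced_on G X) = X"
  by (simp add: induced_on_def)

lemma all_less_3: "(\<forall>i<3. Q i) \<longleftrightarrow> Q 0 \<and> Q 1 \<and> Q (2::nat)"
  by (auto simp: numeral_3_eq_3 numeral_2_eq_2 less_Suc_eq)

lemma path_edges_bracket:
  "A \<noteq> [] \<Longrightarrow> path_edges (x # A @ [y]) = insert {x, hd A} (insert {last A, y} (path_edges A))"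
  by (auto simp: path_edges_Cons path_edges_append)

lemma vertices_path_graph: "vertices (path_graph p) = set p"
  by (simp add: path_graph_def)

lemma vertices_cycle_graph: "vertices (cycle_graph p) = set p"
  by (simp add: cycle_graph_def)

lemma graph_union_simps:
  "vertices (graph_union G H) = vertices G \<union> vertices H"
  "edges (graph_union G H) = edges G \<union> edges H"
  by (simp_all add: graph_union_def)

lemma edges_cycle_graph_3: "edges (cycle_graph [a, b, c]) = {{a, b}, {b, c}, {a, c}}"
  by (auto simp: edges_cycle_graph insert_commute)

context sgraph
begin

text \<open>Trihedra, stamps and prisms will arise from a cycle and a path outside it. With the few
  edges between the two listed in \<open>R\<close>, this yields the whole edge set.\<close>

lemma edges_in_Un_cross:
  assumes "R \<subseteq> X \<times> Y" "\<And>x y. x \<in> X \<Longrightarrow> y \<in> Y \<Longrightarrow> adj x y \<longleftrightarrow> (x, y) \<in> R"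
  shows "edges_in (X \<union> Y) = edges_in X \<union> edges_in Y \<union> (\<lambda>(x, y). {x, y}) ` R"
proof -
  have "{{x, y} | x y. x \<in> X \<and> y \<in> Y \<and> adj x y} = (\<lambda>(x, y). {x, y}) ` R"
    using assms by fastforce
  then show ?thesis by (simp add: edges_in_Un)
qed

text \<open>Induced subgraphs are determined by their vertex sets, so cycles, and later solids, are
  handled and counted as sets of vertices.\<close>

definition icycle :: "'a set \<Rightarrow> bool" where
  "icycle U \<longleftrightarrow> (\<exists>c. is_cycle c \<and> induced_on G U = cycle_graph c)"

text \<open>An induced cycle through \<open>v\<close>, cut open at \<open>v\<close>. Length two is
  allowed and yields a triangle.\<close>

definition closes :: "'a \<Rightarrow> 'a list \<Rightarrow> bool" where
  "closes v p \<longleftrightarrow> ipath p \<and> 2 \<le> length p \<and> v \<notin> set p \<and>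
    (\<forall>x\<in>set p. adj v x \<longleftrightarrow> x = hd p \<or> x = last p)"

lemma closes_rev: "closes v p \<Longrightarrow> closes v (rev p)"
  by (auto simp: closes_def hd_rev last_rev)

lemma edges_in_closes:
  assumes "closes v p"
  shows "edges_in (insert v (set p)) = insert {v, hd p} (insert {v, last p} (path_edges p))"
proof -
  have "ipath p" "p \<noteq> []" using assms by (auto simp: closes_def)
  moreover have "{{v, y} | y. y \<in> set p \<and> adj v y} = {{v, hd p}, {v, last p}}"
    using assms \<open>p \<noteq> []\<close> by (auto simp: closes_def)
  ultimately show ?thesis by (auto simp: edges_in_insert edges_in_ipath)
qed

lemma closes_icycle: assumes "closes v p" shows "icycle (insert v (set p))"
proof -
  have p: "p \<noteq> []" "distinct p" using assms ipath_distinct by (auto simp: closes_def)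
  have "is_cycle (v # p)" using assms p by (auto simp: is_cycle_def closes_def)
  moreover have "induced_on G (insert v (set p)) = cycle_graph (v # p)"
    using p by (intro ugraph_eqI)
      (auto simp: edges_induced_on edges_in_closes[OF assms] edges_cycle_graph path_edges_Cons
        vertices_cycle_graph)
  ultimately show ?thesis by (auto simp: icycle_def)
qed

lemma icycle_closes:
  assumes "icycle U" "v \<in> U" obtains p where "closes v p" "U = insert v (set p)"
proof -
  obtain c where c: "is_cycle c" "induced_on G U = cycle_graph c" using assms
    by (auto simp: icycle_def)
  have "c \<noteq> []" using c by (auto simp: is_cycle_def)
  have U: "U = set c" "edges_in U = edges (cycle_graph c)"
    using edges_induced_on[of U] vertices_induced_on[of G U]
    by (simp_all add: c(2) vertices_cycle_graph)
  then obtain xs ys where xy: "c = xs @ v # ys" using assms split_list by fast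
  \<comment> \<open>The cyclic rotation that puts \<open>v\<close> in front, with \<open>v\<close>
    removed.\<close>
  define p where "p = ys @ xs"
  have p: "distinct p" "2 \<le> length p" "v \<notin> set p" "p \<noteq> []" "U = insert v (set p)"
    using c U xy by (auto simp: is_cycle_def p_def)
  have E: "edges_in U = insert {v, hd p} (insert {v, last p} (path_edges p))"
  proof (cases "xs = [] \<or> ys = []")
    case True
    then show ?thesis using xy p \<open>c \<noteq> []\<close> unfolding U(2) p_def
      by (auto simp: edges_cycle_graph path_edges_Cons path_edges_append insert_commute)
  next
    case False
    then show ?thesis using xy p \<open>c \<noteq> []\<close> unfolding U(2) p_def
      by (auto simp: edges_cycle_graph path_edges_Cons path_edges_append insert_commute)
  qed
  have A: "adj x y \<longleftrightarrow> {x, y} \<in> insert {v, hd p} (insert {v, last p} (path_edges p))"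
    if "x \<in> U" "y \<in> U" for x y
    using that edges_in_doubleton[of x y U] E by simp
  have "ipath p" using p A by (intro ipathI_edges) (auto simp: doubleton_eq_iff)
  moreover have "adj v x \<longleftrightarrow> x = hd p \<or> x = last p" if "x \<in> set p" for x
    using A[of v x] p that path_edges_subset[of "{v, x}" p] by (auto simp: doubleton_eq_iff)
  ultimately show ?thesis using that[of p] p by (auto simp: closes_def)
qed

lemma icycle_vertices: assumes "icycle U" shows "U \<subseteq> vertices G"
proof
  fix v assume "v \<in> U"
  then obtain p where "closes v p" using icycle_closes assms by blast
  then have "adj v (hd p)" by (cases p) (auto simp: closes_def)
  then show "v \<in> vertices G" by (rule adj_vertices)
qed

lemma ipath_adj_vertices: assumes "ipath q" "adj (hd q) s" shows "set q \<subseteq> vertices G"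
proof (cases "length q \<ge> 2")
  case True
  then show ?thesis using ipath_vertices assms by blast
next
  case False
  then have "set q = {hd q}" using assms by (cases q) (auto simp: Suc_le_eq)
  then show ?thesis using assms adj_vertices by simp
qed

text \<open>On an induced path adjacency means being consecutive, so only the order of the two
  vertices is open.\<close>

lemma ipath_split_adj:
  assumes "ipath p" "t \<in> set p" "u \<in> set p" "adj t u"
  obtains A B where "p = A @ t # u # B" | A B where "p = A @ u # t # B"
proof -
  obtain A B where p: "p = A @ t # B" using assms split_list by fast
  have i: "ipath (A @ [t])" "ipath (t # B)"
    using assms p ipath_prefix[of "A @ [t]" B] ipath_suffix[of A "t # B"]
    by auto
  have "u \<noteq> t" using assms by auto
  then consider "u \<in> set A" | "u \<in> set B" using assms p by auto
  then show ?thesis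
  proof cases
    case 1
    then have "A \<noteq> []" by auto
    have "\<forall>y\<in>set A. adj t y \<longleftrightarrow> y = last A" using i(1) \<open>A \<noteq> []\<close> by (simp add: ipath_snoc)
    then have "u = last A" using 1 assms(4) by blast
    then have "p = butlast A @ u # t # B" using p \<open>A \<noteq> []\<close> by simp
    then show ?thesis using that by blast
  next
    case 2
    then have "B \<noteq> []" by auto
    have "\<forall>y\<in>set B. adj t y \<longleftrightarrow> y = hd B" using i(2) \<open>B \<noteq> []\<close> by (simp add: ipath_Cons)
    then have "u = hd B" using 2 assms(4) by blast
    then have "p = A @ t # u # tl B" using p \<open>B \<noteq> []\<close> by simp
    then show ?thesis using that by blast
  qed
qed

definition solid :: "'a set \<Rightarrow> bool" where
  "solid U \<longleftrightarrow> U \<subseteq> vertices G \<and>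
    (\<exists>S :: 'a ugraph. is_solid_graph S \<and> graph_isomorphic (induced_on G U) S)"

text \<open>All solids below are assembled on the vertices of \<open>G\<close> themselves, so the
  isomorphism in the definition is the identity.\<close>

lemma solidI:
  assumes "is_solid_graph S" "U \<subseteq> vertices G" "vertices S = U" "edges S = edges_in U"
  shows "solid U"
proof -
  have "S = induced_on G U"
    using assms by (intro ugraph_eqI) (simp_all add: edges_induced_on)
  moreover have "graph_isomorphic S S"
    unfolding graph_isomorphic_def by (intro exI[of _ id]) simp
  ultimately show ?thesis using assms unfolding solid_def by blast
qed

lemma solid_pyramid:
  assumes "icycle C" "w \<notin> C" "3 \<le> card {x \<in> C. adj w x}"
  shows "solid (insert w C)"
proof -
  obtain c where c: "is_cycle c" "induced_on G C = cycle_graph c" using assms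
    by (auto simp: icycle_def)
  have C: "C = set c" "edges_in C = edges (cycle_graph c)"
    using edges_induced_on[of C] vertices_induced_on[of G C]
    by (simp_all add: c(2) vertices_cycle_graph)
  define X where "X = {x \<in> C. adj w x}"
  define S where
    "S = graph_union (cycle_graph c) \<lparr>vertices = insert w X, edges = {{w, x} | x. x \<in> X}\<rparr>"
  have "X \<noteq> {}" using assms(3) unfolding X_def by force
  then have "w \<in> vertices G" using adj_vertices by (auto simp: X_def)
  moreover have "is_solid_graph S"
    unfolding is_solid_graph_def is_pyramid_def S_def
    using c assms C by (intro disjI1 exI[of _ c] exI[of _ w] exI[of _ X]) (auto simp: X_def)
  ultimately show ?thesis using icycle_vertices[OF assms(1)]
    by (intro solidI[of S])
      (auto simp: S_def graph_union_simps vertices_cycle_graph C(1)[symmetric] C(2)[symmetric]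
        edges_in_insert X_def)
qed

lemma solid_pyramidI:
  assumes "icycle C" "w \<notin> C" "{x, y, z} \<subseteq> C" "distinct [x, y, z]" "adj w x" "adj w y" "adj w z"
  shows "solid (insert w C)"
proof (rule solid_pyramid[OF assms(1,2)])
  have "finite C" using icycle_vertices[OF assms(1)] finite_vertices finite_subset by blast
  then have "card {x, y, z} \<le> card {x \<in> C. adj w x}" using assms by (intro card_mono) auto
  then show "3 \<le> card {x \<in> C. adj w x}" using assms(4) by simp
qed

text \<open>The two arcs of \<open>C\<close> between \<open>s\<close> and \<open>t\<close> together
  with \<open>q\<close> give the three paths. Since \<open>s\<close> and \<open>t\<close> are not
  adjacent, both arcs have interior vertices, as length at least 2 demands.\<close>

lemma solid_trihedron:
  assumes "icycle C" "s \<in> C" "t \<in> C" "s \<noteq> t" "\<not> adj s t" "ipath q" "set q \<inter> C = {}"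
    and cross: "\<And>x y. x \<in> set q \<Longrightarrow> y \<in> C \<Longrightarrow> adj x y \<longleftrightarrow> x = hd q \<and> y = s \<or> x = last q \<and> y = t"
  shows "solid (C \<union> set q)"
proof -
  obtain p where p: "closes s p" "C = insert s (set p)" using icycle_closes assms by blast
  obtain A B where AB: "p = A @ t # B" using p assms split_list[of t p] by auto
  have ne: "A \<noteq> []" "B \<noteq> []" "q \<noteq> []" using p AB assms by (auto simp: closes_def)
  have d: "distinct p" "distinct q" "s \<notin> set p"
    using p assms ipath_distinct by (auto simp: closes_def)
  have E: "edges_in C = insert {s, hd p} (insert {s, last p} (path_edges p))"
    using edges_in_closes p by simp
  have "edges_in (set q \<union> C) = path_edges q \<union> edges_in C \<union> (\<lambda>(x, y). {x, y}) ` {(hd q, s), (last q, t)}"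
    using edges_in_Un_cross[of "{(hd q, s), (last q, t)}" "set q" C] cross ne assms
    by (auto simp: edges_in_ipath)
  then have EU: "edges_in (C \<union> set q) = path_edges q \<union> edges_in C \<union> {{hd q, s}, {last q, t}}"
    by (simp add: Un_commute)
  define P where "P = (!) [s # A @ [t], s # rev B @ [t], s # q @ [t]]"
  have P: "P 0 = s # A @ [t]" "P 1 = s # rev B @ [t]" "P (Suc 0) = s # rev B @ [t]"
    "P 2 = s # q @ [t]"
    by (simp_all add: P_def)
  define S where "S = graph_union (path_graph (P 0)) (graph_union (path_graph (P 1)) (path_graph (P 2)))"
  have "is_trihedron S"
    unfolding is_trihedron_def S_def
  proof (intro exI conjI)
    show "\<forall>i<3. is_path s (P i) t \<and> 2 \<le> path_length (P i)"
      using ne d AB p assms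
      by (auto simp: all_less_3 P is_path_def path_length_def Suc_le_eq)
    show "\<forall>i<3. \<forall>j<3. i \<noteq> j \<longrightarrow> (set (P i) - {s, t}) \<inter> set (P j) = {}"
      using ne d AB p assms by (auto simp: all_less_3 P)
  qed (use assms in auto)
  moreover have "set q \<subseteq> vertices G"
    using ipath_adj_vertices[of q s] cross[of "hd q" s] ne assms by simp
  moreover have "vertices S = C \<union> set q"
    using p(2) AB by (auto simp: S_def P graph_union_simps vertices_path_graph)
  moreover have "edges S = edges_in (C \<union> set q)"
    unfolding S_def P graph_union_simps edges_path_graph EU E AB
    using ne by (simp add: path_edges_bracket path_edges_append path_edges_Cons last_rev hd_rev
      insert_commute Un_ac)
  ultimately show ?thesis
    using icycle_vertices[OF assms(1)] by (intro solidI[of S]) (simp_all add: is_solid_graph_def)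
qed

text \<open>The triangle consists of \<open>t\<close>, \<open>u\<close> and the last vertex of
  \<open>q\<close>; the common end point is \<open>s\<close>. Deleting the edge between
  \<open>t\<close> and \<open>u\<close> from \<open>C\<close> and cutting at \<open>s\<close> leaves
  two of the paths, and \<open>q\<close> extended by \<open>s\<close> is the third.\<close>

lemma solid_stamp:
  assumes "icycle C" "s \<in> C" "t \<in> C" "u \<in> C" "s \<noteq> t" "s \<noteq> u" "adj t u" "ipath q" "set q \<inter> C = {}"
    and cross: "\<And>x y. x \<in> set q \<Longrightarrow> y \<in> C \<Longrightarrow>
      adj x y \<longleftrightarrow> x = hd q \<and> y = s \<or> x = last q \<and> (y = t \<or> y = u)"
  shows "solid (C \<union> set q)"
proof -
  obtain p where p: "closes s p" "C = insert s (set p)" using icycle_closes assms by blast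
  have "ipath p" "t \<in> set p" "u \<in> set p" using p assms by (auto simp: closes_def)
  from ipath_split_adj[OF this \<open>adj t u\<close>]
  \<comment> \<open>The order of \<open>t\<close> and \<open>u\<close> along the cycle is unknown;
    the new names \<open>t'\<close> and \<open>u'\<close> fix it.\<close>
  have "\<exists>t' u' A B. p = A @ t' # u' # B \<and> {t', u'} = {t, u}"
    by (metis insert_commute)
  then obtain t' u' A B where AB: "p = A @ t' # u' # B" "{t', u'} = {t, u}" by blast
  have ne: "q \<noteq> []" using assms by auto
  have d: "distinct p" "distinct q" "s \<notin> set p"
    using p assms ipath_distinct by (auto simp: closes_def)
  have E: "edges_in C = insert {s, hd p} (insert {s, last p} (path_edges p))"
    using edges_in_closes p by simp
  have c: "adj x y \<longleftrightarrow> x = hd q \<and> y = s \<or> x = last q \<and> (y = t' \<or> y = u')"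
    if "x \<in> set q" "y \<in> C" for x y
    using cross[OF that] AB(2) by (auto simp: doubleton_eq_iff)
  have m: "t' \<in> C" "u' \<in> C" "hd q \<in> set q" "last q \<in> set q" using p(2) AB(1) ne by auto
  have "edges_in (set q \<union> C) = edges_in (set q) \<union> edges_in C \<union>
      (\<lambda>(x, y). {x, y}) ` {(hd q, s), (last q, t'), (last q, u')}"
    by (rule edges_in_Un_cross) (use m assms(2) c in \<open>simp_all, blast\<close>)
  then have EU: "edges_in (C \<union> set q) =
      path_edges q \<union> edges_in C \<union> {{hd q, s}, {last q, t'}, {last q, u'}}"
    by (simp add: Un_commute edges_in_ipath assms)
  define P where "P = (!) [t' # rev A @ [s], u' # B @ [s], rev q @ [s]]"
  have P: "P 0 = t' # rev A @ [s]" "P 1 = u' # B @ [s]" "P (Suc 0) = u' # B @ [s]"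
    "P 2 = rev q @ [s]"
    by (simp_all add: P_def)
  define T where "T = (!) [t', u', last q]"
  have T: "T 0 = t'" "T 1 = u'" "T (Suc 0) = u'" "T 2 = last q" by (simp_all add: T_def)
  define S where "S = graph_union (cycle_graph [T 0, T 1, T 2])
    (graph_union (path_graph (P 0)) (graph_union (path_graph (P 1)) (path_graph (P 2))))"
  have lq: "last q \<in> set q" "hd q \<in> set q" using ne by auto
  have dd: "t' \<notin> set A" "t' \<notin> set B" "u' \<notin> set A" "u' \<notin> set B" "t' \<noteq> u'" "s \<noteq> t'" "s \<noteq> u'"
    "s \<notin> set q" "t' \<notin> set q" "u' \<notin> set q"
    using d AB(1) p(2) assms(2,9) m(1,2) by auto
  have lC: "last q \<notin> set A" "last q \<notin> set B" "last q \<noteq> s" "last q \<noteq> t'" "last q \<noteq> u'"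
    using p(2) AB(1) lq(1) assms(9) by auto
  have "is_stamp S"
    unfolding is_stamp_def S_def
  proof (intro exI conjI)
    show "is_cycle [T 0, T 1, T 2]" "s \<notin> {T 0, T 1, T 2}"
      using ne d AB(1) p assms lq by (auto simp: T is_cycle_def)
    show "\<forall>i<3. is_path (T i) (P i) s \<and> 1 \<le> path_length (P i)"
      using ne d AB(1) p assms lq
      by (auto simp: all_less_3 P T is_path_def path_length_def Suc_le_eq hd_rev)
    show "\<forall>i<3. \<forall>j<3. i \<noteq> j \<longrightarrow> (set (P i) - {s}) \<inter> (set (P j) - {s}) = {}"
      using ne d AB(1) p assms by (auto simp: all_less_3 P)
    show "\<forall>i<3. set (P i) \<inter> {T 0, T 1, T 2} = {T i}"
      using dd lC lq by (simp add: all_less_3 P T)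
  qed (use assms in auto)
  moreover have "set q \<subseteq> vertices G"
    using ipath_adj_vertices[of q s] cross[of "hd q" s] ne assms by simp
  moreover have "vertices S = C \<union> set q"
    using p(2) AB(1) lq
    by (auto simp: S_def P T graph_union_simps vertices_path_graph vertices_cycle_graph)
  moreover have "edges S = edges_in (C \<union> set q)"
    unfolding S_def P T graph_union_simps edges_path_graph EU E AB(1)
    using ne
      by (cases "A = []"; cases "B = []"; simp add: path_edges_append path_edges_Cons last_rev hd_rev
      edges_cycle_graph_3 insert_commute Un_ac)
  ultimately show ?thesis
    using icycle_vertices[OF assms(1)] by (intro solidI[of S]) (simp_all add: is_solid_graph_def)
qed

text \<open>Each end of \<open>q\<close> forms a triangle with one of the two edges of
  \<open>C\<close>. The triangles are disjoint because these edges are and because \<open>q\<close>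
  has two different ends. The two remaining arcs of \<open>C\<close> and \<open>q\<close> itself
  join the triangles.\<close>

lemma solid_prism:
  assumes "icycle C" "s \<in> C" "r \<in> C" "t \<in> C" "u \<in> C" "adj s r" "adj t u" "{s, r} \<inter> {t, u} = {}"
    "ipath q" "2 \<le> length q" "set q \<inter> C = {}"
    and cross: "\<And>x y. x \<in> set q \<Longrightarrow> y \<in> C \<Longrightarrow>
      adj x y \<longleftrightarrow> x = hd q \<and> (y = s \<or> y = r) \<or> x = last q \<and> (y = t \<or> y = u)"
  shows "solid (C \<union> set q)"
proof -
  obtain p0 where p0: "closes s p0" "C = insert s (set p0)" using icycle_closes assms by blast
  have "r \<in> set p0" using assms p0 by auto
  then have "r = hd p0 \<or> r = last p0" using p0 assms by (auto simp: closes_def)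
  then have "\<exists>p. closes s p \<and> C = insert s (set p) \<and> r = hd p"
  proof
    assume "r = last p0"
    then show ?thesis using p0 closes_rev[OF p0(1)] by (intro exI[of _ "rev p0"]) (simp add: hd_rev)
  qed (use p0 in blast)
  then obtain p where p: "closes s p" "C = insert s (set p)" "r = hd p" by blast
  have "ipath p" "t \<in> set p" "u \<in> set p" using p assms by (auto simp: closes_def)
  from ipath_split_adj[OF this \<open>adj t u\<close>]
  have "\<exists>t' u' A B. p = A @ t' # u' # B \<and> {t', u'} = {t, u}"
    by (metis insert_commute)
  then obtain t' u' A B where AB: "p = A @ t' # u' # B" "{t', u'} = {t, u}" by blast
  have "r \<noteq> t'" "r \<noteq> u'" using AB(2) assms(8) by (auto simp: doubleton_eq_iff)
  then have neA: "A \<noteq> []" "hd A = r" using AB(1) p by (cases A; auto)+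
  have ne: "q \<noteq> []" using assms by auto
  have d: "distinct p" "distinct q" "s \<notin> set p"
    using p assms ipath_distinct by (auto simp: closes_def)
  have E: "edges_in C = insert {s, hd p} (insert {s, last p} (path_edges p))"
    using edges_in_closes p by simp
  have c: "adj x y \<longleftrightarrow> x = hd q \<and> (y = s \<or> y = r) \<or> x = last q \<and> (y = t' \<or> y = u')"
    if "x \<in> set q" "y \<in> C" for x y
    using cross[OF that] AB(2) by (auto simp: doubleton_eq_iff)
  have m: "t' \<in> C" "u' \<in> C" "hd q \<in> set q" "last q \<in> set q" using p(2) AB(1) ne by auto
  have "edges_in (set q \<union> C) = edges_in (set q) \<union> edges_in C \<union>
      (\<lambda>(x, y). {x, y}) ` {(hd q, s), (hd q, r), (last q, t'), (last q, u')}"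
    by (rule edges_in_Un_cross) (use m assms(2,3) c in \<open>simp_all, blast\<close>)
  then have EU: "edges_in (C \<union> set q) =
      path_edges q \<union> edges_in C \<union> {{hd q, s}, {hd q, r}, {last q, t'}, {last q, u'}}"
    by (simp add: Un_commute edges_in_ipath assms)
  define P where "P = (!) [A @ [t'], s # rev B @ [u'], q]"
  have P: "P 0 = A @ [t']" "P 1 = s # rev B @ [u']" "P (Suc 0) = s # rev B @ [u']" "P 2 = q"
    by (simp_all add: P_def)
  define X where "X = (!) [r, s, hd q]"
  have X: "X 0 = r" "X 1 = s" "X (Suc 0) = s" "X 2 = hd q" by (simp_all add: X_def)
  define Y where "Y = (!) [t', u', last q]"
  have Y: "Y 0 = t'" "Y 1 = u'" "Y (Suc 0) = u'" "Y 2 = last q" by (simp_all add: Y_def)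
  define S where "S = graph_union (graph_union (cycle_graph [X 0, X 1, X 2]) (cycle_graph [Y 0, Y 1, Y 2]))
    (graph_union (path_graph (P 0)) (graph_union (path_graph (P 1)) (path_graph (P 2))))"
  have lq: "last q \<in> set q" "hd q \<in> set q" "last q \<noteq> hd q"
    using ne assms d by (auto simp: last_conv_nth hd_conv_nth nth_eq_iff_index_eq)
  have rA: "r \<in> set A" using neA by auto
  have dd: "t' \<noteq> u'" "r \<noteq> s" "s \<noteq> t'" "s \<noteq> u'" using d AB(1) neA rA by auto
  have lC: "last q \<notin> C" "hd q \<notin> C" using lq assms(11) by auto
  then have lC': "last q \<noteq> s" "last q \<noteq> r" "last q \<noteq> t'" "last q \<noteq> u'"
    "hd q \<noteq> s" "hd q \<noteq> r" "hd q \<noteq> t'" "hd q \<noteq> u'"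
    using m assms(2,3) by blast+
  have "is_prism S"
    unfolding is_prism_def S_def
  proof (intro exI conjI)
    show "is_cycle [X 0, X 1, X 2]" "is_cycle [Y 0, Y 1, Y 2]"
        "{X 0, X 1, X 2} \<inter> {Y 0, Y 1, Y 2} = {}"
      using dd lC' lq \<open>r \<noteq> t'\<close> \<open>r \<noteq> u'\<close> by (auto simp: X Y is_cycle_def)
    show "\<forall>i<3. is_path (X i) (P i) (Y i)"
      using ne d neA by (simp add: AB(1) all_less_3 P X Y is_path_def)
    show "\<forall>i<3. \<forall>j<3. i \<noteq> j \<longrightarrow> set (P i) \<inter> set (P j) = {}"
      using d assms(11) unfolding p(2) AB(1) by (auto simp: all_less_3 P)
  qed (use assms in auto)
  moreover have "set q \<subseteq> vertices G" using ipath_vertices assms by blast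
  moreover have "vertices S = C \<union> set q"
    unfolding S_def P X Y graph_union_simps vertices_path_graph vertices_cycle_graph p(2) AB(1)
    using lq(1,2) rA by auto
  moreover have "edges S = edges_in (C \<union> set q)"
  proof -
    have "path_edges p = insert {last A, t'} (insert {t', u'} (path_edges A \<union> path_edges (u' # B)))"
      using neA by (simp add: AB(1) path_edges_append)
    moreover have "path_edges (P 0) = insert {last A, t'} (path_edges A)"
      using neA by (simp add: P path_edges_append)
    moreover have "path_edges (P 1) = insert {s, last p} (path_edges (u' # B))"
      using path_edges_Cons[of "rev (u' # B)" s] path_edges_rev[of "u' # B"]
      by (simp add: P AB(1) hd_rev)
    moreover have "edges (cycle_graph [X 0, X 1, X 2]) = {{s, hd p}, {hd q, s}, {hd q, r}}"
      "edges (cycle_graph [Y 0, Y 1, Y 2]) = {{t', u'}, {last q, t'}, {last q, u'}}"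
      using p(3) by (simp_all add: X Y edges_cycle_graph_3 insert_commute)
    ultimately show ?thesis
      unfolding S_def graph_union_simps edges_path_graph EU E P(4) by auto
  qed
  ultimately show ?thesis
    using icycle_vertices[OF assms(1)] by (intro solidI[of S]) (simp_all add: is_solid_graph_def)
qed

end

section \<open>Solids between two induced paths\<close>

text \<open>The common last element rules out that one list is a proper prefix of the other, since
  in a distinct list it occurs only at the end.\<close>

lemma lists_diverge:
  assumes "distinct p" "distinct q" "p \<noteq> []" "q \<noteq> []" "last p = last q" "p \<noteq> q"
  shows "\<exists>c x r y s. p = c @ x # r \<and> q = c @ y # s \<and> x \<noteq> y"
  using assms
proof (induction p arbitrary: q)
  case (Cons a p)
  obtain b q' where q: "q = b # q'" using Cons.prems by (cases q) auto
  show ?case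
  proof (cases "a = b")
    case False
    then show ?thesis using q by (intro exI[of _ "[]"]) auto
  next
    case True
    have "p \<noteq> []" "q' \<noteq> []" using Cons.prems q True by (auto split: if_splits)
    then have "\<exists>c x r y s. p = c @ x # r \<and> q' = c @ y # s \<and> x \<noteq> y"
      by (intro Cons.IH) (use Cons.prems q True in auto)
    then obtain c x r y s where "p = c @ x # r \<and> q' = c @ y # s \<and> x \<noteq> y" by blast
    then show ?thesis using q True by (intro exI[of _ "a # c"]) auto
  qed
qed simp

context sgraph
begin

lemma ipath_appendD:
  assumes "ipath (xs @ y # ys)" "xs \<noteq> []"
  shows "ipath xs" "ipath (y # ys)" "set xs \<inter> set (y # ys) = {}"
    "a \<in> set xs \<Longrightarrow> b \<in> set (y # ys) \<Longrightarrow> adj a b \<longleftrightarrow> a = last xs \<and> b = y"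
  using assms ipath_append[of xs "y # ys"] by (simp_all, blast)

text \<open>Because \<open>D\<close> is nonempty, nothing up to \<open>x\<close> sees anything from
  \<open>y\<close> on, so passing through \<open>l\<close> instead of \<open>D\<close> creates no
  chord.\<close>

lemma ipath_detour:
  assumes "ipath p" "p = A @ x # D @ y # B" "D \<noteq> []" "adj l x" "adj l y"
    "\<forall>w\<in>set A. \<not> adj l w" "\<forall>w\<in>set B. \<not> adj l w" "l \<notin> set p"
  shows "ipath (A @ x # l # y # B)"
proof -
  have i: "ipath (A @ [x])" "ipath (y # B)"
    using assms(1) ipath_prefix[of "A @ [x]" "D @ y # B"] ipath_suffix[of "A @ x # D" "y # B"]
    unfolding assms(2) by simp_all
  have pre: "ipath ((A @ [x]) @ hd D # (tl D @ y # B))" using assms(1-3) by (cases D) auto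
  have "adj w w' \<longleftrightarrow> w = x \<and> w' = l" if "w \<in> set (A @ [x])" "w' \<in> set (l # y # B)" for w w'
  proof (cases "w' = l")
    case True
    then show ?thesis using that(1) assms(4,6) adj_sym by auto
  next
    case False
    then have "w' \<in> set (y # B)" using that by auto
    moreover have "hd D \<notin> set (y # B)"
      using ipath_distinct[OF ipath_appendD(2)[OF pre]] by auto
    ultimately have "\<not> adj w w'" using ipath_appendD(4)[OF pre, of w w'] that(1) by auto
    then show ?thesis using False by simp
  qed
  moreover have "ipath (l # y # B)"
    using i(2) assms(5,7,8) unfolding assms(2) by (subst ipath_Cons) auto
  moreover have "set (A @ [x]) \<inter> set (l # y # B) = {}"
    using ipath_distinct[OF assms(1)] assms(8) unfolding assms(2) by auto
  ultimately have "ipath ((A @ [x]) @ l # y # B)" using i(1) by (subst ipath_append) auto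
  then show ?thesis by simp
qed

lemma closes_ends: assumes "closes v p" shows "hd p \<noteq> last p"
  using assms ipath_distinct[of p]
  by (cases p rule: path_edges.cases) (auto simp: closes_def)

text \<open>The solids through \<open>v\<close> in which \<open>v\<close> has exactly the two neighbours \<open>a\<close> and \<open>b\<close> connect
  the induced paths from \<open>a\<close> to \<open>b\<close>: from \<open>p\<close> one passes to a path \<open>r\<close> that is closer to
  \<open>q\<close>, and \<open>p \<union> r\<close> either is such a solid or has a path inside that splits the step into two
  smaller ones.\<close>

lemma path_exchange:
  assumes p: "closes v p" and q: "closes v q" and ends: "hd p = hd q" "last p = last q"
    and neq: "p \<noteq> q"
  shows "\<exists>r. closes v r \<and> hd r = hd p \<and> last r = last p \<and> set r \<union> set q \<subset> set p \<union> set q \<and>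
    set p \<union> set r \<subseteq> set p \<union> set q \<and>
    (solid (insert v (set p \<union> set r)) \<or>
      (\<exists>w. closes v w \<and> hd w = hd p \<and> last w = last p \<and>
        set p \<union> set w \<subset> set p \<union> set r \<and> set r \<union> set w \<subset> set p \<union> set r))"
proof -
  have ip: "ipath p" "ipath q" "p \<noteq> []" "q \<noteq> []" "distinct p" "distinct q"
    using p q ipath_distinct by (auto simp: closes_def)
  obtain c n r1 y0 r2 where div: "p = c @ n # r1" "q = c @ y0 # r2" "n \<noteq> y0"
    using lists_diverge[of p q] ip ends neq by metis
  have c: "c \<noteq> []"
    using div ends by auto
  note P = ipath_appendD[OF ip(1)[unfolded div(1)] c]
  note Q = ipath_appendD(2-)[OF ip(2)[unfolded div(2)] c]
  have lc: "last c \<in> set c" using c by simp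
  \<comment> \<open>Beyond \<open>c\<close> each of the induced paths has only one vertex adjacent
    to \<open>last c\<close>. So \<open>n\<close> cannot reappear on \<open>q\<close>, nor
    \<open>y0\<close> on \<open>p\<close>.\<close>
  have nq: "n \<notin> set (y0 # r2)" using P(4)[OF lc, of n] Q(3)[OF lc, of n] div(3) by auto
  have yp: "y0 \<notin> set (n # r1)" using P(4)[OF lc, of y0] Q(3)[OF lc, of y0] div(3) by auto
  have nr1: "n \<notin> set r1" using ipath_distinct[OF P(2)] by simp
  have r1: "r1 \<noteq> []"
  proof
    assume "r1 = []"
    then have "n = last q" using div(1) ends by simp
    then show False using nq div(2) by (metis last_appendR last_in_set list.distinct(1))
  qed
  have b: "last p \<in> set r1" "last p \<in> set (y0 # r2)"
    using r1 ends div
      by (simp_all, metis last_in_set list.distinct(1) last_ConsR last_ConsL list.set_intros)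
  \<comment> \<open>The detour \<open>K\<close> follows \<open>q\<close> from \<open>y0\<close> to
    the first vertex \<open>z\<close> that touches \<open>r1\<close>, the part of \<open>p\<close>
    beyond \<open>n\<close>. By this choice \<open>z\<close> is the only vertex of \<open>K\<close>
    with neighbours in \<open>r1\<close>.\<close>
  define near where "near x \<longleftrightarrow> x \<in> set r1 \<or> (\<exists>y\<in>set r1. adj x y)" for x
  have "\<exists>x\<in>set (y0 # r2). near x" using b by (auto simp: near_def)
  from split_list_first_prop[OF this] obtain Q0 z R
    where z: "y0 # r2 = Q0 @ z # R" "near z" "\<forall>x\<in>set Q0. \<not> near x" by blast
  have zr: "z \<notin> set r1"
  proof
    assume z1: "z \<in> set r1"
    then have "Q0 \<noteq> []" using z yp by (cases Q0) auto
    then have "adj (last Q0) z" "last Q0 \<in> set Q0"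
      using Q(1) unfolding z(1) by (simp_all add: ipath_append)
    then show False using z(3) z1 by (auto simp: near_def)
  qed
  define K where "K = Q0 @ [z]"
  have K: "y0 # r2 = K @ R" "K \<noteq> []" "hd K = y0" "last K = z" "set K = insert z (set Q0)"
    using z(1)
      by (auto simp: K_def hd_append split: if_splits) (metis hd_append2 list.sel(1) self_append_conv2 hd_append)
  have iK: "ipath K" "distinct K" using Q(1) K ipath_prefix ipath_distinct by metis+
  have KQ: "set K \<subseteq> set (y0 # r2)" unfolding K(1) by auto
  have Kr1: "set K \<inter> set r1 = {}" using zr z(3) by (auto simp: K(5) near_def)
  have Kn: "n \<notin> set K" using nq KQ by blast
  have Kc: "set K \<inter> set c = {}" using Q(2) KQ by blast
  have cK: "adj x y \<longleftrightarrow> x = last c \<and> y = y0" if "x \<in> set c" "y \<in> set K" for x y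
    using Q(3) that KQ by blast
  have Q0r1: "\<not> adj x y" if "x \<in> set Q0" "y \<in> set r1" for x y
    using z(3) that by (auto simp: near_def)
  have vK: "\<not> adj v x" "v \<noteq> x" if "x \<in> set K" for x
  proof -
    have "x \<in> set q" "x \<noteq> hd q" "x \<noteq> last q"
      using that KQ Kc Kr1 b(1) ends div(2) c by auto
    then show "\<not> adj v x" "v \<noteq> x" using q by (auto simp: closes_def)
  qed
  \<comment> \<open>Rejoining \<open>p\<close> at the last neighbour \<open>y\<close> of
    \<open>z\<close> leaves no chord, so the path \<open>r\<close> formed from \<open>c\<close>,
    \<open>K\<close> and \<open>y # B\<close> is again induced.\<close>
  have "\<exists>y\<in>set r1. adj z y" using z(2) zr by (simp add: near_def)
  from split_list_last_prop[OF this] obtain M y B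
    where y: "r1 = M @ y # B" "adj z y" "\<forall>x\<in>set B. \<not> adj z x" by blast
  have yB: "set (y # B) \<subseteq> set r1" "ipath (y # B)"
    using P(2) ipath_suffix[of "n # M" "y # B"] unfolding y(1) by auto
  have iKyB: "ipath (K @ y # B)"
  proof -
    have "adj x w \<longleftrightarrow> x = z \<and> w = y" if "x \<in> set K" "w \<in> set (y # B)" for x w
      using that yB Q0r1 y by (auto simp: K(5))
    then show ?thesis using iK yB Kr1 K by (subst ipath_append) auto
  qed
  define r where "r = c @ K @ y # B"
  \<comment> \<open>\<open>v\<close> sees no vertex of \<open>K\<close>, so an induced path inside
    \<open>p\<close> and \<open>K\<close> with the right ends automatically closes up with
    \<open>v\<close>.\<close>
  have closesI: "closes v w"
    if w: "ipath w" "hd w = hd p" "last w = last p" "set w \<subseteq> set p \<union> set K" for w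
  proof -
    have ne: "hd p \<noteq> last p" using closes_ends p by blast
    then have "2 \<le> length w" using w by (cases w rule: path_edges.cases) auto
    moreover have "adj v x \<longleftrightarrow> x = hd p \<or> x = last p" if "x \<in> set w" for x
    proof -
      have "hd p \<in> set c" using div(1) c by simp
      then have "x \<noteq> hd p \<and> x \<noteq> last p" if "x \<in> set K" using that Kc Kr1 b(1) by auto
      then show ?thesis using w that vK p by (auto simp: closes_def)
    qed
    ultimately show ?thesis using w vK p by (auto simp: closes_def)
  qed
  have cyB: "\<not> adj x w" if "x \<in> set c" "w \<in> set r1" for x w
  proof -
    have "w \<noteq> n" using that P(2) by (auto dest: ipath_distinct)
    then show ?thesis using P(4)[of x w] that by auto
  qed
  have ir: "ipath r"
  proof -
    have "adj x w \<longleftrightarrow> x = last c \<and> w = hd K" if "x \<in> set c" "w \<in> set (K @ y # B)" for x w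
    proof (cases "w \<in> set K")
      case True
      then show ?thesis using cK that K(3) by auto
    next
      case False
      then show ?thesis using that yB cyB K(2) by auto
    qed
    moreover have "set c \<inter> set (K @ y # B) = {}" using Kc P(3) yB by auto
    ultimately show ?thesis unfolding r_def using P(1) iKyB K(2) c by (subst ipath_append) auto
  qed
  have hr: "hd r = hd p" "last r = last p"
    using c y(1) by (simp_all add: r_def div(1))
  have sr: "set r = set c \<union> set K \<union> set (y # B)" by (auto simp: r_def)
  have sp: "set p = set c \<union> insert n (set r1)" by (auto simp: div(1))
  have cr: "closes v r" using ir hr sr sp yB by (intro closesI) auto
  have union: "set p \<union> set r = set p \<union> set K" using sr sp yB by auto
  have nr: "n \<notin> set r" using Kn P(3) yB nr1 sr by auto
  have A1: "set r \<union> set q \<subset> set p \<union> set q"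
  proof -
    \<comment> \<open>The inclusion is strict because \<open>n\<close> is lost: it lies on
      \<open>p\<close>, but neither on \<open>q\<close> nor on \<open>r\<close>.\<close>
    have "n \<notin> set q" using nq P(3) div(2) by auto
    moreover have "set r \<subseteq> set p \<union> set q" using sr sp yB KQ div(2) by auto
    ultimately show ?thesis using nr sp by blast
  qed
  have A2: "set p \<union> set r \<subseteq> set p \<union> set q" using union KQ div(2) by auto
  \<comment> \<open>The candidate for the solid is this cycle with \<open>K\<close> as an outside
    path. \<open>K\<close> attaches through \<open>y0\<close> at \<open>last c\<close> and through
    \<open>z\<close> at vertices of \<open>n # r1\<close>; further edges from \<open>n\<close> to
    \<open>K\<close> are the source of the exceptional cases.\<close>
  define C where "C = insert v (set p)"
  have C: "icycle C" using closes_icycle p by (simp add: C_def)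
  have "v \<notin> set K" using vK(2) by blast
  then have KC: "set K \<inter> C = {}" using Kn Kc Kr1 sp by (auto simp: C_def)
  have CU: "insert v (set p \<union> set r) = C \<union> set K" by (auto simp: C_def union)
  have pn: "adj (last c) n" using P(4)[OF lc] by simp
  have pq: "adj (last c) y0" using cK[OF lc, of y0] K by (metis hd_in_set)
  have yr1: "y \<in> set r1" using y by simp
  have py: "\<not> adj (last c) y" "last c \<noteq> y" using cyB[OF lc yr1] P(3) lc yr1 by auto
  have inC: "last c \<in> C" "n \<in> C" "y \<in> C" using lc yr1 sp by (auto simp: C_def)
  have "solid (C \<union> set K) \<or>
      (\<exists>w. closes v w \<and> hd w = hd p \<and> last w = last p \<and>
        set p \<union> set w \<subset> set p \<union> set r \<and> set r \<union> set w \<subset> set p \<union> set r)"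
  proof (cases "Q0 = []")
    case True
    then have Kz: "K = [z]" "z = y0" using K by (auto simp: K_def)
    have sub: "{last c, y} \<subseteq> {w \<in> C. adj z w}" using pq y inC Kz by (auto simp: adj_sym)
    have fin: "finite {w \<in> C. adj z w}" by (simp add: C_def)
    show ?thesis
    proof (cases "3 \<le> card {w \<in> C. adj z w}")
      case True
      then have "solid (insert z C)" using solid_pyramid[OF C, of z] KC Kz by auto
      then show ?thesis by (simp add: Kz)
    next
      case False
      have "{last c, y} = {w \<in> C. adj z w}"
        using False py(2) by (intro card_seteq fin sub) auto
      then have "adj z w \<longleftrightarrow> w = last c \<or> w = y" if "w \<in> C" for w using that by blast
      then have "solid (C \<union> set K)"
        using py inC KC iK by (intro solid_trihedron[OF C, of "last c" y]) (auto simp: Kz)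
      then show ?thesis by simp
    qed
  next
    case Q0: False
    have y0Q: "y0 \<in> set Q0" using K(3) Q0 by (auto simp: K_def)
    have zy: "z \<noteq> y0" using y0Q iK(2) by (auto simp: K_def)
    show ?thesis
    \<comment> \<open>If this fails, \<open>n\<close> has at most one neighbour in \<open>K\<close>,
      and that is \<open>y0\<close> or \<open>z\<close>.\<close>
    proof (cases "\<exists>u\<in>set K. u \<noteq> y0 \<and> adj n u \<and> (\<exists>u\<in>set Q0. adj n u)")
      case True
      then have "\<exists>u\<in>set K. adj n u" by blast
      from split_list_last_prop[OF this] obtain Qa u Qb
        where u: "K = Qa @ u # Qb" "adj n u" "\<forall>x\<in>set Qb. \<not> adj n x" by blast
      have Qa: "Qa \<noteq> []"
      proof
        assume "Qa = []"
        then show False using True u K(3) by auto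
      qed
      have y0Qa: "y0 \<in> set Qa" using K(3) Qa u(1) by auto
      show ?thesis
      proof (cases "M = []")
        case True
        have "adj n y" using P(2) True y(1) by (simp add: ipath_Cons)
        \<comment> \<open>With \<open>M\<close> empty, \<open>y\<close> follows \<open>n\<close> on
          \<open>p\<close>. So \<open>n\<close> sees \<open>last c\<close>, \<open>u\<close> and
          \<open>y\<close> on the cycle through \<open>r\<close> and is the apex of a
          pyramid.\<close>
        then have "solid (insert n (insert v (set r)))"
          using nr p sp u lc pn py Kc Kr1 yr1 adj_sym[of n "last c"]
          by (intro solid_pyramidI[OF closes_icycle[OF cr], of n "last c" u y])
            (auto simp: closes_def sr)
        moreover have "insert n (insert v (set r)) = C \<union> set K"
          using True y(1) by (auto simp: C_def sr sp)
        ultimately show ?thesis by simp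
      next
        case M: False
        \<comment> \<open>By going from \<open>n\<close> directly to its last neighbour
          \<open>u\<close> on \<open>K\<close>, this path skips both \<open>y0\<close> and
          \<open>hd M\<close>. The union with \<open>p\<close> thus loses \<open>y0\<close>, and the
          union with \<open>r\<close> loses \<open>hd M\<close>.\<close>
        define w where "w = c @ n # u # Qb @ y # B"
        have i1: "ipath (u # Qb @ y # B)" using iKyB ipath_suffix[of Qa "u # Qb @ y # B"] u(1)
          by simp
        have hM: "hd r1 = hd M" "hd M \<in> set r1" "hd M \<notin> set (y # B)"
          using M y(1) ipath_distinct[OF P(2)] by (cases M; auto)+
        have n1: "\<not> adj n x" if "x \<in> set (y # B)" for x
        proof -
          have "adj n x \<longleftrightarrow> x = hd r1" using P(2) r1 that yB by (auto simp: ipath_Cons)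
          then show ?thesis using hM that by auto
        qed
        have i2: "ipath (n # u # Qb @ y # B)"
        proof -
          have "adj n x \<longleftrightarrow> x = u" if "x \<in> set (u # Qb @ y # B)" for x
            using that u n1 by auto
          moreover have "n \<notin> set (u # Qb @ y # B)" using nr by (auto simp: sr u(1))
          ultimately show ?thesis using i1 by (subst ipath_Cons) auto
        qed
        have "ipath w"
        proof -
          have y0u: "y0 \<notin> set (u # Qb)" using y0Qa iK(2) u(1) by auto
          have "adj x x' \<longleftrightarrow> x = last c \<and> x' = n"
            if x: "x \<in> set c" "x' \<in> set (n # u # Qb @ y # B)" for x x'
          proof -
            consider "x' = n" | "x' \<in> set (u # Qb)" | "x' \<in> set (y # B)" using x by auto
            then show ?thesis
            proof cases
              case 1
              then show ?thesis using P(4) x by auto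
            next
              case 2
              then have "x' \<in> set K" "x' \<noteq> y0" "x' \<noteq> n" using u(1) y0u Kn by auto
              then show ?thesis using cK x by auto
            next
              case 3
              then show ?thesis using cyB yB x nr sr by blast
            qed
          qed
          moreover have "set c \<inter> set (n # u # Qb @ y # B) = {}"
            using P(3) Kc yB by (auto simp: u(1))
          ultimately show ?thesis unfolding w_def using P(1) i2 c by (subst ipath_append) auto
        qed
        moreover have "hd w = hd p" "last w = last p" using c y(1) by (simp_all add: w_def div(1))
        moreover have sw: "set w \<subseteq> set p \<union> set K" using yB by (auto simp: w_def sp u(1))
        ultimately have w: "closes v w" "hd w = hd p" "last w = last p" by (auto intro: closesI)
        have "y0 \<notin> set w"
          using y0Qa iK(2) u(1) Kc Kn Kr1 yB by (auto simp: w_def)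
        then have "set p \<union> set w \<subset> set p \<union> set r"
          using sw KC y0Qa unfolding union C_def by (auto simp: u(1))
        moreover have "hd M \<notin> set r \<union> set w"
          using hM P(3) nr1 Kr1 sr by (auto simp: w_def u(1))
        moreover have "hd M \<in> set p" "set w \<subseteq> set p \<union> set r" using sw hM(2) sp union by auto
        ultimately show ?thesis using w by blast
      qed
    next
      case beta: False
      have vp: "v \<notin> set p" using p by (simp add: closes_def)
      have lcn: "last c \<noteq> n" "last c \<notin> set r1" "n \<notin> set c" "y \<notin> set c"
        using lc P(3) yr1 by auto
      have vn: "v \<noteq> last c" "v \<noteq> n" "v \<notin> set r1" "v \<noteq> y" "v \<notin> set c"
        using vp lc sp yr1 by auto
      have zC: "y0 \<notin> C" "z \<notin> C" using KC y0Q K(5) by auto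
      have len: "2 \<le> length K" using Q0 by (cases Q0) (auto simp: K_def)
      have ny: "n \<noteq> y" using nr1 yr1 by auto
      have rK: "ipath (rev K)" "hd (rev K) = z" "last (rev K) = y0" "set (rev K) \<inter> C = {}"
        using iK K KC by (auto simp: hd_rev last_rev)
      have zn: "\<not> adj z n" if "adj n y0"
        using beta that y0Q zy adj_sym[of z n] by (auto simp: K(5))
      \<comment> \<open>All edges between \<open>K\<close> and the cycle. At the end
        \<open>y0\<close> there is one attachment, or two if \<open>n\<close> sees
        \<open>y0\<close>. If \<open>z\<close> has one neighbour or two consecutive ones on
        \<open>n # r1\<close>, the four combinations give a trihedron, two kinds of stamps and a
        prism.\<close>
      have cross: "adj x w \<longleftrightarrow> x = y0 \<and> (w = last c \<or> w = n \<and> adj n y0) \<or> x = z \<and> w \<in> set (n # r1) \<and> adj z w"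
        if xw: "x \<in> set K" "w \<in> C" for x w
      proof -
        consider "w = v" | "w \<in> set c" | "w = n" | "w \<in> set r1" using xw by (auto simp: C_def sp)
        then show ?thesis
        proof cases
          case 1
          then show ?thesis using vK[OF xw(1)] adj_sym[of x v] vn by auto
        next
          case 2
          then show ?thesis using cK[of w x] xw adj_sym[of x w] P(3) by auto
        next
          case 3
          have "\<not> adj n x" if "x \<noteq> y0" "x \<noteq> z" using beta that xw by (auto simp: K(5))
          then show ?thesis using 3 zy lcn adj_sym[of x n] by auto
        next
          case 4
          then show ?thesis using xw Q0r1 zy nr1 lcn by (auto simp: K(5))
        qed
      qed
      show ?thesis
      proof (cases "\<exists>x\<in>set (n # M). adj z x")
        case False
        then have zr1: "w \<in> set (n # r1) \<and> adj z w \<longleftrightarrow> w = y" for w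
          using y by auto
        show ?thesis
        proof (cases "adj n y0")
          case True
          have "adj x w \<longleftrightarrow> x = hd (rev K) \<and> w = y \<or> x = last (rev K) \<and> (w = last c \<or> w = n)"
            if "x \<in> set (rev K)" "w \<in> C" for x w
            using cross[of x w] that zr1 True by (auto simp: rK)
          then have "solid (C \<union> set (rev K))"
            using rK inC py ny pn by (intro solid_stamp[OF C, of y "last c" n]) auto
          then show ?thesis by simp
        next
          case False
          have "adj x w \<longleftrightarrow> x = hd K \<and> w = last c \<or> x = last K \<and> w = y"
            if "x \<in> set K" "w \<in> C" for x w
            using cross[OF that] zr1 False K by auto
          then have "solid (C \<union> set K)"
            using inC py KC iK by (intro solid_trihedron[OF C, of "last c" y]) auto
          then show ?thesis by simp
        qed
      next
        case True
        from split_list_first_prop[OF this] obtain M1 x D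
          where x: "n # M = M1 @ x # D" "adj z x" "\<forall>w\<in>set M1. \<not> adj z w" by blast
        have split1: "n # r1 = M1 @ x # D @ y # B" using x(1) y(1)
          by (metis append_Cons append_assoc)
        have pp: "p = (c @ M1 @ [x]) @ D @ y # B" using split1 div(1) by simp
        have xC: "x \<in> C" unfolding C_def pp by simp
        have xc: "x \<notin> set c" "x \<noteq> last c" using P(3) split1 lc by (auto simp: disjoint_iff)
        show ?thesis
        proof (cases "D = []")
          case True
          have axy: "adj x y" "x \<noteq> y"
            using ipath_appendD(4)[OF ip(1)[unfolded pp True append_Nil], of x y] by auto
          have zr1: "w \<in> set (n # r1) \<and> adj z w \<longleftrightarrow> w = x \<or> w = y" for w
            using x y unfolding split1 True by auto
          show ?thesis
          proof (cases "adj n y0")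
            case an: True
            have xn: "x \<noteq> n" using zn[OF an] x(2) by auto
            have "adj x' w \<longleftrightarrow> x' = hd K \<and> (w = last c \<or> w = n) \<or> x' = last K \<and> (w = x \<or> w = y)"
              if "x' \<in> set K" "w \<in> C" for x' w
              using cross[OF that] zr1 an K by auto
            then have "solid (C \<union> set K)"
              using inC xC py KC iK pn axy xc xn ny len
              by (intro solid_prism[OF C, of "last c" n x y]) auto
            then show ?thesis by simp
          next
            case an: False
            have "adj x' w \<longleftrightarrow> x' = hd K \<and> w = last c \<or> x' = last K \<and> (w = x \<or> w = y)"
              if "x' \<in> set K" "w \<in> C" for x' w
              using cross[OF that] zr1 an K by auto
            then have "solid (C \<union> set K)"
              using inC xC py KC iK axy xc
              by (intro solid_stamp[OF C, of "last c" x y]) auto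
            then show ?thesis by simp
          qed
        next
          case D: False
          \<comment> \<open>Here \<open>z\<close> replaces the nonempty segment \<open>D\<close> of
            \<open>p\<close>. The union with \<open>p\<close> lacks \<open>y0\<close>, and the union
            with \<open>r\<close> lacks \<open>hd D\<close>.\<close>
          define w where "w = (c @ M1) @ x # z # y # B"
          have p': "p = (c @ M1) @ x # D @ y # B" using pp by simp
          have hD: "hd D \<in> set D" "hd D \<notin> set (c @ M1 @ x # y # B)"
            using ip(5) D unfolding p' by (cases D; auto)+
          have "ipath w" unfolding w_def
          proof (rule ipath_detour[OF ip(1) p' D])
            show "adj z x" "adj z y" "\<forall>w\<in>set B. \<not> adj z w" using x y by auto
            show "\<forall>w\<in>set (c @ M1). \<not> adj z w" using x(3) cK[of _ z] K(5) zy adj_sym[of z] by auto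
            show "z \<notin> set p" using zC by (simp add: C_def)
          qed
          moreover have hw: "hd w = hd p" "last w = last p" using c by (simp_all add: w_def pp)
          moreover have sw: "set w \<subseteq> insert z (set p)" by (auto simp: w_def pp)
          ultimately have "closes v w" using K(5) by (intro closesI) auto
          moreover have "y0 \<notin> set p" "y0 \<in> set K" using zC y0Q K(5) by (auto simp: C_def)
          then have "set p \<union> set w \<subset> set p \<union> set r" using sw zy K(5) unfolding union by auto
          moreover have "hd D \<notin> set r"
            using hD KC unfolding sr C_def p' by auto
          then have "hd D \<notin> set r \<union> set w"
            using hD zC(2) unfolding w_def C_def p' by auto
          moreover have "hd D \<in> set p" using hD by (simp add: pp)
          ultimately have "closes v w \<and> hd w = hd p \<and> last w = last p \<and>
            set p \<union> set w \<subset> set p \<union> set r \<and> set r \<union> set w \<subset> set p \<union> set r"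
            using sw K(5) union hw by auto
          then show ?thesis by blast
        qed
      qed
    qed
  qed
  then show ?thesis using cr hr A1 A2 CU by metis
qed


section \<open>Counting solids over a pair of neighbours\<close>

text \<open>The three paths are compared simultaneously. After a common initial part, the next
  vertex of each lies on another of them and sees the last common vertex, so it is the next vertex
  there too. Three vertices each of which equals another one are all equal.\<close>

lemma ipaths_eq:
  assumes "ipath p" "ipath q" "ipath r" "hd p = hd q" "hd p = hd r" "last p = last q"
    "last p = last r"
    "set p \<subseteq> set q \<union> set r" "set q \<subseteq> set p \<union> set r" "set r \<subseteq> set p \<union> set q"
  shows "p = q"
proof -
  have ne: "p \<noteq> []" "q \<noteq> []" "r \<noteq> []" using assms by auto
  \<comment> \<open>A proper initial part of \<open>p\<close> cannot exhaust \<open>s\<close>, for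
    then the last vertex of \<open>p\<close> would occur on \<open>p\<close> twice.\<close>
  have longer: "k < length s"
    if "ipath s" "take k p = take k s" "last p = last s" "k < length p" "0 < k" for s k
  proof (rule ccontr)
    assume "\<not> k < length s"
    then have "s = take k p" using that by simp
    then have "last p \<in> set (take k p)" using that(1,3) ipath_nonempty last_in_set by metis
    moreover have "last p \<in> set (drop k p)" using that ne
      by (metis last_drop last_in_set drop_eq_Nil not_less)
    ultimately show False
      using ipath_distinct[OF assms(1)] set_take_disj_set_drop_if_distinct[of p k k] by auto
  qed
  have prefixes: "k \<le> length p \<Longrightarrow> take k p = take k q \<and> take k p = take k r" for k
  proof (induction k)
    case (Suc k)
    then have IH: "take k p = take k q" "take k p = take k r" "k < length p" by auto
    show ?case
    proof (cases "k = 0")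
      case True
      then show ?thesis using ne assms(4,5) by (cases p; cases q; cases r) auto
    next
      case False
      define c where "c = take k p"
      have c: "c \<noteq> []" using False ne by (simp add: c_def)
      have len: "k < length q" "k < length r" using longer assms IH False by blast+
      have pd: "p = c @ p ! k # drop (Suc k) p" "q = c @ q ! k # drop (Suc k) q"
        "r = c @ r ! k # drop (Suc k) r"
        using IH len unfolding c_def by (metis append_take_drop_id Cons_nth_drop_Suc)+
      have key: "x = s ! k" if "ipath s" "s = c @ s ! k # drop (Suc k) s" "x \<in> set s" "x \<notin> set c"
        "adj (last c) x" for s x
      proof -
        have i: "ipath (c @ s ! k # drop (Suc k) s)" using that by simp
        have "x \<in> set (s ! k # drop (Suc k) s)" using that(2,3,4) by (metis Un_iff set_append)
        then show ?thesis using ipath_appendD(4)[OF i c, of "last c" x] that(5) c by simp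
      qed
      have step: "adj (last c) (s ! k)" "s ! k \<notin> set c" "s ! k \<in> set s"
        if "ipath s" "s = c @ s ! k # drop (Suc k) s" for s
      proof -
        have i: "ipath (c @ s ! k # drop (Suc k) s)" using that by simp
        show "adj (last c) (s ! k)" using ipath_appendD(4)[OF i c, of "last c" "s ! k"] c by simp
        show "s ! k \<notin> set c" using ipath_appendD(3)[OF i c] by auto
        show "s ! k \<in> set s" using that(2) by (metis in_set_conv_decomp)
      qed
      have kk: "s ! k = s1 ! k \<or> s ! k = s2 ! k"
        if "ipath s" "s = c @ s ! k # drop (Suc k) s" "ipath s1" "s1 = c @ s1 ! k # drop (Suc k) s1"
          "ipath s2" "s2 = c @ s2 ! k # drop (Suc k) s2" "set s \<subseteq> set s1 \<union> set s2" for s s1 s2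
        using step[OF that(1,2)] key[OF that(3,4)] key[OF that(5,6)] that(7) by blast
      have "p ! k = q ! k \<or> p ! k = r ! k" "q ! k = p ! k \<or> q ! k = r ! k"
          "r ! k = p ! k \<or> r ! k = q ! k"
        using kk[OF assms(1) pd(1) assms(2) pd(2) assms(3) pd(3)] kk[OF assms(2) pd(2) assms(1) pd(1) assms(3) pd(3)]
          kk[OF assms(3) pd(3) assms(1) pd(1) assms(2) pd(2)] assms by blast+
      then have "q ! k = p ! k" "r ! k = p ! k" by metis+
      then show ?thesis
        using IH len by (simp add: take_Suc_conv_app_nth)
    qed
  qed simp
  have t: "take (length p) q = p" using prefixes[of "length p"] by simp
  show ?thesis
  proof (rule ccontr)
    assume "p \<noteq> q"
    then have d: "drop (length p) q \<noteq> []" using t by auto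
    then have "last q \<in> set (drop (length p) q)"
      by (metis last_drop last_in_set drop_eq_Nil not_less)
    moreover have "last q \<in> set (take (length p) q)" using t assms(6) ne by (metis last_in_set)
    ultimately show False
      using ipath_distinct[OF assms(2)] set_take_disj_set_drop_if_distinct[of q "length p"
        "length p"] by auto
  qed
qed

text \<open>Prescribing both ends selects one of the two directions in which the cycle can be
  read.\<close>

definition closing_paths :: "'a set \<Rightarrow> 'a \<Rightarrow> 'a \<Rightarrow> 'a \<Rightarrow> 'a list set" where
  "closing_paths X v a b = {p. closes v p \<and> hd p = a \<and> last p = b \<and> set p \<subseteq> X}"

lemma finite_closing_paths: assumes "finite X" shows "finite (closing_paths X v a b)"
proof (rule finite_subset)
  show "closing_paths X v a b \<subseteq> {p. set p \<subseteq> X \<and> length p \<le> card X}"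
  proof
    fix p assume p: "p \<in> closing_paths X v a b"
    then have "distinct p" "set p \<subseteq> X" using ipath_distinct
      by (auto simp: closing_paths_def closes_def)
    then show "p \<in> {p. set p \<subseteq> X \<and> length p \<le> card X}"
      using distinct_card[of p] card_mono[OF assms, of "set p"] by simp
  qed
qed (use finite_lists_length_le assms in blast)

text \<open>Grow a set \<open>R\<close> of paths as in Prim's algorithm, always across a pair \<open>p \<in> R\<close>, \<open>q \<notin> R\<close> with the
  smallest union. By the exchange lemma the union is then a solid, and it is a new one because
  no three distinct paths have the same pairwise unions.\<close>

lemma card_closing_paths_le:
  assumes X: "finite X" and ne: "closing_paths X v a b \<noteq> {}"
  shows "card (closing_paths X v a b) \<le>
    Suc (card {U. solid U \<and> (\<exists>p\<in>closing_paths X v a b. \<exists>q\<in>closing_paths X v a b. U = insert v (set p \<union> set q))})"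
proof -
  define PS where "PS = closing_paths X v a b"
  have finP: "finite PS" using finite_closing_paths X by (simp add: PS_def)
  define S where "S R = {U. solid U \<and> (\<exists>p\<in>R. \<exists>q\<in>R. p \<noteq> q \<and> U = insert v (set p \<union> set q))}" for R
  have PSD: "closes v p" "hd p = a" "last p = b" "set p \<subseteq> X" "ipath p" "v \<notin> set p" if "p \<in> PS" for p
    using that by (auto simp: PS_def closing_paths_def closes_def)
  have PSI: "p \<in> PS" if "closes v p" "hd p = a" "last p = b" "set p \<subseteq> X" for p
    using that by (auto simp: PS_def closing_paths_def)
  have sub: "insert v (set p \<union> set q) \<in> Pow (insert v X)" if "p \<in> PS" "q \<in> PS" for p q
    using PSD(4)[OF that(1)] PSD(4)[OF that(2)] by auto
  have finS: "finite (S R)" if "R \<subseteq> PS" for R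
  proof (rule finite_subset[of _ "Pow (insert v X)"])
    show "S R \<subseteq> Pow (insert v X)" using that sub unfolding S_def by blast
  qed (use X in simp)
  have "\<exists>R\<subseteq>PS. R \<noteq> {} \<and> card R = Suc k \<and> Suc k \<le> Suc (card (S R))" if "Suc k \<le> card PS" for k
    using that
  proof (induction k)
    case 0
    then obtain p where "p \<in> PS" using ne PS_def by auto
    then show ?case by (intro exI[of _ "{p}"]) auto
  next
    case (Suc k)
    then obtain R where R: "R \<subseteq> PS" "R \<noteq> {}" "card R = Suc k" "Suc k \<le> Suc (card (S R))" by auto
    define cross where "cross = R \<times> (PS - R)"
    have "\<not> PS \<subseteq> R" using R Suc.prems card_mono[OF finite_subset[OF R(1) finP], of PS] by auto
    then have "cross \<noteq> {}" using R by (auto simp: cross_def)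
    moreover have "finite cross"
      unfolding cross_def
        by (intro finite_cartesian_product finite_Diff finP finite_subset[OF R(1) finP])
    ultimately obtain pq where pq: "is_arg_min (\<lambda>(p, q). card (set p \<union> set q)) (\<lambda>x. x \<in> cross) pq"
      using ex_is_arg_min_if_finite by metis
    obtain p q where "pq = (p, q)" by (cases pq)
    then have pq: "p \<in> R" "q \<in> PS" "q \<notin> R"
      "\<And>p' q'. p' \<in> R \<Longrightarrow> q' \<in> PS \<Longrightarrow> q' \<notin> R \<Longrightarrow> card (set p \<union> set q) \<le> card (set p' \<union> set q')"
      using pq by (auto simp: is_arg_min_linorder cross_def)
    have min: "\<not> set p' \<union> set q' \<subset> set p \<union> set q" if "p' \<in> R" "q' \<in> PS" "q' \<notin> R" for p' q'
      using pq(4)[OF that] psubset_card_mono[of "set p \<union> set q" "set p' \<union> set q'"] by auto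
    have pP: "p \<in> PS" using R pq by auto
    have "closes v p" "closes v q" "hd p = hd q" "last p = last q" "p \<noteq> q"
      using PSD pq pP by auto
    note path_exchange[OF this]
    then obtain r where r: "closes v r" "hd r = hd p" "last r = last p"
      "set r \<union> set q \<subset> set p \<union> set q"
      "set p \<union> set r \<subseteq> set p \<union> set q"
      and alt: "solid (insert v (set p \<union> set r)) \<or>
        (\<exists>w. closes v w \<and> hd w = hd p \<and> last w = last p \<and>
        set p \<union> set w \<subset> set p \<union> set r \<and> set r \<union> set w \<subset> set p \<union> set r)" by blast
    have pqX: "set p \<union> set q \<subseteq> X" using PSD pq pP by auto
    have rP: "r \<in> PS" using r pqX PSD[OF pP] by (intro PSI) auto
    \<comment> \<open>If \<open>r\<close> were in \<open>R\<close>, the pair of \<open>r\<close> and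
      \<open>q\<close> would cross with a smaller union.\<close>
    have rR: "r \<notin> R" using min[of r q] pq r(4) by blast
    have eq: "set p \<union> set r = set p \<union> set q" using min[OF pq(1) rP rR] r(5) by blast
    have sol: "solid (insert v (set p \<union> set r))"
    proof (rule ccontr)
      assume "\<not> ?thesis"
      then obtain w where w: "closes v w" "hd w = hd p" "last w = last p"
        "set p \<union> set w \<subset> set p \<union> set r" "set r \<union> set w \<subset> set p \<union> set r" using alt by blast
      have wP: "w \<in> PS" using w pqX eq PSD[OF pP] by (intro PSI) auto
      show False
      \<comment> \<open>Whichever side \<open>w\<close> lies on, it forms a crossing pair with
        \<open>r\<close> or with \<open>p\<close> whose union is too small.\<close>
      proof (cases "w \<in> R")
        case True
        then show ?thesis using min[OF True rP rR] w(5) eq by (simp add: Un_commute)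
      next
        case False
        then show ?thesis using min[OF pq(1) wP False] w(4) eq by simp
      qed
    qed
    have new: "insert v (set p \<union> set r) \<notin> S R"
    proof
      assume "insert v (set p \<union> set r) \<in> S R"
      then obtain s t where st: "s \<in> R" "t \<in> R" "s \<noteq> t"
        "insert v (set p \<union> set r) = insert v (set s \<union> set t)"
        by (auto simp: S_def)
      have "v \<notin> set p \<union> set r" "v \<notin> set s \<union> set t" using PSD pP rP st R by auto
      then have U: "set p \<union> set r = set s \<union> set t" using st(4) by (meson insert_ident)
      \<comment> \<open>Both \<open>s\<close> and \<open>t\<close> form crossing pairs with
        \<open>r\<close>. Their unions lie inside the minimal one, hence equal it.\<close>
      have "set s \<union> set r = set p \<union> set q" "set t \<union> set r = set p \<union> set q"
        using min[OF st(1) rP rR] min[OF st(2) rP rR] U eq by blast+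
      then have "set s \<subseteq> set t \<union> set r" "set t \<subseteq> set s \<union> set r" "set r \<subseteq> set s \<union> set t"
        using U eq by blast+
      moreover have "s \<in> PS" "t \<in> PS" using st R by auto
      ultimately have "s = t" using rP PSD by (intro ipaths_eq[of s t r]) simp_all
      then show False using st by simp
    qed
    have "insert (insert v (set p \<union> set r)) (S R) \<subseteq> S (insert r R)"
      using sol pq(1) rR by (auto simp: S_def)
    then have "Suc (card (S R)) \<le> card (S (insert r R))"
      using new finS[of R] finS[of "insert r R"] R rP
        card_mono[of "S (insert r R)" "insert (insert v (set p \<union> set r)) (S R)"] by auto
    then show ?case using R rP rR finite_subset[OF R(1) finP] by (intro exI[of _ "insert r R"]) auto
  qed
  from this[of "card PS - 1"] obtain R where R: "R \<subseteq> PS" "card R = card PS"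
    "card PS \<le> Suc (card (S R))"
    using ne finP by (cases "card PS") (auto simp: PS_def)
  then have "R = PS" using finP card_subset_eq by blast
  moreover have "S PS \<subseteq> {U. solid U \<and> (\<exists>p\<in>PS. \<exists>q\<in>PS. U = insert v (set p \<union> set q))}"
    by (auto simp: S_def)
  moreover have "finite {U. solid U \<and> (\<exists>p\<in>PS. \<exists>q\<in>PS. U = insert v (set p \<union> set q))}"
  proof (rule finite_subset[of _ "Pow (insert v X)"])
    show "{U. solid U \<and> (\<exists>p\<in>PS. \<exists>q\<in>PS. U = insert v (set p \<union> set q))} \<subseteq> Pow (insert v X)"
      using sub by blast
  qed (use X in simp)
  ultimately have "card (S R) \<le> card {U. solid U \<and> (\<exists>p\<in>PS. \<exists>q\<in>PS. U = insert v (set p \<union> set q))}"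
    using card_mono by blast
  then show ?thesis using R(3) unfolding PS_def by linarith
qed

end

section \<open>Solids through three neighbours\<close>

context sgraph
begin

text \<open>A tripod is what remains of a smallest connected set \<open>X \<subseteq> F\<close> that sees \<open>a\<close>, \<open>b\<close> and \<open>c\<close>: a path \<open>p\<close>
  inside \<open>X\<close> from \<open>a\<close> to \<open>b\<close> and a possibly empty path \<open>r\<close> linking \<open>c\<close> to \<open>p\<close>.\<close>

definition tripod :: "'a set \<Rightarrow> 'a \<Rightarrow> 'a \<Rightarrow> 'a \<Rightarrow> 'a list \<Rightarrow> 'a list \<Rightarrow> bool" where
  "tripod F a b c p r \<longleftrightarrow> ipath p \<and> ipath (c # r) \<and> set p \<subseteq> F \<and> set r \<subseteq> F \<and> set p \<inter> set r = {} \<and>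
    (\<forall>x\<in>set p. (adj a x \<longleftrightarrow> x = hd p) \<and> (adj b x \<longleftrightarrow> x = last p)) \<and>
    (\<forall>x\<in>set r. \<not> adj a x \<and> \<not> adj b x) \<and>
    (\<forall>x\<in>set (butlast (c # r)). \<forall>y\<in>set p. \<not> adj x y) \<and> (\<exists>y\<in>set p. adj (last (c # r)) y)"

lemma tripod_swap: "tripod F a b c p r \<Longrightarrow> tripod F b a c (rev p) r"
  unfolding tripod_def by (simp add: hd_rev last_rev)

lemma conn_append_ipath:
  assumes "ipath p" "ipath q" "x \<in> set p" "y \<in> set q" "adj x y"
  shows "conn (set p \<union> set q)"
  using conn_Un[OF conn_ipath[OF assms(1)] conn_ipath[OF assms(2)] assms(3,4)] assms(5) by blast

lemma shortest_ipath:
  assumes "\<exists>p. ipath p \<and> Q p"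
  shows "\<exists>p. ipath p \<and> Q p \<and> (\<forall>q. ipath q \<longrightarrow> Q q \<longrightarrow> length p \<le> length q)"
  using ex_has_least_nat[of "\<lambda>p. ipath p \<and> Q p" _ length] assms by blast

text \<open>Three outcomes are needed because the link from \<open>c\<close> to the path may itself
  see \<open>a\<close> or \<open>b\<close>. Then link and path merge into one path from
  \<open>c\<close> to the other of these two vertices, and the one that is seen takes the third
  place with an empty link.\<close>

lemma tripod_exists:
  assumes F: "finite F" "X \<subseteq> F" "conn X" "\<exists>x\<in>X. adj a x" "\<exists>x\<in>X. adj b x" "\<exists>x\<in>X. adj c x"
    and out: "a \<notin> F" "b \<notin> F" "c \<notin> F"
  shows "\<exists>p r. tripod F a b c p r \<or> tripod F c b a p r \<or> tripod F c a b p r"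
proof -
  define Q where "Q X \<longleftrightarrow> X \<subseteq> F \<and> conn X \<and> (\<exists>x\<in>X. adj a x) \<and> (\<exists>x\<in>X. adj b x) \<and> (\<exists>x\<in>X. adj c x)" for X
  have "Q X" using assms by (simp add: Q_def)
  then obtain X where X: "Q X" "\<And>Y. Q Y \<Longrightarrow> card X \<le> card Y"
    using ex_has_least_nat[of Q X card] by blast
  have XF: "X \<subseteq> F" "finite X" "conn X" using X F finite_subset by (auto simp: Q_def)
  have min: "Y = X" if "Q Y" "Y \<subseteq> X" for Y
    using X(2)[OF that(1)] that(2) XF by (metis card_seteq)
  obtain xa xb xc where x: "xa \<in> X" "adj a xa" "xb \<in> X" "adj b xb" "xc \<in> X" "adj c xc"
    using X(1) by (auto simp: Q_def)
  have "\<exists>p. ipath p \<and> (set p \<subseteq> X \<and> adj a (hd p) \<and> adj b (last p))"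
    using XF(3) x unfolding conn_def joined_def by metis
  \<comment> \<open>Minimal length makes \<open>a\<close> see only the first vertex of
    \<open>p\<close> and \<open>b\<close> only the last.\<close>
  from shortest_ipath[OF this] obtain p where p: "ipath p"
    "set p \<subseteq> X \<and> adj a (hd p) \<and> adj b (last p)"
    and pmin: "\<And>q. ipath q \<Longrightarrow> set q \<subseteq> X \<and> adj a (hd q) \<and> adj b (last q) \<Longrightarrow> length p \<le> length q"
    by blast
  have pne: "p \<noteq> []" using p by auto
  have pa: "adj a x \<longleftrightarrow> x = hd p" if "x \<in> set p" for x
  proof
    assume ax: "adj a x"
    obtain A B where AB: "p = A @ x # B" using \<open>x \<in> set p\<close> split_list by fast
    then have "length p \<le> length (x # B)"
      using p ax ipath_suffix[of A "x # B"] by (intro pmin) auto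
    then show "x = hd p" using AB by simp
  qed (use p in simp)
  have pb: "adj b x \<longleftrightarrow> x = last p" if "x \<in> set p" for x
  proof
    assume bx: "adj b x"
    obtain A B where AB: "p = A @ x # B" using \<open>x \<in> set p\<close> split_list by fast
    then have "hd (A @ [x]) = hd p" by (cases A) auto
    then have "length p \<le> length (A @ [x])"
      using p bx ipath_prefix[of "A @ [x]" B] AB by (intro pmin) auto
    then show "x = last p" using AB by simp
  qed (use p in simp)
  have pF: "set p \<subseteq> F" using p XF by auto
  show ?thesis
  proof (cases "\<exists>y\<in>set p. adj c y")
    case True
    then have "tripod F a b c p []" using p pa pb pF unfolding tripod_def by simp
    then show ?thesis by blast
  next
    case cp: False
    have "\<exists>r. ipath r \<and> (set r \<subseteq> X \<and> adj c (hd r) \<and> (\<exists>y\<in>set p. adj (last r) y))"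
    proof -
      have "hd p \<in> X" using p pne hd_in_set by blast
      then have "joined X xc (hd p)" using XF(3) x by (simp add: conn_def)
      then obtain r where r: "ipath r" "hd r = xc" "last r = hd p" "set r \<subseteq> X"
        by (auto simp: joined_def)
      have "xc \<noteq> hd p" using cp x pne by auto
      have "r \<noteq> []" using r by auto
      \<comment> \<open>The end point \<open>hd p\<close> is dropped, as only adjacency of the last
        vertex to \<open>p\<close> is required; disjointness from \<open>p\<close> follows later
        from minimal length.\<close>
      then obtain s y where s: "r = s @ [y]" by (cases r rule: rev_cases) auto
      moreover have "s \<noteq> []" using s r \<open>xc \<noteq> hd p\<close> by auto
      ultimately have "ipath s \<and> set s \<subseteq> X \<and> adj c (hd s) \<and> adj (last s) (hd p)"
        using r x by (auto simp: ipath_append)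
      then show ?thesis using pne by (intro exI[of _ s]) auto
    qed
    from shortest_ipath[OF this] obtain r where r: "ipath r"
      "set r \<subseteq> X \<and> adj c (hd r) \<and> (\<exists>y\<in>set p. adj (last r) y)"
      and rmin: "\<And>q. ipath q \<Longrightarrow> set q \<subseteq> X \<and> adj c (hd q) \<and> (\<exists>y\<in>set p. adj (last q) y) \<Longrightarrow> length r \<le> length q"
      by blast
    have rne: "r \<noteq> []" using r by auto
    have rF: "set r \<subseteq> F" using r XF by auto
    have rc: "adj c x \<longleftrightarrow> x = hd r" if "x \<in> set r" for x
    proof
      assume cx: "adj c x"
      obtain A B where AB: "r = A @ x # B" using \<open>x \<in> set r\<close> split_list by fast
      then have "length r \<le> length (x # B)"
        using r cx ipath_suffix[of A "x # B"] by (intro rmin) auto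
      then show "x = hd r" using AB by simp
    qed (use r in simp)
    have rp: "x = last r" if x: "x \<in> set r" "y \<in> set p" "adj x y" for x y
    proof -
      obtain A B where AB: "r = A @ x # B" using x split_list by fast
      then have "hd (A @ [x]) = hd r" by (cases A) auto
      then have "length r \<le> length (A @ [x])"
        using r x ipath_prefix[of "A @ [x]" B] AB by (intro rmin) auto
      then show "x = last r" using AB by simp
    qed
    have disj: "set p \<inter> set r = {}"
    proof (rule ccontr)
      assume "set p \<inter> set r \<noteq> {}"
      then obtain x where x: "x \<in> set p" "x \<in> set r" by blast
      obtain A B where AB: "r = A @ x # B" using x split_list by fast
      have A: "A \<noteq> []" using AB cp x r by auto
      have "adj (last A) x" using r(1) unfolding AB
        using ipath_appendD(4)[OF _ A, of x B "last A" x] A by simp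
      then have "last A = last r" using rp[of "last A" x] x A AB by auto
      moreover have "last r \<in> set (x # B)" using AB by simp
      ultimately show False
        using ipath_appendD(3)[OF r(1)[unfolded AB] A] last_in_set[OF A] by (metis disjoint_iff)
    qed
    have ir: "ipath (c # r)" using r(1) rne rc rF out by (auto simp: ipath_Cons)
    obtain y where y: "y \<in> set p" "adj (last r) y" using r by blast
    have connr: "conn (set r)" using r conn_ipath by blast
    have bl: "\<not> adj x y" if "x \<in> set (butlast (c # r))" "y \<in> set p" for x y
    proof (cases "x = c")
      case False
      then have "x \<in> set (butlast r)" using that rne by simp
      moreover have "last r \<notin> set (butlast r)"
        using ipath_distinct[OF r(1)] rne
          by (metis append_butlast_last_id distinct_append disjoint_iff list.set_intros(1))
      ultimately show ?thesis using rp[of x y] that(2) in_set_butlastD by metis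
    qed (use cp that in simp)
    have relabel: "tripod F c b a (r @ p) []"
      if ab: "ipath p" "\<And>x. x \<in> set p \<Longrightarrow> adj b x \<longleftrightarrow> x = last p" "\<exists>x\<in>set r. adj a x"
        "\<forall>x\<in>set r. \<not> adj b x"
        "\<exists>x\<in>set p. adj b x" "set p \<subseteq> X" "p \<noteq> []"
          "\<And>x y. x \<in> set r \<Longrightarrow> y \<in> set p \<Longrightarrow> adj x y \<Longrightarrow> x = last r"
        "set p \<inter> set r = {}" "\<not> (\<exists>y\<in>set p. adj c y)" "\<exists>y\<in>set p. adj (last r) y"
        "\<And>Y. conn Y \<and> (\<exists>x\<in>Y. adj a x) \<and> (\<exists>x\<in>Y. adj b x) \<and> (\<exists>x\<in>Y. adj c x) \<Longrightarrow> Y \<subseteq> F \<Longrightarrow> Q Y"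
      for a b p
    proof -
      from split_list_last_prop[OF ab(11)] obtain A y B where y: "p = A @ y # B" "adj (last r) y"
        "\<forall>x\<in>set B. \<not> adj (last r) x" by blast
      have iyB: "ipath (y # B)" using ab(1) y ipath_suffix by blast
      have "conn (set r \<union> set (y # B))"
        using conn_append_ipath[OF r(1) iyB, of "last r" y] y(2) rne by simp
      moreover have "adj b (last p)" "last p \<in> set (y # B)" using ab(2)[of "last p"] ab(7) y(1)
        by auto
      ultimately have N1: "conn (set r \<union> set (y # B)) \<and> (\<exists>x\<in>set r \<union> set (y # B). adj a x) \<and>
        (\<exists>x\<in>set r \<union> set (y # B). adj b x) \<and> (\<exists>x\<in>set r \<union> set (y # B). adj c x)"
        using ab(3) r rne by (metis UnI1 UnI2 hd_in_set)
      have N2: "set r \<union> set (y # B) \<subseteq> X" using r ab(6) y(1) by auto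
      \<comment> \<open>\<open>r\<close> and the part of \<open>p\<close> from \<open>y\<close> on
        already see all three vertices, so by minimality of \<open>X\<close> nothing on
        \<open>p\<close> precedes \<open>y\<close>.\<close>
      have "Q (set r \<union> set (y # B))"
        using N1 order_trans[OF N2 XF(1)] by (rule ab(12))
      then have "set r \<union> set (y # B) = X" using N2 by (rule min)
      then have "set p \<subseteq> set (y # B)" using ab(6,9) by blast
      then have "A = []" using ipath_distinct[OF ab(1)] y(1) by (cases A) auto
      then have hp: "hd p = y" "\<forall>x\<in>set p. adj (last r) x \<longleftrightarrow> x = hd p" using y by auto
      have "adj x w \<longleftrightarrow> x = last r \<and> w = hd p" if "x \<in> set r" "w \<in> set p" for x w
        using ab(8)[OF that] hp that by auto
      then have "ipath (r @ p)" using r(1) ab(1,7,9) rne by (subst ipath_append) auto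
      moreover have "adj c x \<longleftrightarrow> x = hd (r @ p)" if "x \<in> set (r @ p)" for x
        using rc ab(9,10) rne that by (metis Un_iff disjoint_iff hd_append2 hd_in_set set_append)
      moreover have "adj b x \<longleftrightarrow> x = last (r @ p)" if "x \<in> set (r @ p)" for x
        using ab(2,4,7,9) that by (metis Un_iff disjoint_iff last_appendR last_in_set set_append)
      moreover have "set (r @ p) \<subseteq> F" using rF ab(6) XF by auto
      ultimately show ?thesis using ab(3) unfolding tripod_def by auto
    qed
    show ?thesis
    proof (cases "\<exists>x\<in>set r. adj a x"; cases "\<exists>x\<in>set r. adj b x")
      \<comment> \<open>Here \<open>r\<close> alone sees all three vertices, and minimality of
        \<open>X\<close> leaves no room for \<open>p\<close>.\<close>
      assume "\<exists>x\<in>set r. adj a x" "\<exists>x\<in>set r. adj b x"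
      moreover have "\<exists>x\<in>set r. adj c x" "set r \<subseteq> X" using r rne by auto
      ultimately have "set r = X" using connr rF by (intro min) (auto simp: Q_def)
      then show ?thesis using disj p pne by (metis Int_absorb2 set_empty)
    next
      assume ab: "\<exists>x\<in>set r. adj a x" "\<not> (\<exists>x\<in>set r. adj b x)"
      have "tripod F c b a (r @ p) []"
        by (rule relabel) (use ab p pb pne rp disj cp y in \<open>auto simp: Q_def\<close>)
      then show ?thesis by blast
    next
      assume ab: "\<not> (\<exists>x\<in>set r. adj a x)" "\<exists>x\<in>set r. adj b x"
      have "tripod F c a b (r @ rev p) []"
        by (rule relabel) (use ab p pa pne rp disj cp y in \<open>auto simp: last_rev Q_def\<close>)
      then show ?thesis by blast
    next
      assume ab: "\<not> (\<exists>x\<in>set r. adj a x)" "\<not> (\<exists>x\<in>set r. adj b x)"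
      then have "tripod F a b c p r"
        using p(1) ir pF rF disj pa pb bl y rne unfolding tripod_def by auto
      then show ?thesis by blast
    qed
  qed
qed

text \<open>The cases decide which solid arises where \<open>l\<close> meets the path: a single
  attachment serves trihedra and stamps, an edge serves stamps and prisms, and otherwise
  \<open>l\<close> can replace the segment between its first and its last neighbour.\<close>

lemma neighbours_on_ipath:
  assumes "ipath p" "\<exists>y\<in>set p. adj l y"
  obtains (one) y where "y \<in> set p" "\<And>w. w \<in> set p \<Longrightarrow> adj l w \<longleftrightarrow> w = y"
  | (two) x y where "x \<in> set p" "y \<in> set p" "adj x y" "\<And>w. w \<in> set p \<Longrightarrow> adj l w \<longleftrightarrow> w = x \<or> w = y"
  | (many) A x D y B where "p = A @ x # D @ y # B" "D \<noteq> []" "adj l x" "adj l y"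
      "\<forall>w\<in>set A. \<not> adj l w" "\<forall>w\<in>set B. \<not> adj l w"
proof -
  from split_list_last_prop[OF assms(2)] obtain M y B
    where y: "p = M @ y # B" "adj l y" "\<forall>w\<in>set B. \<not> adj l w" by blast
  show ?thesis
  proof (cases "\<exists>x\<in>set M. adj l x")
    case False
    then show ?thesis using y by (intro one[of y]) auto
  next
    case True
    from split_list_first_prop[OF True] obtain A x D
      where x: "M = A @ x # D" "adj l x" "\<forall>w\<in>set A. \<not> adj l w" by blast
    show ?thesis
    proof (cases "D = []")
      case True
      have "ipath ((A @ [x]) @ y # B)" using assms(1) x y True by simp
      from ipath_appendD(4)[OF this, of x y] have "adj x y" by simp
      then show ?thesis using x y True by (intro two[of x y]) auto
    next
      case False
      then show ?thesis using x y by (intro many[of A x D y B]) auto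
    qed
  qed
qed

lemma ipath_bracket:
  assumes "ipath p" "a \<notin> set p" "b \<notin> set p" "a \<noteq> b" "\<not> adj a b"
    "\<And>x. x \<in> set p \<Longrightarrow> (adj a x \<longleftrightarrow> x = hd p) \<and> (adj b x \<longleftrightarrow> x = last p)"
  shows "ipath (a # p @ [b])"
proof -
  have "p \<noteq> []" using assms(1) by auto
  then have "ipath (p @ [b])" using assms by (subst ipath_snoc) auto
  then show ?thesis using assms \<open>p \<noteq> []\<close> by (subst ipath_Cons) auto
qed

text \<open>Apart from some pyramids, the base cycle consists of \<open>a\<close>, \<open>b\<close>,
  the path \<open>p\<close> or its detour through \<open>l\<close>, and also \<open>v\<close> if
  \<open>a\<close> and \<open>b\<close> are not adjacent. The rest of the tripod is attached to it
  as an outside path. The assumption \<open>sym\<close> merely fixes which of the two ends is called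
  \<open>a\<close>.\<close>

lemma tripod_solid_aux:
  assumes T: "tripod F a b c p r"
    and v: "adj v a" "adj v b" "adj v c" "v \<notin> F" "\<And>x. x \<in> F \<Longrightarrow> \<not> adj v x"
    and abc: "a \<noteq> b" "a \<noteq> c" "b \<noteq> c" "a \<notin> F" "b \<notin> F" "c \<notin> F"
    and sym: "adj b c \<Longrightarrow> adj a c"
  shows "\<exists>U. solid U \<and> insert v {a, b, c} \<subseteq> U \<and> U \<subseteq> insert v ({a, b, c} \<union> F)"
proof -
  define q where "q = c # r"
  define l where "l = last q"
  have p: "ipath p" "set p \<subseteq> F" "\<And>x. x \<in> set p \<Longrightarrow> (adj a x \<longleftrightarrow> x = hd p) \<and> (adj b x \<longleftrightarrow> x = last p)"
    "p \<noteq> []"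
    using T by (auto simp: tripod_def)
  have q: "ipath q" "set r \<subseteq> F" "set p \<inter> set q = {}" "\<And>x. x \<in> set r \<Longrightarrow> \<not> adj a x \<and> \<not> adj b x"
    "\<And>x y. x \<in> set (butlast q) \<Longrightarrow> y \<in> set p \<Longrightarrow> \<not> adj x y" "\<exists>y\<in>set p. adj l y" "q \<noteq> []"
    using T abc unfolding tripod_def q_def l_def by auto
  have sq: "set q = insert c (set r)" by (simp add: q_def)
  have lq: "l \<in> set q" using q(7) by (simp add: l_def)
  have bq: "q = butlast q @ [l]" using q(7) by (simp add: l_def)
  have qp: "adj x y \<longleftrightarrow> x = l \<and> adj l y" if "x \<in> set q" "y \<in> set p" for x y
    using that q(5)[of x y] bq
      by (metis Un_iff empty_iff empty_set insert_iff list.simps(15) set_append)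
  have nv: "v \<noteq> a" "v \<noteq> b" "v \<noteq> c" "v \<notin> set p" "v \<notin> set r" using v p q by auto
  have ap: "a \<notin> set p" "b \<notin> set p" "c \<notin> set p" "a \<notin> set r" "b \<notin> set r" using abc p q by auto
  have vp: "\<not> adj v x" if "x \<in> set p \<or> x \<in> set r" for x using that v p q by auto
  have vq: "ipath (v # q)" using q(1) nv v vp by (auto simp: ipath_Cons q_def)
  have rev_adj: "adj x w \<longleftrightarrow> adj w x" for x w by (rule adj_sym)
  have bounds: ?thesis
    if "solid U" "v \<in> U" "a \<in> U" "b \<in> U" "c \<in> U" "U \<subseteq> {v, a, b, c} \<union> set p \<union> set r" for U
    using that p q by (intro exI[of _ U]) auto
  \<comment> \<open>If the first and the last neighbour of \<open>l\<close> on \<open>p\<close> are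
    not consecutive, \<open>l\<close> itself is moved onto the path; the link then attaches at the
    single vertex \<open>l\<close>.\<close>
  have detour: "\<exists>m. ipath m \<and> (\<forall>x\<in>set m. (adj a x \<longleftrightarrow> x = hd m) \<and> (adj b x \<longleftrightarrow> x = last m)) \<and>
      l \<in> set m \<and> set m \<subseteq> insert l (set p) \<and> 2 \<le> length m"
    if m: "p = A @ x # D @ y # B" "D \<noteq> []" "adj l x" "adj l y"
      "\<forall>w\<in>set A. \<not> adj l w" "\<forall>w\<in>set B. \<not> adj l w" and "\<not> adj a l" "\<not> adj b l" for A x D y B
  proof -
    have "ipath (A @ x # l # y # B)" using ipath_detour[OF p(1) m] q(3) lq by blast
    moreover have "hd (A @ x # l # y # B) = hd p" by (simp add: m(1) hd_append)
    moreover have "last (A @ x # l # y # B) = last p" by (simp add: m(1))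
    moreover have "l \<noteq> hd p" "l \<noteq> last p" using lq q(3) p(4)
      by (metis disjoint_iff hd_in_set last_in_set)+
    ultimately show ?thesis using p(3) that(7,8) unfolding m(1) 
      by (intro exI[of _ "A @ x # l # y # B"]) auto
  qed
  show ?thesis
  proof (cases "adj a b")
    case ab: True
    have cyc: "icycle ({a, b} \<union> set m)"
      if "ipath m" "\<And>x. x \<in> set m \<Longrightarrow> (adj a x \<longleftrightarrow> x = hd m) \<and> (adj b x \<longleftrightarrow> x = last m)" "a \<notin> set m"
        "b \<notin> set m" for m
    proof -
      have "m \<noteq> []" using that by auto
      then have "ipath (m @ [b])" using that by (subst ipath_snoc) auto
      then have "closes a (m @ [b])" using that ab abc \<open>m \<noteq> []\<close> by (auto simp: closes_def Suc_le_eq)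
      from closes_icycle[OF this] show ?thesis by (simp add: insert_commute)
    qed
    show ?thesis
    proof (cases "adj a c")
      case ac: True
      show ?thesis
      proof (cases "adj b c")
        case True
        \<comment> \<open>With \<open>a\<close>, \<open>b\<close>, \<open>c\<close> pairwise
          adjacent, the four vertices form a pyramid over a triangle.\<close>
        have "closes v [a, b]" using v nv ab abc by (auto simp: closes_def)
        then have "icycle {v, a, b}" using closes_icycle by fastforce
        then have "solid (insert c {v, a, b})"
          using v ac True nv abc adj_sym[of c] by (intro solid_pyramidI[of _ c v a b]) auto
        then show ?thesis by (rule bounds) auto
      next
        case False
        \<comment> \<open>The apex is \<open>a\<close>: it sees \<open>v\<close>, \<open>b\<close>
          and \<open>c\<close> on the cycle that leads from \<open>v\<close> through
          \<open>c\<close> to \<open>l\<close>, on to \<open>y\<close>, along \<open>p\<close> to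
          \<open>b\<close> and back to \<open>v\<close>.\<close>
        from split_list_last_prop[OF q(6)] obtain M y B
          where y: "p = M @ y # B" "adj l y" "\<forall>w\<in>set B. \<not> adj l w" by blast
        have iyB: "ipath (y # B)" using p(1) y ipath_suffix by blast
        have "ipath ((y # B) @ [b])"
          using iyB p(3) ap y(1) by (subst ipath_snoc) auto
        moreover have "adj x w \<longleftrightarrow> x = last q \<and> w = y"
          if "x \<in> set q" "w \<in> set ((y # B) @ [b])" for x w
        proof (cases "w = b")
          case True
          have "\<not> adj x b" using that(1) False q(4) adj_sym by (auto simp: sq)
          then show ?thesis using True ap y(1) by auto
        next
          case w: False
          then have "w \<in> set (y # B)" using that by auto
          then show ?thesis using qp[OF that(1), of w] y by (auto simp: l_def)
        qed
        ultimately have "ipath (q @ (y # B) @ [b])"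
          using q ap abc y(1) by (subst ipath_append) (auto simp: sq)
        then have "closes v (q @ (y # B) @ [b])"
          using v vp nv y(1) by (auto simp: closes_def q_def)
        from closes_icycle[OF this] have "icycle (insert v (set (q @ (y # B) @ [b])))" .
        then have "solid (insert a (insert v (set (q @ (y # B) @ [b]))))"
          using v(1) ab ac nv abc ap y(1) adj_sym[of a v]
          by (intro solid_pyramidI[of _ a v b c]) (auto simp: sq)
        then show ?thesis using y(1) by (intro bounds) (auto simp: sq)
      qed
    next
      case ac: False
      then have bc: "\<not> adj b c" using sym by blast
      \<comment> \<open>Now \<open>c\<close> sees neither \<open>a\<close> nor \<open>b\<close>. The
        outside path is \<open>v # q\<close>, attached through \<open>v\<close> to the edge between
        \<open>a\<close> and \<open>b\<close> and through \<open>l\<close> to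
        \<open>p\<close>.\<close>
      define C where "C = {a, b} \<union> set p"
      have C: "icycle C" unfolding C_def using p ap by (intro cyc) auto
      have qab: "\<not> adj x a" "\<not> adj x b" if "x \<in> set q" for x
        using that q(4) ac bc rev_adj by (auto simp: sq)
      have disj: "set (v # q) \<inter> C = {}" using nv ap abc q(3) by (auto simp: C_def sq)
      have lC: "l \<notin> C" using disj lq by auto
      have cross: "adj x w \<longleftrightarrow> x = v \<and> (w = a \<or> w = b) \<or> x = l \<and> w \<in> set p \<and> adj l w"
        if "x \<in> set (v # q)" "w \<in> C" for x w
        using that v vp qab qp[of x w] nv lq ap by (auto simp: C_def sq)
      have ends: "hd (rev (v # q)) = l" "last (rev (v # q)) = v" "last (v # q) = l"
        using q(7) by (simp_all add: l_def hd_rev last_rev)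
      have SC: ?thesis if "solid (C \<union> set (v # q))"
        using that by (rule bounds) (auto simp: C_def sq)
      show ?thesis
      proof (rule neighbours_on_ipath[OF p(1) q(6)])
        fix y assume y: "y \<in> set p" "\<And>w. w \<in> set p \<Longrightarrow> adj l w \<longleftrightarrow> w = y"
        have "solid (C \<union> set (rev (v # q)))"
        proof (rule solid_stamp[OF C, of y a b])
          fix x w assume "x \<in> set (rev (v # q))" "w \<in> C"
          then show "adj x w \<longleftrightarrow> x = hd (rev (v # q)) \<and> w = y \<or> x = last (rev (v # q)) \<and> (w = a \<or> w = b)"
            unfolding ends using cross[of x w] y by auto
        next
          show "ipath (rev (v # q))" using vq by (simp only: ipath_rev)
        qed (use y ab abc ap vq disj in \<open>auto simp: C_def\<close>)
        then show ?thesis using SC by simp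
      next
        fix x y assume xy: "x \<in> set p" "y \<in> set p" "adj x y"
          "\<And>w. w \<in> set p \<Longrightarrow> adj l w \<longleftrightarrow> w = x \<or> w = y"
        have "solid (C \<union> set (v # q))"
        proof (rule solid_prism[OF C, of a b x y])
          fix s w assume "s \<in> set (v # q)" "w \<in> C"
          then show "adj s w \<longleftrightarrow> s = hd (v # q) \<and> (w = a \<or> w = b) \<or> s = last (v # q) \<and> (w = x \<or> w = y)"
            unfolding ends using cross[of s w] xy by auto
        qed (use xy ab abc ap vq disj q(7) in \<open>auto simp: C_def Suc_le_eq\<close>)
        then show ?thesis using SC by simp
      next
        fix A x D y B
        assume "p = A @ x # D @ y # B" "D \<noteq> []" "adj l x" "adj l y"
          "\<forall>w\<in>set A. \<not> adj l w" "\<forall>w\<in>set B. \<not> adj l w"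
        from detour[OF this] obtain m where m: "ipath m"
          "\<forall>x\<in>set m. (adj a x \<longleftrightarrow> x = hd m) \<and> (adj b x \<longleftrightarrow> x = last m)" "l \<in> set m"
            "set m \<subseteq> insert l (set p)"
          using qab[OF lq] rev_adj by blast
        define C' where "C' = {a, b} \<union> set m"
        have C': "icycle C'" unfolding C'_def using m ap lC by (intro cyc) (auto simp: C_def)
        \<comment> \<open>As \<open>l\<close> now lies on the cycle, the outside path stops before
          it.\<close>
        define e where "e = v # butlast q"
        have e: "v # q = e @ [l]" using bq by (simp add: e_def)
        have ne: "e \<noteq> []" by (simp add: e_def)
        have ie: "ipath e" "l \<notin> set e" "\<And>x. x \<in> set e \<Longrightarrow> adj l x \<longleftrightarrow> x = last e" "e \<noteq> []"
          using vq ne unfolding e by (simp_all add: ipath_snoc[OF ne])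
        have "solid (C' \<union> set (rev e))"
        proof (rule solid_stamp[OF C', of l a b])
          fix s w assume sw: "s \<in> set (rev e)" "w \<in> C'"
          have se: "s \<in> set (v # q)" "s \<noteq> l" unfolding e using sw ie by auto
          have he: "hd (rev e) = last e" "last (rev e) = v" using ie(4)
            by (simp_all add: hd_rev last_rev e_def)
          show "adj s w \<longleftrightarrow> s = hd (rev e) \<and> w = l \<or> s = last (rev e) \<and> (w = a \<or> w = b)"
          proof (cases "w = l")
            case True
            then show ?thesis using ie(3)[of s] sw lC rev_adj[of s l] unfolding he
              by (auto simp: C_def)
          next
            case False
            then have "w \<in> C" using sw m by (auto simp: C_def C'_def)
            then show ?thesis using cross[OF se(1), of w] se(2) False unfolding he by auto
          qed
        next
          show "set (rev e) \<inter> C' = {}"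
            using disj ie(2) m(4) unfolding e by (auto simp: C_def C'_def)
        qed (use m ab abc ap ie lC in \<open>auto simp: C_def C'_def\<close>)
        moreover have "C' \<union> set (rev e) \<subseteq> {v, a, b, c} \<union> set p \<union> set r"
          using m lq in_set_butlastD[of _ q] by (auto simp: C'_def e_def sq)
        moreover have "c \<in> C' \<union> set (rev e)"
          using m bq by (cases r) (auto simp: C'_def e_def q_def l_def)
        ultimately show ?thesis by (intro bounds) (auto simp: C'_def e_def)
      qed
    qed
  next
    case ab: False
    have cyc: "icycle ({v, a, b} \<union> set m)"
      if m: "ipath m" "\<And>x. x \<in> set m \<Longrightarrow> (adj a x \<longleftrightarrow> x = hd m) \<and> (adj b x \<longleftrightarrow> x = last m)"
        "a \<notin> set m" "b \<notin> set m" "v \<notin> set m" "\<And>x. x \<in> set m \<Longrightarrow> \<not> adj v x" for m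
    proof -
      have "ipath (a # m @ [b])" using ipath_bracket m ab abc by blast
      then have "closes v (a # m @ [b])" using m nv v by (auto simp: closes_def)
      from closes_icycle[OF this] show ?thesis by (simp add: insert_commute)
    qed
    define C where "C = {v, a, b} \<union> set p"
    have C: "icycle C" unfolding C_def using p ap nv vp by (intro cyc) auto
    have disj: "set q \<inter> C = {}" using nv ap abc q(3) by (auto simp: C_def sq)
    have lC: "l \<notin> C" using disj lq by auto
    have SC: ?thesis if "solid (C \<union> set q)"
      using that by (rule bounds) (auto simp: C_def sq)
    \<comment> \<open>\<open>c\<close> sees \<open>v\<close> in any case, so two further neighbours
      on the cycle suffice.\<close>
    have pyr: ?thesis if "{x, y} \<subseteq> C - {v}" "x \<noteq> y" "adj c x" "adj c y" for x y
    proof -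
      have "solid (insert c C)" using that disj v(3) adj_sym[of c v]
        by (intro solid_pyramidI[OF C, of c v x y]) (auto simp: sq C_def)
      then show ?thesis by (rule bounds) (auto simp: C_def)
    qed
    show ?thesis
    proof (cases "adj b c \<or> (adj a c \<and> r = [])")
      case True
      show ?thesis
      proof (cases "adj b c")
        case True
        then show ?thesis using sym[OF True] nv abc(1) adj_sym[of c]
          by (intro pyr[of a b]) (auto simp: C_def)
      next
        case False
        with True have ac: "adj a c" "r = []" by auto
        obtain y where "y \<in> set p" "adj c y" using q(6) ac by (auto simp: l_def q_def)
        then show ?thesis using ac nv ap adj_sym[of c a] by (intro pyr[of a y]) (auto simp: C_def)
      qed
    next
      case False
      then have bc: "\<not> adj b c" and acr: "adj a c \<Longrightarrow> r \<noteq> []" by auto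
      have rl: "adj a l \<longleftrightarrow> adj a c \<and> r = []" "\<not> adj b l"
        using q(4) bc by (cases "r = []"; auto simp: l_def q_def)+
      \<comment> \<open>The outside path is now \<open>q\<close>. Its end \<open>c\<close> attaches
        to \<open>v\<close> alone or to the edge between \<open>v\<close> and \<open>a\<close>, its
        end \<open>l\<close> to \<open>p\<close>.\<close>
      have cross: "adj x w \<longleftrightarrow> x = c \<and> (w = v \<or> w = a \<and> adj a c) \<or> x = l \<and> w \<in> set p \<and> adj l w"
        if xw: "x \<in> set q" "w \<in> C" for x w
      proof -
        consider "w = v" | "w = a" | "w = b" | "w \<in> set p" using xw by (auto simp: C_def)
        then show ?thesis
        proof cases
          case 1
          then show ?thesis using xw v vp nv rev_adj[of x v] by (auto simp: sq)
        next
          case 2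
          then show ?thesis using xw q(4) nv ap rev_adj[of x a] by (auto simp: sq)
        next
          case 3
          then show ?thesis using xw q(4) nv abc ap bc rev_adj[of x b] by (auto simp: sq)
        next
          case 4
          then show ?thesis using qp[of x w] xw nv ap by auto
        qed
      qed
      have hq: "hd q = c" "last q = l" "hd (rev q) = l" "last (rev q) = c" 
        using q(7) by (simp_all add: q_def l_def hd_rev last_rev)
      show ?thesis
      proof (rule neighbours_on_ipath[OF p(1) q(6)])
        fix y assume y: "y \<in> set p" "\<And>w. w \<in> set p \<Longrightarrow> adj l w \<longleftrightarrow> w = y"
        show ?thesis
        proof (cases "adj a c")
          case True
          have "solid (C \<union> set (rev q))"
          proof (rule solid_stamp[OF C, of y v a])
            fix x w assume "x \<in> set (rev q)" "w \<in> C"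
            then show "adj x w \<longleftrightarrow> x = hd (rev q) \<and> w = y \<or> x = last (rev q) \<and> (w = v \<or> w = a)"
              unfolding hq using cross[of x w] y True by auto
          qed (use y v nv ap q disj in \<open>auto simp: C_def\<close>)
          then show ?thesis using SC by simp
        next
          case False
          have "solid (C \<union> set q)"
          proof (rule solid_trihedron[OF C, of v y])
            fix x w assume "x \<in> set q" "w \<in> C"
            then show "adj x w \<longleftrightarrow> x = hd q \<and> w = v \<or> x = last q \<and> w = y"
              unfolding hq using cross[of x w] y False by auto
          qed (use y v nv ap q disj vp in \<open>auto simp: C_def\<close>)
          then show ?thesis using SC by simp
        qed
      next
        fix x y assume xy: "x \<in> set p" "y \<in> set p" "adj x y"
          "\<And>w. w \<in> set p \<Longrightarrow> adj l w \<longleftrightarrow> w = x \<or> w = y"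
        show ?thesis
        proof (cases "adj a c")
          case True
          have "solid (C \<union> set q)"
          proof (rule solid_prism[OF C, of v a x y])
            fix s w assume "s \<in> set q" "w \<in> C"
            then show "adj s w \<longleftrightarrow> s = hd q \<and> (w = v \<or> w = a) \<or> s = last q \<and> (w = x \<or> w = y)"
              unfolding hq using cross[of s w] xy True by auto
          next
            \<comment> \<open>The triangles of a prism are disjoint, so \<open>c\<close> and
              \<open>l\<close> must differ; the case of equality has been settled by a
              pyramid.\<close>
            show "2 \<le> length q" using acr[OF True] by (cases r) (auto simp: q_def)
          qed (use xy v nv ap q disj in \<open>auto simp: C_def\<close>)
          then show ?thesis using SC by simp
        next
          case False
          have "solid (C \<union> set q)"
          proof (rule solid_stamp[OF C, of v x y])
            fix s w assume "s \<in> set q" "w \<in> C"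
            then show "adj s w \<longleftrightarrow> s = hd q \<and> w = v \<or> s = last q \<and> (w = x \<or> w = y)"
              unfolding hq using cross[of s w] xy False by auto
          qed (use xy v nv ap q disj in \<open>auto simp: C_def\<close>)
          then show ?thesis using SC by simp
        qed
      next
        fix A x D y B
        assume many: "p = A @ x # D @ y # B" "D \<noteq> []" "adj l x" "adj l y"
          "\<forall>w\<in>set A. \<not> adj l w" "\<forall>w\<in>set B. \<not> adj l w"
        show ?thesis
        proof (cases "r = []")
          case True
          then have "adj c x" "adj c y" using many by (auto simp: l_def q_def)
          moreover have "x \<noteq> y" using ipath_distinct[OF p(1)] many by auto
          ultimately show ?thesis using nv many by (intro pyr[of x y]) (auto simp: C_def)
        next
          case r: False
          then have "\<not> adj a l" "\<not> adj b l" using rl by auto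
          from detour[OF many this] obtain m where m: "ipath m"
            "\<forall>x\<in>set m. (adj a x \<longleftrightarrow> x = hd m) \<and> (adj b x \<longleftrightarrow> x = last m)" "l \<in> set m"
              "set m \<subseteq> insert l (set p)"
            by blast
          have lr: "l \<in> set r" using r by (simp add: l_def q_def)
          define C' where "C' = {v, a, b} \<union> set m"
          have vm: "\<not> adj v x" if "x \<in> set m" for x using m vp lr that by auto
          have C': "icycle C'" unfolding C'_def using m ap lC nv vm
            by (intro cyc) (auto simp: C_def)
          define e where "e = butlast q"
          have e: "q = e @ [l]" "e \<noteq> []" using bq r by (simp_all add: e_def q_def)
          have ie: "ipath e" "l \<notin> set e" "\<And>x. x \<in> set e \<Longrightarrow> adj l x \<longleftrightarrow> x = last e"
            using q(1) e(2) unfolding e(1) by (simp_all add: ipath_snoc)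
          have he: "hd e = c" "c \<in> set e" using e hq(1)
            by (metis hd_append2, metis hd_append2 hd_in_set)
          have disj': "set e \<inter> C' = {}" using disj ie(2) m(4) unfolding e
            by (auto simp: C_def C'_def)
          have cross': "adj s w \<longleftrightarrow> s = c \<and> (w = v \<or> w = a \<and> adj a c) \<or> s = last e \<and> w = l"
            if sw: "s \<in> set e" "w \<in> C'" for s w
          proof -
            have sq': "s \<in> set q" "s \<noteq> l" using sw ie unfolding e by auto
            show ?thesis
            proof (cases "w = l")
              case True
              then show ?thesis using ie(3)[of s] sw lC rev_adj[of s l] by (auto simp: C_def)
            next
              case False
              then have "w \<in> C" using sw m by (auto simp: C_def C'_def)
              then show ?thesis using cross[OF sq'(1), of w] sq'(2) False by auto
            qed
          qed
          have SC': ?thesis if "solid (C' \<union> set e)"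
          proof (rule bounds[OF that])
            show "C' \<union> set e \<subseteq> {v, a, b, c} \<union> set p \<union> set r"
              using m lr in_set_butlastD[of _ q] by (auto simp: C'_def e_def sq)
          qed (use he in \<open>auto simp: C'_def\<close>)
          show ?thesis
          proof (cases "adj a c")
            case True
            have "solid (C' \<union> set (rev e))"
            proof (rule solid_stamp[OF C', of l v a])
              fix s w assume "s \<in> set (rev e)" "w \<in> C'"
              then show "adj s w \<longleftrightarrow> s = hd (rev e) \<and> w = l \<or> s = last (rev e) \<and> (w = v \<or> w = a)"
                using cross'[of s w] True he e(2) by (auto simp: hd_rev last_rev)
            qed (use m v nv ie lC disj' in \<open>auto simp: C_def C'_def\<close>)
            then show ?thesis using SC' by simp
          next
            case False
            have "solid (C' \<union> set e)"
            proof (rule solid_trihedron[OF C', of v l])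
              fix s w assume "s \<in> set e" "w \<in> C'"
              then show "adj s w \<longleftrightarrow> s = hd e \<and> w = v \<or> s = last e \<and> w = l"
                using cross'[of s w] False he by auto
            qed (use m v vm nv ie lC disj' in \<open>auto simp: C_def C'_def\<close>)
            then show ?thesis using SC' by simp
          qed
        qed
      qed
    qed
  qed
qed


lemma tripod_solid:
  assumes T: "tripod F a b c p r"
    and v: "adj v a" "adj v b" "adj v c" "v \<notin> F" "\<And>x. x \<in> F \<Longrightarrow> \<not> adj v x"
    and abc: "a \<noteq> b" "a \<noteq> c" "b \<noteq> c" "a \<notin> F" "b \<notin> F" "c \<notin> F"
  shows "\<exists>U. solid U \<and> insert v {a, b, c} \<subseteq> U \<and> U \<subseteq> insert v ({a, b, c} \<union> F)"
proof (cases "adj b c \<longrightarrow> adj a c")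
  case True
  then show ?thesis using tripod_solid_aux[OF T v abc] by blast
next
  case False
  \<comment> \<open>Here \<open>b\<close> sees \<open>c\<close> but \<open>a\<close> does not;
    reversing the tripod exchanges their roles.\<close>
  have "\<exists>U. solid U \<and> insert v {b, a, c} \<subseteq> U \<and> U \<subseteq> insert v ({b, a, c} \<union> F)"
    by (rule tripod_solid_aux[OF tripod_swap[OF T]]) (use v abc False in auto)
  then show ?thesis by (simp add: insert_commute)
qed

lemma joined_interior:
  assumes "joined ({a, b} \<union> F) a b" "a \<noteq> b"
  shows "\<exists>s. ipath (a # s @ [b]) \<and> set s \<subseteq> F"
proof -
  obtain p where p: "ipath p" "hd p = a" "last p = b" "set p \<subseteq> {a, b} \<union> F"
    using assms by (auto simp: joined_def)
  obtain p' where p': "p = a # p'" using p by (cases p) auto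
  then have "p' \<noteq> []" using p assms by auto
  then obtain s where s: "p' = s @ [b]" using p p' by (cases p' rule: rev_cases) auto
  have "a \<notin> set s" "b \<notin> set s" using ipath_distinct[OF p(1)] by (auto simp: p' s)
  then have "set s \<subseteq> F" using p(4) by (auto simp: p' s)
  then show ?thesis using p(1) p' s by blast
qed

text \<open>If a connected part of \<open>F\<close> sees all three neighbours, a tripod provides the
  solid. Otherwise the interiors of the three connecting paths neither meet nor touch, so the paths
  form an induced cycle through \<open>a\<close>, \<open>b\<close> and \<open>c\<close>, and
  \<open>v\<close> is the apex of a pyramid over it.\<close>

lemma triple_solid:
  assumes v: "adj v a" "adj v b" "adj v c" "v \<notin> F" "\<And>x. x \<in> F \<Longrightarrow> \<not> adj v x"
    and abc: "a \<noteq> b" "a \<noteq> c" "b \<noteq> c" and F: "finite F"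
    and J: "joined ({a, b} \<union> F) a b" "joined ({b, c} \<union> F) b c" "joined ({c, a} \<union> F) c a"
  shows "\<exists>U. solid U \<and> insert v {a, b, c} \<subseteq> U \<and> U \<subseteq> insert v ({a, b, c} \<union> F)"
proof -
  have out: "a \<notin> F" "b \<notin> F" "c \<notin> F" using v by blast+
  show ?thesis
  proof (cases "\<exists>X\<subseteq>F. conn X \<and> (\<exists>x\<in>X. adj a x) \<and> (\<exists>x\<in>X. adj b x) \<and> (\<exists>x\<in>X. adj c x)")
    case True
    then obtain p r where "tripod F a b c p r \<or> tripod F c b a p r \<or> tripod F c a b p r"
      using tripod_exists[OF F _ _ _ _ _ out] by blast
    then show ?thesis
    proof (elim disjE)
      assume "tripod F a b c p r"
      from tripod_solid[OF this v abc out] show ?thesis .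
    next
      assume "tripod F c b a p r"
      from tripod_solid[OF this v(3,2,1,4,5) abc(3)[symmetric] abc(2)[symmetric] abc(1)[symmetric] out(3,2,1)]
      show ?thesis by (simp add: insert_commute)
    next
      assume "tripod F c a b p r"
      from tripod_solid[OF this v(3,1,2,4,5) abc(2)[symmetric] abc(3)[symmetric] abc(1) out(3,1,2)]
      show ?thesis by (simp add: insert_commute)
    qed
  next
    case False
    then have no: False
      if "X \<subseteq> F" "conn X" "\<exists>x\<in>X. adj a x" "\<exists>x\<in>X. adj b x" "\<exists>x\<in>X. adj c x" for X
      using that by blast
    obtain s where s: "ipath (a # s @ [b])" "set s \<subseteq> F" using joined_interior[OF J(1)] abc by blast
    obtain t where t: "ipath (b # t @ [c])" "set t \<subseteq> F" using joined_interior[OF J(2)] abc by blast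
    obtain u where u: "ipath (c # u @ [a])" "set u \<subseteq> F" using joined_interior[OF J(3)] abc by blast
    have sees: "adj x (hd r)" "adj y (last r)" "ipath r" if "ipath (x # r @ [y])" "r \<noteq> []" for x y r
      using that by (auto simp: ipath_Cons ipath_snoc)
    \<comment> \<open>The interior of the path between \<open>a\<close> and \<open>b\<close> is
      connected and sees both ends; seeing \<open>c\<close> as well would contradict
      \<open>no\<close>.\<close>
    have N1: "\<not> adj c x" if "x \<in> set s" for x
      using no[OF s(2)] sees[OF s(1)] conn_ipath[of s] that
        by (metis hd_in_set last_in_set list.set_cases list.distinct(1))
    have N2: "\<not> adj a x" if "x \<in> set t" for x
      using no[OF t(2)] sees[OF t(1)] conn_ipath[of t] that
        by (metis hd_in_set last_in_set list.set_cases list.distinct(1))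
    have N3: "\<not> adj b x" if "x \<in> set u" for x
      using no[OF u(2)] sees[OF u(1)] conn_ipath[of u] that
        by (metis hd_in_set last_in_set list.set_cases list.distinct(1))
    \<comment> \<open>Two interiors that meet or touch would form a connected set that sees all
      three vertices.\<close>
    have anti: "\<not> (x = y \<or> adj x y)"
      if "ipath (a' # r1 @ [b'])" "ipath (b' # r2 @ [c'])" "set r1 \<subseteq> F" "set r2 \<subseteq> F" "x \<in> set r1"
        "y \<in> set r2"
        "{a', b', c'} = {a, b, c}" for a' b' c' r1 r2 x y
    proof
      assume xy: "x = y \<or> adj x y"
      have ne: "r1 \<noteq> []" "r2 \<noteq> []" using that by auto
      have "conn (set r1 \<union> set r2)"
        using conn_Un[OF conn_ipath conn_ipath that(5,6) xy] sees that(1,2) ne by blast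
      moreover have "\<exists>x\<in>set r1 \<union> set r2. adj z x" if "z \<in> {a', b', c'}" for z
        using that sees[OF \<open>ipath (a' # r1 @ [b'])\<close>] sees[OF \<open>ipath (b' # r2 @ [c'])\<close>] ne
        by (metis UnI1 UnI2 empty_iff hd_in_set insert_iff last_in_set)
      ultimately show False using no[of "set r1 \<union> set r2"] that(3,4) unfolding that(7) by blast
    qed
    have st: "\<not> (x = y \<or> adj x y)" if "x \<in> set s" "y \<in> set t" for x y
      using anti[OF s(1) t(1) s(2) t(2) that] by blast
    have tu: "\<not> (x = y \<or> adj x y)" if "x \<in> set t" "y \<in> set u" for x y
      using anti[OF t(1) u(1) t(2) u(2) that] by blast
    have us: "\<not> (x = y \<or> adj x y)" if "x \<in> set u" "y \<in> set s" for x y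
      using anti[OF u(1) s(1) u(2) s(2) that] by blast
    \<comment> \<open>Starting after \<open>a\<close>, the cycle passes \<open>s\<close>,
      \<open>b\<close>, \<open>t\<close>, \<open>c\<close> and \<open>u\<close>. Any of the
      interiors may be empty, which is why the neighbours of \<open>a\<close> are described by
      \<open>hd\<close> and \<open>last\<close> of the whole list.\<close>
    define L where "L = (s @ [b]) @ (t @ [c])"
    have is1: "ipath (s @ [b])" "\<And>x. x \<in> set (s @ [b]) \<Longrightarrow> adj a x \<longleftrightarrow> x = hd (s @ [b])"
      "a \<notin> set (s @ [b])"
      using s(1) by (auto simp: ipath_Cons)
    have it1: "ipath (t @ [c])" "\<And>x. x \<in> set (t @ [c]) \<Longrightarrow> adj b x \<longleftrightarrow> x = hd (t @ [c])"
      "b \<notin> set (t @ [c])"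
      using t(1) by (auto simp: ipath_Cons)
    have iu1: "ipath (u @ [a])" "\<And>x. x \<in> set (u @ [a]) \<Longrightarrow> adj c x \<longleftrightarrow> x = hd (u @ [a])"
      "c \<notin> set (u @ [a])"
      using u(1) by (auto simp: ipath_Cons)
    have iL: "ipath L"
    proof -
      have "adj x y \<longleftrightarrow> x = b \<and> y = hd (t @ [c])" if "x \<in> set (s @ [b])" "y \<in> set (t @ [c])" for x y
      proof (cases "x = b")
        case True
        then show ?thesis using it1(2) that by blast
      next
        case False
        then have "x \<in> set s" using that by auto
        then have "\<not> adj x y" using N1[of x] st[of x y] that adj_sym[of x c] by auto
        then show ?thesis using False by simp
      qed
      moreover have "set (s @ [b]) \<inter> set (t @ [c]) = {}"
        using st s(2) out it1(3) by auto
      ultimately show ?thesis unfolding L_def using is1(1) it1(1) by (subst ipath_append) auto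
    qed
    have uL: "adj x y \<longleftrightarrow> x = c \<and> y = hd u" if xy: "x \<in> set L" "y \<in> set u" for x y
    proof -
      consider "x \<in> set s" | "x = b" | "x \<in> set t" | "x = c" using xy by (auto simp: L_def)
      then show ?thesis
      proof cases
        case 1
        then show ?thesis using us[of y x] that adj_sym[of x y] s(2) out by auto
      next
        case 2
        then show ?thesis using N3 that abc by auto
      next
        case 3
        then show ?thesis using tu[of x y] that t(2) out by auto
      next
        case 4
        then show ?thesis using iu1(2)[of y] that by (auto simp: hd_append)
      qed
    qed
    have iLu: "ipath (L @ u)"
    proof (cases "u = []")
      case False
      have "set L \<inter> set u = {}" using us tu u(2) out by (auto simp: L_def)
      moreover have "last L = c" by (simp add: L_def)
      moreover have "ipath u" using sees[OF u(1) False] by simp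
      ultimately show ?thesis using iL False uL L_def by (subst ipath_append) auto
    qed (use iL in simp)
    have hL: "hd (L @ u) = hd (s @ [b])" by (simp add: L_def hd_append)
    have lL: "last (L @ u) = (if u = [] then c else last u)" by (simp add: L_def)
    have La: "adj a x \<longleftrightarrow> x = hd (L @ u) \<or> x = last (L @ u)" if xL: "x \<in> set (L @ u)" for x
    proof -
      have hs: "hd (s @ [b]) \<in> set s \<or> hd (s @ [b]) = b" by (cases s) auto
      have ll: "last (L @ u) \<in> set u \<or> last (L @ u) = c" using lL by auto
      have au: "adj a x \<longleftrightarrow> x = last (L @ u)" if "x \<in> set u"
      proof -
        have "u \<noteq> []" using that by auto
        have "ipath (c # u @ [a])" by (rule u(1))
        then have "ipath (u @ [a])" using \<open>u \<noteq> []\<close> by (simp add: ipath_Cons)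
        then show ?thesis using that \<open>u \<noteq> []\<close> by (simp add: ipath_snoc lL)
      qed
      have ac: "adj a c \<longleftrightarrow> u = []"
        using iu1(2)[of a] adj_sym[of a c] out u(2) by (cases u) auto
      have disj: "set u \<inter> set s = {}" "set u \<inter> set t = {}" using us tu by auto
      consider "x \<in> set s \<or> x = b" | "x \<in> set t" | "x = c" | "x \<in> set u"
        using xL by (auto simp: L_def)
      then show ?thesis
      proof cases
        case 1
        then have "x \<noteq> last (L @ u)" using ll disj s(2) out abc u(2) by auto
        then show ?thesis using is1(2)[of x] 1 hL by auto
      next
        case 2
        then have "x \<noteq> last (L @ u)" "x \<noteq> hd (L @ u)" using ll disj hs hL t(2) out st[of _ x]
          by auto
        then show ?thesis using N2 2 by simp
      next
        case 3
        then have "x \<noteq> hd (L @ u)" using hs hL s(2) out abc by auto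
        moreover have "c \<noteq> last u" if "u \<noteq> []" using last_in_set[OF that] u(2) out by blast
        ultimately show ?thesis using ac 3 lL by auto
      next
        case 4
        then have "x \<noteq> hd (L @ u)" using hs hL disj u(2) out by auto
        then show ?thesis using au 4 by simp
      qed
    qed
    have "closes a (L @ u)"
      unfolding closes_def
    proof (intro conjI ballI)
      show "a \<notin> set (L @ u)" using out s t u abc by (auto simp: L_def)
      show "2 \<le> length (L @ u)" by (simp add: L_def)
    qed (use iLu La in auto)
    from closes_icycle[OF this] have C: "icycle (insert a (set (L @ u)))" .
    have "v \<notin> insert a (set (L @ u))" using v s t u by (auto simp: L_def)
    then have "solid (insert v (insert a (set (L @ u))))"
      using v abc by (intro solid_pyramidI[OF C, of v a b c]) (auto simp: L_def)
    then show ?thesis using s t u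
      by (intro exI[of _ "insert v (insert a (set (L @ u)))"]) (auto simp: L_def)
  qed
qed

end

section \<open>Elimination of vertices\<close>

context sgraph
begin

section \<open>Cycles and solids through the eliminated vertex\<close>

definition ncycles :: "'a set \<Rightarrow> nat" where
  "ncycles X = card {U. U \<subseteq> X \<and> icycle U}"

definition nsolids :: "'a set \<Rightarrow> nat" where
  "nsolids X = card {U. U \<subseteq> X \<and> solid U}"

definition nbhd :: "'a set \<Rightarrow> 'a \<Rightarrow> 'a set" where
  "nbhd X v = {x \<in> X. adj v x}"

text \<open>Sorting the sets through \<open>v\<close> by their trace on the neighbourhood turns the
  counts into sums over pairs and triples of neighbours.\<close>

definition meeting :: "'a set \<Rightarrow> 'a \<Rightarrow> ('a set \<Rightarrow> bool) \<Rightarrow> 'a set \<Rightarrow> 'a set set" where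
  "meeting X v P T = {U. U \<subseteq> X \<and> v \<in> U \<and> P U \<and> U \<inter> nbhd X v = T}"

lemma finite_meeting: "finite X \<Longrightarrow> finite (meeting X v P T)"
  by (rule finite_subset[of _ "Pow X"]) (auto simp: meeting_def)

lemma card_edges_in_remove:
  assumes "finite X" "v \<in> X"
  shows "card (edges_in X) = card (edges_in (X - {v})) + card (nbhd X v)"
proof -
  have "{{v, y} | y. y \<in> X - {v} \<and> adj v y} = (\<lambda>y. {v, y}) ` nbhd X v"
  proof -
    have "y \<in> X - {v} \<and> adj v y \<longleftrightarrow> y \<in> nbhd X v" for y by (auto simp: nbhd_def)
    then show ?thesis by (simp only: Setcompr_eq_image)
  qed
  then have "edges_in X = edges_in (X - {v}) \<union> (\<lambda>y. {v, y}) ` nbhd X v"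
    using edges_in_insert[of v "X - {v}"] insert_Diff[OF assms(2)] by simp
  moreover have "edges_in (X - {v}) \<inter> (\<lambda>y. {v, y}) ` nbhd X v = {}"
    by (auto simp: edges_in_def)
  moreover have "finite (edges_in (X - {v}))"
    by (rule finite_subset[of _ "Pow X"]) (use assms in \<open>auto simp: edges_in_def\<close>)
  moreover have "card ((\<lambda>y. {v, y}) ` nbhd X v) = card (nbhd X v)"
    by (rule card_image) (auto simp: inj_on_def doubleton_eq_iff)
  moreover have "finite (nbhd X v)" using assms by (simp add: nbhd_def)
  ultimately show ?thesis by (simp add: card_Un_disjoint)
qed

lemma card_subsets_remove:
  assumes "finite X" "v \<in> X"
  shows "card {U. U \<subseteq> X \<and> P U} = card {U. U \<subseteq> X - {v} \<and> P U} + card {U. U \<subseteq> X \<and> v \<in> U \<and> P U}"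
proof -
  have "{U. U \<subseteq> X \<and> P U} = {U. U \<subseteq> X - {v} \<and> P U} \<union> {U. U \<subseteq> X \<and> v \<in> U \<and> P U}" by auto
  moreover have "{U. U \<subseteq> X - {v} \<and> P U} \<inter> {U. U \<subseteq> X \<and> v \<in> U \<and> P U} = {}" by auto
  moreover have "finite {U. U \<subseteq> X - {v} \<and> P U}" "finite {U. U \<subseteq> X \<and> v \<in> U \<and> P U}"
    using assms by (auto intro!: finite_subset[of _ "Pow X"])
  ultimately show ?thesis by (simp add: card_Un_disjoint)
qed

lemma sum_card_meeting:
  assumes "finite X" "finite I"
  shows "(\<Sum>T\<in>I. card (meeting X v P T)) = card {U. U \<subseteq> X \<and> v \<in> U \<and> P U \<and> U \<inter> nbhd X v \<in> I}"
proof -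
  have "{U. U \<subseteq> X \<and> v \<in> U \<and> P U \<and> U \<inter> nbhd X v \<in> I} = (\<Union>T\<in>I. meeting X v P T)"
    by (auto simp: meeting_def)
  moreover have "card (\<Union>T\<in>I. meeting X v P T) = (\<Sum>T\<in>I. card (meeting X v P T))"
    using assms by (intro card_UN_disjoint) (auto simp: finite_meeting, auto simp: meeting_def)
  ultimately show ?thesis by simp
qed

lemma closes_mem: assumes "closes v p" shows "hd p \<in> set p" "last p \<in> set p"
proof -
  have "p \<noteq> []" using assms by (auto simp: closes_def)
  then show "hd p \<in> set p" "last p \<in> set p" by simp_all
qed

text \<open>The induced cycles with trace \<open>T\<close> are the closing paths between its two
  elements, completed by \<open>v\<close>. The union of two such paths has the same trace, which
  places the solids obtained from them in the class of \<open>T\<close>.\<close>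

lemma nice_vertex_pair:
  assumes X: "finite X" and v: "nice X v" and T: "T \<subseteq> nbhd X v" "card T = 2"
  shows "1 \<le> card (meeting X v icycle T)"
    "card (meeting X v icycle T) \<le>
      Suc (card (meeting X v solid T))"
proof -
  obtain a b where ab: "T = {a, b}" "a \<noteq> b" using T(2) by (auto simp: card_2_iff)
  have N: "adj v a" "adj v b" "a \<in> X" "b \<in> X" "v \<in> X" "v \<noteq> a" "v \<noteq> b"
    using T ab v by (auto simp: nbhd_def nice_def)
  let ?C = "meeting X v icycle T" and ?S = "meeting X v solid T"
  let ?P = "closing_paths X v a b"
  have meet: "set p \<inter> nbhd X v = T" if "p \<in> ?P" for p
  proof -
    have p: "closes v p" "hd p = a" "last p = b" "set p \<subseteq> X" using that
      by (auto simp: closing_paths_def)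
    then show ?thesis using closes_mem[OF p(1)] ab by (auto simp: nbhd_def closes_def)
  qed
  have vN: "v \<notin> nbhd X v" by (simp add: nbhd_def)
  have "joined ({a, b} \<union> {x \<in> X. x \<noteq> v \<and> \<not> adj v x}) a b" using v N ab by (auto simp: nice_def)
  then obtain p where p: "ipath p" "hd p = a" "last p = b"
    "set p \<subseteq> {a, b} \<union> {x \<in> X. x \<noteq> v \<and> \<not> adj v x}"
    by (auto simp: joined_def)
  have "closes v p"
  proof -
    have "2 \<le> length p" using p ab(2) by (cases p rule: path_edges.cases) auto
    then show ?thesis using p N by (auto simp: closes_def)
  qed
  then have pP: "p \<in> ?P" using p N by (auto simp: closing_paths_def)
  have C: "?C = (\<lambda>p. insert v (set p)) ` ?P"
  proof (intro equalityI subsetI)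
    fix U assume "U \<in> ?C"
    then have U: "U \<subseteq> X" "v \<in> U" "icycle U" "U \<inter> nbhd X v = T" by (auto simp: meeting_def)
    obtain q where q: "closes v q" "U = insert v (set q)" using icycle_closes U by blast
    note mem = closes_mem[OF q(1)]
    have "{hd q, last q} \<subseteq> U \<inter> nbhd X v" using mem q U by (auto simp: closes_def nbhd_def)
    then have "{hd q, last q} \<subseteq> {a, b}" using U ab by simp
    moreover have "hd q \<noteq> last q" using closes_ends q by blast
    ultimately have "hd q = a \<and> last q = b \<or> hd q = b \<and> last q = a" by auto
    then show "U \<in> (\<lambda>p. insert v (set p)) ` ?P"
    proof
      assume "hd q = a \<and> last q = b"
      then have "q \<in> ?P" using q U by (auto simp: closing_paths_def)
      then show ?thesis using q by blast
    next
      assume "hd q = b \<and> last q = a"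
      then have "rev q \<in> ?P" using q U closes_rev by (auto simp: closing_paths_def hd_rev last_rev)
      then show ?thesis using q by (intro image_eqI[of _ _ "rev q"]) auto
    qed
  next
    fix U assume "U \<in> (\<lambda>p. insert v (set p)) ` ?P"
    then obtain q where q: "q \<in> ?P" "U = insert v (set q)" by blast
    then show "U \<in> ?C" using meet[OF q(1)] closes_icycle[of v q] N vN
      by (auto simp: closing_paths_def meeting_def)
  qed
  show "1 \<le> card ?C" using pP C finite_closing_paths[OF X] by (auto simp: Suc_le_eq card_gt_0_iff)
  have "card ?C \<le> card ?P" unfolding C using finite_closing_paths[OF X] by (rule card_image_le)
  also have "\<dots> \<le> Suc (card {U. solid U \<and> (\<exists>p\<in>?P. \<exists>q\<in>?P. U = insert v (set p \<union> set q))})"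
    using card_closing_paths_le[OF X] pP by blast
  also have "card {U. solid U \<and> (\<exists>p\<in>?P. \<exists>q\<in>?P. U = insert v (set p \<union> set q))} \<le> card ?S"
  proof (rule card_mono[OF finite_meeting[OF X]])
    show "{U. solid U \<and> (\<exists>p\<in>?P. \<exists>q\<in>?P. U = insert v (set p \<union> set q))} \<subseteq> ?S"
    proof clarify
      fix p q assume pq: "solid (insert v (set p \<union> set q))" "p \<in> ?P" "q \<in> ?P"
      have "insert v (set p \<union> set q) \<inter> nbhd X v = T" using meet[OF pq(2)] meet[OF pq(3)] vN by blast
      moreover have "insert v (set p \<union> set q) \<subseteq> X" using pq N by (auto simp: closing_paths_def)
      ultimately show "insert v (set p \<union> set q) \<in> ?S" using pq(1) by (simp add: meeting_def)
    qed
  qed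
  finally show "card ?C \<le> Suc (card ?S)" by simp
qed

lemma nice_vertex_triple:
  assumes X: "finite X" and v: "nice X v" and T: "T \<subseteq> nbhd X v" "card T = 3"
  shows "1 \<le> card (meeting X v solid T)"
proof -
  obtain a b c where abc: "T = {a, b, c}" "a \<noteq> b" "a \<noteq> c" "b \<noteq> c" using T(2)
    by (auto simp: card_3_iff)
  define F where "F = {x \<in> X. x \<noteq> v \<and> \<not> adj v x}"
  have N: "adj v a" "adj v b" "adj v c" "a \<in> X" "b \<in> X" "c \<in> X" "v \<in> X"
    using T abc v by (auto simp: nbhd_def nice_def)
  have J: "joined ({x, y} \<union> F) x y" if "x \<in> T" "y \<in> T" "x \<noteq> y" for x y
    using v T that unfolding nice_def nbhd_def F_def by blast
  have "\<exists>U. solid U \<and> insert v {a, b, c} \<subseteq> U \<and> U \<subseteq> insert v ({a, b, c} \<union> F)"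
    by (rule triple_solid) (use N abc J X in \<open>auto simp: F_def\<close>)
  then obtain U where U: "solid U" "insert v {a, b, c} \<subseteq> U" "U \<subseteq> insert v ({a, b, c} \<union> F)" by blast
  then have "U \<in> meeting X v solid T"
    using N abc(1) by (auto simp: F_def nbhd_def meeting_def)
  then have "0 < card (meeting X v solid T)" using finite_meeting[OF X] unfolding card_gt_0_iff
    by blast
  then show ?thesis by simp
qed

text \<open>The second inequality avoids subtraction of natural numbers: it bounds the gain in
  solids from below by the gain in cycles, minus \<open>d choose 2\<close>, plus
  \<open>d choose 3\<close>.\<close>

lemma nice_vertex_counts:
  assumes X: "finite X" and v: "nice X v"
  defines "d \<equiv> card (nbhd X v)"
  shows "ncycles (X - {v}) + (d choose 2) \<le> ncycles X"
    "nsolids (X - {v}) + ncycles X + (d choose 3) \<le> nsolids X + ncycles (X - {v}) + (d choose 2)"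
proof -
  define N where "N = nbhd X v"
  define I where "I k = {T. T \<subseteq> N \<and> card T = k}" for k
  define cy where "cy T = card (meeting X v icycle T)" for T
  define so where "so T = card (meeting X v solid T)" for T
  have vX: "v \<in> X" using v by (simp add: nice_def)
  have finN: "finite N" using X by (simp add: N_def nbhd_def)
  have finI: "finite (I k)" for k using finN by (simp add: I_def)
  have cI: "card (I k) = (d choose k)" for k using n_subsets[OF finN]
    by (simp add: I_def d_def N_def)
  \<comment> \<open>Every induced cycle through \<open>v\<close> has a trace of exactly two
    vertices, so the sum over pairs counts all of them. An exact count is required, because the
    second inequality bounds the number of cycles from above.\<close>
  have two: "U \<inter> N \<in> I 2" if U: "U \<subseteq> X" "v \<in> U" "icycle U" for U
  proof -
    obtain p where p: "closes v p" "U = insert v (set p)" using icycle_closes U by blast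
    have "U \<inter> N = {hd p, last p}" using closes_mem[OF p(1)] p that
      by (auto simp: closes_def N_def nbhd_def)
    then show ?thesis using closes_ends[OF p(1)] by (auto simp: I_def)
  qed
  have cyX: "ncycles X = ncycles (X - {v}) + (\<Sum>T\<in>I 2. cy T)"
  proof -
    have "{U. U \<subseteq> X \<and> v \<in> U \<and> icycle U} = {U. U \<subseteq> X \<and> v \<in> U \<and> icycle U \<and> U \<inter> nbhd X v \<in> I 2}"
      using two by (auto simp: N_def)
    then show ?thesis
      unfolding ncycles_def cy_def sum_card_meeting[OF X finI]
      using card_subsets_remove[OF X vX, of icycle] by simp
  qed
  \<comment> \<open>For solids a lower bound suffices, so those with other traces are
    dropped.\<close>
  have soX: "nsolids (X - {v}) + (\<Sum>T\<in>I 2. so T) + (\<Sum>T\<in>I 3. so T) \<le> nsolids X"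
  proof -
    have "I 2 \<inter> I 3 = {}" by (auto simp: I_def)
    then have "(\<Sum>T\<in>I 2. so T) + (\<Sum>T\<in>I 3. so T) = (\<Sum>T\<in>I 2 \<union> I 3. so T)"
      by (simp add: sum.union_disjoint finI)
    also have "\<dots> \<le> card {U. U \<subseteq> X \<and> v \<in> U \<and> solid U}"
      unfolding so_def using X
        by (subst sum_card_meeting) (auto intro!: card_mono finI finite_subset[of _ "Pow X"])
    finally show ?thesis unfolding nsolids_def using card_subsets_remove[OF X vX, of solid] by simp
  qed
  have c1: "1 \<le> cy T" "cy T \<le> Suc (so T)" if "T \<in> I 2" for T
    using nice_vertex_pair[OF X v, of T] that by (simp_all add: I_def cy_def so_def N_def)
  have s1: "1 \<le> so T" if "T \<in> I 3" for T
    using nice_vertex_triple[OF X v, of T] that by (simp add: I_def so_def N_def)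
  have "(\<Sum>T\<in>I 2. 1) \<le> (\<Sum>T\<in>I 2. cy T)" "(\<Sum>T\<in>I 2. cy T) \<le> (\<Sum>T\<in>I 2. so T) + (\<Sum>T\<in>I 2. 1)"
    "(\<Sum>T\<in>I 3. 1) \<le> (\<Sum>T\<in>I 3. so T)"
    unfolding sum.distrib[symmetric] by (rule sum_mono, use c1 s1 in simp)+
  then have "(d choose 2) \<le> (\<Sum>T\<in>I 2. cy T)" "(\<Sum>T\<in>I 2. cy T) \<le> (\<Sum>T\<in>I 2. so T) + (d choose 2)"
    "(d choose 3) \<le> (\<Sum>T\<in>I 3. so T)"
    by (simp_all add: cI)
  then show "ncycles (X - {v}) + (d choose 2) \<le> ncycles X"
    "nsolids (X - {v}) + ncycles X + (d choose 3) \<le> nsolids X + ncycles (X - {v}) + (d choose 2)"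
    using cyX soX by linarith+
qed

lemma nice_vertex_neighbour:
  assumes "nice X v" "conn X" "x \<in> X" "x \<noteq> v"
  shows "\<exists>n\<in>nbhd X v. joined (X - {v}) x n"
proof -
  have "joined X x v" using assms by (auto simp: conn_def nice_def)
  then obtain p where p: "ipath p" "hd p = x" "last p = v" "set p \<subseteq> X" by (auto simp: joined_def)
  then have "p \<noteq> []" by auto
  then obtain q where q: "p = q @ [v]" using p by (metis append_butlast_last_id)
  have "q \<noteq> []" using q p assms by auto
  then have "ipath q" "v \<notin> set q" "adj v (last q)" "hd q = x" using p q by (auto simp: ipath_snoc)
  then show ?thesis using p q \<open>q \<noteq> []\<close>
    by (intro bexI[of _ "last q"]) (auto simp: joined_def nbhd_def)
qed

text \<open>Every other vertex reaches a neighbour of \<open>v\<close> before it reaches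
  \<open>v\<close>, and any two neighbours are joined by a path that avoids
  \<open>v\<close>.\<close>

lemma nice_vertex_conn:
  assumes "nice X v" "conn X" "X \<noteq> {v}"
  shows "conn (X - {v})" "nbhd X v \<noteq> {}"
proof -
  have vX: "v \<in> X" using assms by (simp add: nice_def)
  obtain x where x: "x \<in> X" "x \<noteq> v" using assms vX by blast
  then show "nbhd X v \<noteq> {}" using nice_vertex_neighbour[OF assms(1,2)] by blast
  have nn: "joined (X - {v}) a b" if "a \<in> nbhd X v" "b \<in> nbhd X v" for a b
  proof (cases "a = b")
    case True
    have "b \<in> X - {v}" using that by (auto simp: nbhd_def)
    then show ?thesis using joined_refl True by simp
  next
    case False
    then have "joined ({a, b} \<union> {x \<in> X. x \<noteq> v \<and> \<not> adj v x}) a b"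
      using assms(1) that by (auto simp: nice_def nbhd_def)
    then show ?thesis by (rule joined_mono) (use that in \<open>auto simp: nbhd_def\<close>)
  qed
  have "joined (X - {v}) a b" if ab: "a \<in> X - {v}" "b \<in> X - {v}" for a b
  proof -
    obtain m n where mn: "m \<in> nbhd X v" "joined (X - {v}) a m" "n \<in> nbhd X v" "joined (X - {v}) b n"
      using nice_vertex_neighbour[OF assms(1,2), of a] nice_vertex_neighbour[OF assms(1,2), of b] ab
        by blast
    show ?thesis using joined_trans[OF joined_trans[OF mn(2) nn[OF mn(1,3)]] joined_sym[OF mn(4)]] .
  qed
  then show "conn (X - {v})" using x by (auto simp: conn_def)
qed

section \<open>Colourings and vertex removal\<close>

definition colorable :: "'a set \<Rightarrow> nat \<Rightarrow> bool" where
  "colorable X k \<longleftrightarrow> (\<exists>c :: 'a \<Rightarrow> nat. (\<forall>x\<in>X. c x < k) \<and> (\<forall>x\<in>X. \<forall>y\<in>X. adj x y \<longrightarrow> c x \<noteq> c y))"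

text \<open>The neighbours use fewer than \<open>k\<close> colours, so one is free for
  \<open>v\<close>. Read contrapositively, removing a vertex can make the graph
  \<open>k\<close>-colourable only if its degree is at least \<open>k\<close>.\<close>

lemma colorable_insert:
  assumes "colorable (X - {v}) k" "v \<in> X" "card (nbhd X v) < k" "finite X"
  shows "colorable X k"
proof -
  obtain c where c: "\<And>x. x \<in> X - {v} \<Longrightarrow> c x < k" 
    "\<And>x y. x \<in> X - {v} \<Longrightarrow> y \<in> X - {v} \<Longrightarrow> adj x y \<Longrightarrow> c x \<noteq> c y"
    using assms(1) unfolding colorable_def by blast
  have "card (c ` nbhd X v) < card {..<k}"
    using card_image_le[of "nbhd X v" c] assms by (simp add: nbhd_def)
  then have "\<not> {..<k} \<subseteq> c ` nbhd X v" using card_mono[of "c ` nbhd X v" "{..<k}"] assms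
    by (auto simp: nbhd_def)
  then obtain j where j: "j < k" "j \<notin> c ` nbhd X v" by auto
  have "(\<forall>x\<in>X. (c(v := j)) x < k) \<and> (\<forall>x\<in>X. \<forall>y\<in>X. adj x y \<longrightarrow> (c(v := j)) x \<noteq> (c(v := j)) y)"
    using c j adj_sym by (auto simp: nbhd_def)
  then show ?thesis unfolding colorable_def by blast
qed

lemma colorable_insert_Suc:
  assumes "colorable (X - {v}) k" shows "colorable X (Suc k)"
proof -
  obtain c where c: "\<And>x. x \<in> X - {v} \<Longrightarrow> c x < k" 
    "\<And>x y. x \<in> X - {v} \<Longrightarrow> y \<in> X - {v} \<Longrightarrow> adj x y \<Longrightarrow> c x \<noteq> c y"
    using assms unfolding colorable_def by blast
  have "(\<forall>x\<in>X. (c(v := k)) x < Suc k) \<and> (\<forall>x\<in>X. \<forall>y\<in>X. adj x y \<longrightarrow> (c(v := k)) x \<noteq> (c(v := k)) y)"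
    using c by (auto simp: less_Suc_eq)
  then show ?thesis unfolding colorable_def by blast
qed

end

section \<open>Binomial formulas for complete graphs\<close>

definition complete_beth1 :: "nat \<Rightarrow> int" where "complete_beth1 k = int (k choose 2) - int k"
definition complete_beth2 :: "nat \<Rightarrow> int" where "complete_beth2 k = int (k choose 3) - int (k choose 2) + int k"
definition complete_beth3 :: "nat \<Rightarrow> int" where
  "complete_beth3 k = int (k choose 4) - int (k choose 3) + int (k choose 2) - int k"

lemma choose_Suc: "Suc k choose 2 = (k choose 2) + k" "Suc k choose 3 = (k choose 3) + (k choose 2)"
  "Suc k choose 4 = (k choose 4) + (k choose 3)"
  by (simp_all add: numeral_eq_Suc)

lemma complete_beth_Suc:
  "complete_beth1 (Suc k) = complete_beth1 k + (int k - 1)"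
  "complete_beth2 (Suc k) = complete_beth2 k + (int (k choose 2) - int k + 1)"
  "complete_beth3 (Suc k) = complete_beth3 k + (int (k choose 3) - int (k choose 2) + int k - 1)"
  by (simp_all add: complete_beth1_def complete_beth2_def complete_beth3_def choose_Suc)

text \<open>Up to constants these are the growth terms of \<open>complete_beth2\<close> and
  \<open>complete_beth3\<close>. The differences of the second expression are the values of the
  first plus one, which are nonnegative from 1 on. The start at 1 matters: the first expression
  drops from 0 to -1 between 0 and 1.\<close>

lemma increments_mono:
  assumes "1 \<le> j" "j \<le> d"
  shows "int (j choose 2) - int j \<le> int (d choose 2) - int d"
    "int (j choose 3) - int (j choose 2) + int j \<le> int (d choose 3) - int (d choose 2) + int d"
proof -
  have *: "0 \<le> int (k choose 2) - int k + 1" if "1 \<le> k" for k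
    using that by (induction k rule: dec_induct) (simp_all add: choose_Suc numeral_eq_Suc)
  show "int (j choose 2) - int j \<le> int (d choose 2) - int d"
    using assms(2) by (induction d rule: dec_induct) (use assms(1) in \<open>simp_all add: choose_Suc\<close>)
  show "int (j choose 3) - int (j choose 2) + int j \<le> int (d choose 3) - int (d choose 2) + int d"
    using assms(2)
  proof (induction d rule: dec_induct)
    case (step d)
    then show ?case using *[of d] assms(1) by (simp add: choose_Suc)
  qed simp
qed

lemma increments_nonneg:
  assumes "1 \<le> d"
  shows "0 \<le> int (d choose 2) - int d + 1" "0 \<le> int (d choose 3) - int (d choose 2) + int d - 1"
  using increments_mono[of 1 d] assms by (simp_all add: numeral_eq_Suc)

text \<open>The threshold is dictated by \<open>complete_beth3\<close>, whose values at 3 and 4 are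
  both -1; from 4 on all increments are positive.\<close>

lemma complete_beth_strict_mono:
  assumes "4 \<le> h" "h < k"
  shows "complete_beth1 h < complete_beth1 k" "complete_beth2 h < complete_beth2 k"
    "complete_beth3 h < complete_beth3 k"
proof -
  have 4: "(4::nat) choose 2 = 6" "(4::nat) choose 3 = 4" by (simp_all add: numeral_eq_Suc)
  have inc: "0 < int d - 1" "0 < int (d choose 2) - int d + 1"
    "0 < int (d choose 3) - int (d choose 2) + int d - 1"
    if "4 \<le> d" for d
    using increments_mono[of 4 d] that by (simp_all add: 4)
  have "Suc h \<le> k" using assms by simp
  then have "complete_beth1 h < complete_beth1 k \<and> complete_beth2 h < complete_beth2 k \<and> complete_beth3 h < complete_beth3 k"
  proof (induction k rule: dec_induct)
    case base
    then show ?case using inc[OF assms(1)] by (simp add: complete_beth_Suc)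
  next
    case (step k)
    then have "4 \<le> k" using assms by simp
    then show ?case using inc[of k] step by (simp add: complete_beth_Suc)
  qed
  then show "complete_beth1 h < complete_beth1 k" "complete_beth2 h < complete_beth2 k"
    "complete_beth3 h < complete_beth3 k" by auto
qed

context sgraph
begin

text \<open>The same eliminated vertex, of degree \<open>d\<close>, serves all three bounds. If the
  rest is still not \<open>k\<close>-colourable, nonnegativity of the increments suffices. Otherwise
  \<open>k \<le> d\<close>, the rest needs \<open>k\<close> colours, and the gain is at least that
  from \<open>K\<^sup>k\<close> to the next complete graph.\<close>

theorem beth_lower_bounds:
  assumes "finite X" "conn X" "\<not> colorable X k"
  shows "complete_beth1 (Suc k) \<le> int (card (edges_in X)) - int (card X) \<and>
    complete_beth2 (Suc k) \<le> int (ncycles X) - int (card (edges_in X)) + int (card X) \<and>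
    complete_beth3 (Suc k) \<le> int (nsolids X) - int (ncycles X) + int (card (edges_in X)) - int (card X)"
  using assms
proof (induction "card X" arbitrary: X k rule: less_induct)
  case less
  obtain v where v: "nice X v" using nice_exists[of X] less.prems unfolding conn_def by blast
  define d where "d = card (nbhd X v)"
  define Y where "Y = X - {v}"
  have vX: "v \<in> X" using v by (simp add: nice_def)
  have E: "card (edges_in X) = card (edges_in Y) + d"
    using card_edges_in_remove[OF less.prems(1) vX] by (simp add: Y_def d_def)
  have V: "card X = card Y + 1" "card Y < card X"
    using vX less.prems(1) card_Suc_Diff1[of X v] by (auto simp: Y_def)
  note counts = nice_vertex_counts[OF less.prems(1) v, folded d_def Y_def]
  have finY: "finite Y" using less.prems by (simp add: Y_def)
  show ?case
  proof (cases "X = {v}")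
    case True
    then have Y: "Y = {}" "d = 0" by (auto simp: Y_def d_def nbhd_def)
    have "colorable X (Suc k')" for k' using True unfolding colorable_def
      by (intro exI[of _ "\<lambda>_. 0"]) auto
    \<comment> \<open>One vertex is colourable with any positive number of colours, so only the
      values -1, 1 and -1 at a single vertex are claimed.\<close>
    then have k: "k = 0" using less.prems(3) by (cases k) auto
    have "\<not> icycle {}" by (auto simp: icycle_def is_cycle_def induced_on_def cycle_graph_def)
    then have "ncycles Y = 0" "edges_in Y = {}"
      by (auto simp: Y ncycles_def edges_in_def) (auto simp: edges_in_iff elim: edge_cases)
    then show ?thesis using E V counts k unfolding Y
      by (simp add: complete_beth1_def complete_beth2_def complete_beth3_def binomial_eq_0)
  next
    case False
    have Y: "conn Y" "1 \<le> d"
      using nice_vertex_conn[OF v less.prems(2) False] less.prems(1)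
      by (auto simp: Y_def d_def Suc_le_eq card_gt_0_iff nbhd_def)
    note inc = increments_nonneg[OF Y(2)]
    show ?thesis
    proof (cases "colorable Y k")
      case False
      then show ?thesis using less.hyps[OF V(2) finY Y(1) False] E V counts inc Y(2) by simp
    next
      case True
      have kd: "k \<le> d"
        using colorable_insert[of X v k] True less.prems vX unfolding Y_def d_def by (metis not_le)
      have "Y \<noteq> {}" using Y by (auto simp: conn_def)
      \<comment> \<open>The rest is nonempty and \<open>k\<close>-colourable, so \<open>k\<close> is
        positive and the induction hypothesis can be applied with one colour fewer.\<close>
      then obtain j where j: "k = Suc j" using True by (cases k) (auto simp: colorable_def)
      have "\<not> colorable Y j" using colorable_insert_Suc[of X v j] less.prems(3) j
        by (auto simp: Y_def)
      from less.hyps[OF V(2) finY Y(1) this]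
      show ?thesis using E V counts increments_mono[of k d] kd j by (simp add: complete_beth_Suc)
    qed
  qed
qed

end

section \<open>Complete minors\<close>

context sgraph
begin

lemma inj_induced_on: "inj_on (induced_on G) A"
  by (rule inj_onI) (metis vertices_induced_on)

lemma card_induced_cycles: "card (induced_cycles G) = ncycles (vertices G)"
proof -
  have "induced_cycles G = induced_on G ` {U. U \<subseteq> vertices G \<and> icycle U}"
    by (auto simp: induced_cycles_def is_induced_subgraph_def icycle_def)
  then show ?thesis by (simp add: ncycles_def card_image inj_induced_on)
qed

lemma card_solids: "card (solids G) = nsolids (vertices G)"
proof -
  have "solids G = induced_on G ` {U. U \<subseteq> vertices G \<and> solid U}"
    by (auto simp: solids_def is_induced_subgraph_def solid_def)
  then show ?thesis by (simp add: nsolids_def card_image inj_induced_on)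
qed

lemma edges_in_vertices: "edges_in (vertices G) = edges G"
  using simple by (auto simp: edges_in_def simple_graph_def)

lemma proper_coloring_iff_colorable: "(\<exists>c. proper_coloring G k c) \<longleftrightarrow> colorable (vertices G) k"
proof -
  have "proper_coloring G k c \<longleftrightarrow>
      (\<forall>x\<in>vertices G. c x < k) \<and> (\<forall>x\<in>vertices G. \<forall>y\<in>vertices G. adj x y \<longrightarrow> c x \<noteq> c y)" for c
    using adj_vertices by (auto simp: proper_coloring_def adj_def)
  then show ?thesis by (simp add: colorable_def)
qed

lemma not_colorable_less_chromatic_number:
  "k < chromatic_number G \<Longrightarrow> \<not> colorable (vertices G) k"
  unfolding chromatic_number_def proper_coloring_iff_colorable by (rule not_less_Least)

lemma is_minor_iff:
  "is_minor H G \<longleftrightarrow> (\<exists>B. disjoint_family_on B (vertices H) \<and>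
    (\<forall>v\<in>vertices H. B v \<subseteq> vertices G \<and> conn (B v)) \<and>
    (\<forall>u v. {u, v} \<in> edges H \<longrightarrow> (\<exists>x\<in>B u. \<exists>y\<in>B v. adj x y)))"
  unfolding is_minor_def graph_connected_induced_on adj_def ..

lemma complete_minorI:
  fixes B :: "nat \<Rightarrow> 'a set"
  assumes "\<And>i. i < t \<Longrightarrow> B i \<subseteq> vertices G \<and> conn (B i)"
    "\<And>i j. i < j \<Longrightarrow> j < t \<Longrightarrow> B i \<inter> B j = {} \<and> (\<exists>x\<in>B i. \<exists>y\<in>B j. adj x y)"
  shows "is_minor (complete_graph t) G"
  unfolding is_minor_iff
proof (intro exI conjI allI impI ballI)
  show "disjoint_family_on B (vertices (complete_graph t))"
    using assms(2)
      by (auto simp: disjoint_family_on_def complete_graph_def) (metis disjoint_iff linorder_neqE_nat)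
  show "B i \<subseteq> vertices G" "conn (B i)" if "i \<in> vertices (complete_graph t)" for i
    using assms(1) that by (auto simp: complete_graph_def)
  show "\<exists>x\<in>B i. \<exists>y\<in>B j. adj x y" if "{i, j} \<in> edges (complete_graph t)" for i j
  proof -
    have "i < t" "j < t" "i \<noteq> j" using that by (auto simp: complete_graph_def doubleton_eq_iff)
    then show ?thesis using assms(2)[of i j] assms(2)[of j i] adj_sym by (metis linorder_neqE_nat)
  qed
qed

text \<open>Representatives chosen from the branch sets are distinct. The bound makes the set under
  \<open>Max\<close> in \<open>hadwiger_number\<close> finite.\<close>

lemma complete_minor_card:
  assumes "is_minor (complete_graph t) G" shows "t \<le> card (vertices G)"
proof -
  obtain B :: "nat \<Rightarrow> 'a set" where B: "disjoint_family_on B {..<t}"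
    "\<And>i. i < t \<Longrightarrow> B i \<subseteq> vertices G \<and> conn (B i)"
    using assms unfolding is_minor_iff by (auto simp: complete_graph_def)
  define f where "f i = (SOME x. x \<in> B i)" for i
  have f: "f i \<in> B i" if "i < t" for i
    using B(2)[OF that] unfolding f_def conn_def by (metis some_in_eq)
  have "inj_on f {..<t}"
  proof (rule inj_onI)
    fix i j assume "i \<in> {..<t}" "j \<in> {..<t}" "f i = f j"
    then show "i = j" using f[of i] f[of j] B(1) by (auto simp: disjoint_family_on_def)
  qed
  moreover have "f ` {..<t} \<subseteq> vertices G" using f B(2) by blast
  ultimately show ?thesis using card_inj_on_le[of f "{..<t}"] finite_vertices by simp
qed

lemma finite_complete_minors: "finite {t. is_minor (complete_graph t) G}"
  by (rule finite_subset[of _ "{..card (vertices G)}"]) (use complete_minor_card in auto)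

lemma hadwiger_ge: "is_minor (complete_graph t) G \<Longrightarrow> t \<le> hadwiger_number G"
  unfolding hadwiger_number_def using finite_complete_minors by (intro Max_ge) auto

lemma conn_singleton: "conn {x}"
  by (auto intro!: connI joined_refl)

lemma hadwiger_ge_1: assumes "vertices G \<noteq> {}" shows "1 \<le> hadwiger_number G"
proof -
  obtain x where "x \<in> vertices G" using assms by blast
  then show ?thesis
    by (intro hadwiger_ge complete_minorI[of _ "\<lambda>_. {x}"]) (auto simp: conn_singleton)
qed

lemma hadwiger_ge_2: assumes "adj x y" shows "2 \<le> hadwiger_number G"
  by (rule hadwiger_ge, rule complete_minorI[of _ "\<lambda>i. if i = 0 then {x} else {y}"])
    (use assms adj_vertices[OF assms] in \<open>auto simp: conn_singleton\<close>)

text \<open>The cycle is contracted to a triangle: two consecutive vertices stay single, and the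
  remaining path is the third branch set.\<close>

lemma hadwiger_ge_3: assumes "icycle U" shows "3 \<le> hadwiger_number G"
proof -
  have "U \<noteq> {}" using assms by (auto simp: icycle_def is_cycle_def induced_on_def cycle_graph_def)
  then obtain v where "v \<in> U" by blast
  from icycle_closes[OF assms this] obtain p where p: "closes v p" "U = insert v (set p)" .
  then obtain x q where q: "p = x # q" "q \<noteq> []"
    by (cases p rule: path_edges.cases) (auto simp: closes_def)
  have V: "U \<subseteq> vertices G" using icycle_vertices assms .
  have a: "adj v x" "adj v (last q)" "adj x (hd q)" "v \<noteq> x" "v \<notin> set q" "x \<notin> set q" "conn (set q)"
    using p q conn_ipath by (auto simp: closes_def ipath_Cons)
  define B where "B i = (if i = 0 then {v} else if i = 1 then {x} else set q)" for i :: nat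
  have "is_minor (complete_graph 3) G"
  proof (rule complete_minorI[of _ B])
    show "B i \<subseteq> vertices G \<and> conn (B i)" for i using p q V a by (auto simp: B_def conn_singleton)
    fix i j :: nat assume ij: "i < j" "j < 3"
    then have "(i = 0 \<and> j = 1) \<or> (i = 0 \<and> j = 2) \<or> (i = 1 \<and> j = 2)" by linarith
    then show "B i \<inter> B j = {} \<and> (\<exists>x\<in>B i. \<exists>y\<in>B j. adj x y)"
      using a q(2) last_in_set[OF q(2)] hd_in_set[OF q(2)] by (auto simp: B_def)
  qed
  then show ?thesis by (rule hadwiger_ge)
qed

lemma complete_minor_4I:
  assumes "conn A" "conn B" "conn C" "conn D" "A \<union> B \<union> C \<union> D \<subseteq> vertices G"
    "A \<inter> B = {}" "A \<inter> C = {}" "A \<inter> D = {}" "B \<inter> C = {}" "B \<inter> D = {}" "C \<inter> D = {}"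
    "\<exists>x\<in>A. \<exists>y\<in>B. adj x y" "\<exists>x\<in>A. \<exists>y\<in>C. adj x y" "\<exists>x\<in>A. \<exists>y\<in>D. adj x y"
    "\<exists>x\<in>B. \<exists>y\<in>C. adj x y" "\<exists>x\<in>B. \<exists>y\<in>D. adj x y" "\<exists>x\<in>C. \<exists>y\<in>D. adj x y"
  shows "is_minor (complete_graph 4) G"
proof -
  define F where "F i = (if i = 0 then A else if i = 1 then B else if i = 2 then C else D)" for i :: nat
  have F: "F 0 = A" "F 1 = B" "F 2 = C" "F 3 = D" by (simp_all add: F_def)
  show ?thesis
  proof (rule complete_minorI[of _ F])
    fix i :: nat assume "i < 4"
    show "F i \<subseteq> vertices G \<and> conn (F i)" using assms(1-5) by (auto simp: F_def)
  next
    fix i j :: nat assume ij: "i < j" "j < 4"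
    then have "(i = 0 \<and> (j = 1 \<or> j = 2 \<or> j = 3)) \<or> (i = 1 \<and> (j = 2 \<or> j = 3)) \<or> (i = 2 \<and> j = 3)"
      by linarith
    then show "F i \<inter> F j = {} \<and> (\<exists>x\<in>F i. \<exists>y\<in>F j. adj x y)"
      using assms(6-) F by (elim disjE conjE) simp_all
  qed
qed

text \<open>Three branch sets are the single vertices \<open>v\<close>, \<open>a\<close> and
  \<open>b\<close>. The fourth is another neighbour \<open>c\<close> together with the paths that
  connect it to \<open>a\<close> and \<open>b\<close>; their interiors lie outside the neighbourhood
  of \<open>v\<close>, so \<open>a\<close> and \<open>b\<close> themselves stay free.\<close>

lemma nice_vertex_K4:
  assumes v: "nice X v" "X \<subseteq> vertices G"
    and N: "3 \<le> card (nbhd X v)" "a \<in> nbhd X v" "b \<in> nbhd X v" "adj a b"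
  shows "is_minor (complete_graph 4) G"
proof -
  have "\<not> nbhd X v \<subseteq> {a, b}"
  proof
    assume "nbhd X v \<subseteq> {a, b}"
    then have "card (nbhd X v) \<le> card {a, b}" by (intro card_mono) auto
    then show False using N(1) card_insert_le_m1[of 2 "{b}" a]
      by (simp add: card_insert_if split: if_splits)
  qed
  then obtain c where c: "c \<in> nbhd X v" "c \<noteq> a" "c \<noteq> b" by blast
  have ab: "a \<noteq> b" using N(4) by auto
  define F where "F = {x \<in> X. x \<noteq> v \<and> \<not> adj v x}"
  have in_X: "a \<in> X" "b \<in> X" "c \<in> X" "v \<in> X" "adj v a" "adj v b" "adj v c" "v \<noteq> a" "v \<noteq> b" "v \<noteq> c"
    using v N c by (auto simp: nice_def nbhd_def)
  have "joined ({a, c} \<union> F) a c" "joined ({b, c} \<union> F) b c"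
    using v(1) in_X c(2,3) by (auto simp: nice_def F_def)
  then obtain s t where s: "ipath (a # s @ [c])" "set s \<subseteq> F"
    and t: "ipath (b # t @ [c])" "set t \<subseteq> F"
    using joined_interior c by metis
  have first: "ipath (r @ [c])" "adj x (hd (r @ [c]))" if "ipath (x # r @ [c])" for x r
    using that by (simp add: ipath_Cons, cases r) (simp_all add: ipath_Cons)
  note s' = first[OF s(1)] and t' = first[OF t(1)]
  define D where "D = set (s @ [c]) \<union> set (t @ [c])"
  have D: "conn D" unfolding D_def
    by (rule conn_Un[OF conn_ipath[OF s'(1)] conn_ipath[OF t'(1)], of c c]) auto
  have hD: "hd (s @ [c]) \<in> D" "hd (t @ [c]) \<in> D" unfolding D_def
    by (metis UnI1 hd_in_set snoc_eq_iff_butlast, metis UnI2 hd_in_set snoc_eq_iff_butlast)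
  have sub: "D \<subseteq> insert c F" "c \<in> D" using s t by (auto simp: D_def)
  show ?thesis
    by (rule complete_minor_4I[of "{v}" "{a}" "{b}" D])
      (use D hD sub in_X v(2) ab c s' t' N(4) in \<open>auto simp: conn_singleton F_def\<close>)
qed

end

section \<open>Graphs that are not 3-colourable\<close>

text \<open>Branch sets compose by taking unions. Such a union is connected because an induced path
  in \<open>G'\<close> lifts to a chain of connected sets in \<open>G\<close>, consecutive ones
  being linked by an edge.\<close>

lemma is_minor_trans:
  assumes G: "simple_graph G" and G': "simple_graph G'" and HG: "is_minor H G'"
    and GG: "is_minor G' G"
  shows "is_minor H G"
proof -
  interpret G: sgraph G by unfold_locales (rule G)
  interpret G': sgraph G' by unfold_locales (rule G')
  obtain B where B: "disjoint_family_on B (vertices H)"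
    "\<And>v. v \<in> vertices H \<Longrightarrow> B v \<subseteq> vertices G' \<and> G'.conn (B v)"
    "\<And>u v. {u, v} \<in> edges H \<Longrightarrow> \<exists>x\<in>B u. \<exists>y\<in>B v. G'.adj x y"
    using HG unfolding G'.is_minor_iff by blast
  obtain R where R: "disjoint_family_on R (vertices G')"
    "\<And>v. v \<in> vertices G' \<Longrightarrow> R v \<subseteq> vertices G \<and> G.conn (R v)"
    "\<And>u v. G'.adj u v \<Longrightarrow> \<exists>x\<in>R u. \<exists>y\<in>R v. G.adj x y"
    using GG unfolding G.is_minor_iff G'.adj_def by blast
  have path: "G.conn (\<Union>x\<in>set p. R x)" if "G'.ipath p" "set p \<subseteq> vertices G'" for p
    using that
  proof (induction p)
    case (Cons x p)
    show ?case
    proof (cases "p = []")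
      case True
      then show ?thesis using R(2)[of x] Cons.prems by simp
    next
      case False
      then have p: "G'.ipath p" "G'.adj x (hd p)" "hd p \<in> set p" using Cons.prems
        by (auto simp: G'.ipath_Cons)
      obtain a b where ab: "a \<in> R x" "b \<in> R (hd p)" "G.adj a b" using R(3)[OF p(2)] by blast
      have "G.conn (R x \<union> (\<Union>x\<in>set p. R x))"
        by (rule G.conn_Un[of _ _ a b]) (use R(2)[of x] Cons p ab in auto)
      then show ?thesis by simp
    qed
  qed simp
  have un: "G.conn (\<Union>x\<in>X. R x)" if X: "G'.conn X" "X \<subseteq> vertices G'" for X
  proof -
    obtain x a where x: "x \<in> X" "a \<in> R x" using X R(2) unfolding G'.conn_def G.conn_def by blast
    show ?thesis
    proof (rule G.connI)
      show "a \<in> (\<Union>x\<in>X. R x)" using x by blast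
      fix b assume "b \<in> (\<Union>x\<in>X. R x)"
      then obtain y where y: "y \<in> X" "b \<in> R y" by blast
      then obtain p where p: "G'.ipath p" "hd p = x" "last p = y" "set p \<subseteq> X"
        using X x unfolding G'.conn_def G'.joined_def by blast
      then have "p \<noteq> []" by auto
      then have "x \<in> set p" "y \<in> set p" using p by auto
      then have "G.joined (\<Union>x\<in>set p. R x) a b"
        using path[OF p(1)] p(4) X(2) x y unfolding G.conn_def by blast
      then show "G.joined (\<Union>x\<in>X. R x) a b" by (rule G.joined_mono) (use p in blast)
    qed
  qed
  define B' where "B' h = (\<Union>x\<in>B h. R x)" for h
  show ?thesis unfolding G.is_minor_iff
  proof (intro exI[of _ B'] conjI ballI allI impI)
    show "disjoint_family_on B' (vertices H)"
      unfolding disjoint_family_on_def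
    proof (intro ballI impI)
      fix g h assume gh: "g \<in> vertices H" "h \<in> vertices H" "g \<noteq> h"
      have "R x \<inter> R y = {}" if "x \<in> B g" "y \<in> B h" for x y
      proof -
        have "x \<noteq> y" using that gh B(1) by (auto simp: disjoint_family_on_def)
        then show ?thesis using R(1) B(2) gh that by (auto simp: disjoint_family_on_def)
      qed
      then show "B' g \<inter> B' h = {}" unfolding B'_def by blast
    qed
    fix h assume h: "h \<in> vertices H"
    show "B' h \<subseteq> vertices G" using B(2)[OF h] R(2) unfolding B'_def by blast
    show "G.conn (B' h)" using B(2)[OF h] un unfolding B'_def by blast
  next
    fix g h assume "{g, h} \<in> edges H"
    then obtain x y where "x \<in> B g" "y \<in> B h" "G'.adj x y" using B(3) by blast
    then show "\<exists>x\<in>B' g. \<exists>y\<in>B' h. G.adj x y" using R(3)[of x y] unfolding B'_def by blast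
  qed
qed

text \<open>If the chosen vertex \<open>v\<close> has
  at least three neighbours and no \<open>K\<^sup>4\<close> minor appears, its neighbourhood is independent; in a
  colouring of the graph with \<open>v\<close> and its neighbours contracted, all neighbours of \<open>v\<close> get one colour,
  and \<open>v\<close> can be recoloured.\<close>

lemma K4_minor_if_not_3_colorable:
  assumes "simple_graph G" "\<not> sgraph.colorable G (vertices G) 3"
  shows "is_minor (complete_graph 4) G"
  using assms
proof (induction "card (vertices G)" arbitrary: G rule: less_induct)
  case less
  interpret sgraph G by unfold_locales (rule less.prems)
  define V where "V = vertices G"
  have finV: "finite V" by (simp add: V_def finite_vertices)
  have "V \<noteq> {}" using less.prems(2) by (auto simp: colorable_def V_def)
  then obtain v where v: "nice V v" using nice_exists finV by blast
  have vV: "v \<in> V" using v by (simp add: nice_def)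
  define N where "N = nbhd V v"
  have N: "N \<subseteq> V" "v \<notin> N" "\<And>x. x \<in> N \<longleftrightarrow> adj v x" "finite N"
    using adj_vertices finV by (auto simp: N_def nbhd_def V_def)
  show ?case
  proof (cases "card N < 3")
    case True
    define G' where "G' = induced_on G (V - {v})"
    have G': "simple_graph G'" "vertices G' = V - {v}"
      using simple finV by (auto simp: G'_def induced_on_def simple_graph_def)
    interpret G': sgraph G' by unfold_locales (rule G')
    have ed: "edges G' = {e \<in> edges G. e \<subseteq> V - {v}}" by (simp add: G'_def induced_on_def)
    have adj': "G'.adj x y \<longleftrightarrow> adj x y \<and> x \<noteq> v \<and> y \<noteq> v" for x y
      unfolding G'.adj_def ed using adj_vertices[of x y] by (auto simp: adj_def V_def)
    have "\<not> colorable (V - {v}) 3"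
      using colorable_insert[of V v 3] vV True finV less.prems(2) by (auto simp: N_def V_def)
    moreover have "G'.colorable (V - {v}) 3 \<longleftrightarrow> colorable (V - {v}) 3"
      unfolding colorable_def G'.colorable_def
      by (intro ex_cong1 conj_cong ball_cong refl) (simp add: adj')
    ultimately have "\<not> G'.colorable (V - {v}) 3" by simp
    then have "is_minor (complete_graph 4) G'"
      using G' card_Diff1_less[OF finV vV] by (intro less.hyps) (simp_all add: V_def)
    moreover have "is_minor G' G" unfolding is_minor_iff
      by (intro exI[of _ "\<lambda>x. {x}"])
        (auto simp: disjoint_family_on_def G'(2) conn_singleton V_def adj' G'.adj_def[symmetric])
    ultimately show ?thesis using is_minor_trans simple G'(1) by blast
  next
    case False
    show ?thesis
    proof (cases "\<exists>a\<in>N. \<exists>b\<in>N. adj a b")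
      case True
      then show ?thesis using nice_vertex_K4[OF v] False by (auto simp: V_def N_def)
    next
      case indep: False
      \<comment> \<open>Adjacency after the contraction of \<open>v\<close> and all its neighbours
        to the vertex \<open>v\<close>. All edges of \<open>v\<close> itself lead into
        \<open>N\<close> and disappear.\<close>
      define A where "A x y \<longleftrightarrow> x \<in> V - N \<and> y \<in> V - N \<and> x \<noteq> y \<and>
        (adj x y \<or> x = v \<and> (\<exists>n\<in>N. adj n y) \<or> y = v \<and> (\<exists>n\<in>N. adj n x))" for x y
      have A_sym: "A x y \<longleftrightarrow> A y x" for x y unfolding A_def using adj_sym by blast
      define G' where "G' = \<lparr>vertices = V - N, edges = {{x, y} | x y. A x y}\<rparr>"
      have G': "simple_graph G'" "vertices G' = V - N"
        using finV by (auto simp: G'_def simple_graph_def A_def)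
      interpret G': sgraph G' by unfold_locales (rule G')
      have adj': "G'.adj x y \<longleftrightarrow> A x y" for x y
      proof -
        have "edges G' = {{x, y} | x y. A x y}" by (simp add: G'_def)
        then show ?thesis unfolding G'.adj_def using A_sym by (auto simp: doubleton_eq_iff)
      qed
      have "N \<noteq> {}" using False by auto
      then have "card (V - N) < card V" using N(1) finV by (intro psubset_card_mono) auto
      moreover have "\<not> G'.colorable (V - N) 3"
      proof
        assume "G'.colorable (V - N) 3"
        then obtain c where c: "\<And>x. x \<in> V - N \<Longrightarrow> c x < 3"
          "\<And>x y. A x y \<Longrightarrow> c x \<noteq> (c y :: nat)"
          unfolding G'.colorable_def adj' by (metis A_def)
        \<comment> \<open>Any colour below 3 other than \<open>c v\<close>, which is now used on all
          of \<open>N\<close>, is suitable for \<open>v\<close>.\<close>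
        define j where "j = (if c v = 0 then 1 else 0 :: nat)"
        define c' where "c' x = (if x = v then j else if x \<in> N then c v else c x)" for x
        have cv: "c v < 3" using c(1)[of v] vV N(2) by simp
        have j: "j < 3" "j \<noteq> c v" by (auto simp: j_def)
        have ne: "c' x \<noteq> c' y" if xy: "adj x y" "y \<noteq> v" for x y
        proof -
          have V: "x \<in> V" "y \<in> V" "x \<noteq> y" using xy adj_vertices by (auto simp: V_def)
          consider "x = v" | "x \<noteq> v" "x \<in> N" | "x \<noteq> v" "x \<notin> N" by blast
          then show ?thesis
          proof cases
            case 1
            then have "y \<in> N" using N(3) xy by simp
            then show ?thesis using 1 xy j by (simp add: c'_def)
          next
            case 2
            then have "y \<notin> N" using indep xy by blast
            then have "A v y" using 2 xy V vV N by (auto simp: A_def)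
            then show ?thesis using 2 xy \<open>y \<notin> N\<close> c(2)[of v y] by (simp add: c'_def)
          next
            case 3
            show ?thesis
            proof (cases "y \<in> N")
              case True
              then have "A v x" using 3 xy V vV N adj_sym[of x y] by (auto simp: A_def)
              then show ?thesis using 3 xy True c(2)[of v x] by (simp add: c'_def)
            next
              case False
              then have "A x y" using 3 xy V by (auto simp: A_def)
              then show ?thesis using 3 xy False c(2)[of x y] by (simp add: c'_def)
            qed
          qed
        qed
        have "c' x \<noteq> c' y" if "adj x y" for x y
        proof (cases "y = v")
          case True
          then have "x \<noteq> v" "adj y x" using that adj_sym[of x y] by auto
          then show ?thesis using ne[of y x] by auto
        qed (use ne that in blast)
        moreover have "c' x < 3" if "x \<in> V" for x using that c(1) cv j by (auto simp: c'_def)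
        ultimately have "colorable V 3" unfolding colorable_def by blast
        then show False using less.prems(2) by (simp add: V_def)
      qed
      ultimately have "is_minor (complete_graph 4) G'" using G'
        by (intro less.hyps) (simp_all add: V_def)
      moreover have "is_minor G' G" unfolding is_minor_iff
      proof (intro exI conjI ballI allI impI)
        let ?R = "\<lambda>x. if x = v then insert v N else {x}"
        show "disjoint_family_on ?R (vertices G')" by (auto simp: disjoint_family_on_def G'(2))
        show "?R x \<subseteq> vertices G" if "x \<in> vertices G'" for x using that N vV
          by (auto simp: G'(2) V_def)
        have "conn (insert v N)"
        proof (rule connI[of v])
          fix b assume "b \<in> insert v N"
          then show "joined (insert v N) v b" using N(3) by (auto intro: joined_refl joined_adj)
        qed simp
        then show "conn (?R x)" for x by (simp add: conn_singleton)
        show "\<exists>a\<in>?R x. \<exists>b\<in>?R y. adj a b" if "{x, y} \<in> edges G'" for x y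
        proof -
          have "A x y" using that adj' by (simp add: G'.adj_def)
          then show ?thesis unfolding A_def using adj_sym by auto
        qed
      qed
      ultimately show ?thesis using is_minor_trans simple G'(1) by blast
    qed
  qed
qed

section \<open>Complete graphs\<close>

lemma edges_complete_graph: "edges (complete_graph t) = {e. e \<subseteq> {..<t} \<and> card e = 2}"
  by (auto simp: complete_graph_def card_2_iff)

lemma simple_complete_graph: "simple_graph (complete_graph t)"
  using edges_complete_graph[of t] by (auto simp: simple_graph_def complete_graph_def)

text \<open>On a cycle of length at least 4 the vertices at positions 0 and 2 are not adjacent, and
  the apex adds no edge between them. Completeness leaves only a triangle with its apex.\<close>

lemma complete_pyramid_card:
  assumes "is_cycle c" "w \<notin> set c" "X \<subseteq> set c"
    and S: "S = graph_union (cycle_graph c) \<lparr>vertices = insert w X, edges = {{w, x} | x. x \<in> X}\<rparr>"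
    and complete: "\<And>u v. u \<in> vertices S \<Longrightarrow> v \<in> vertices S \<Longrightarrow> u \<noteq> v \<Longrightarrow> {u, v} \<in> edges S"
  shows "card (vertices S) = 4"
proof -
  have c: "distinct c" "3 \<le> length c" using assms by (auto simp: is_cycle_def)
  have "length c = 3"
  proof (rule ccontr)
    assume "length c \<noteq> 3"
    then have l: "4 \<le> length c" using c by simp
    have l02: "0 < length c" "2 < length c" using l by auto
    have n: "c ! 0 \<in> set c" "c ! 2 \<in> set c" "c ! 0 \<noteq> c ! 2"
      using l02 nth_eq_iff_index_eq[OF c(1) l02] by simp_all
    then have "{c ! 0, c ! 2} \<in> edges S"
      using complete by (auto simp: S graph_union_simps vertices_cycle_graph)
    then have "{c ! 0, c ! 2} \<in> edges (cycle_graph c) \<union> {{w, x} | x. x \<in> X}"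
      by (simp add: S graph_union_simps)
    moreover have "{c ! 0, c ! 2} \<noteq> {w, x}" for x using n assms(2) by (auto simp: doubleton_eq_iff)
    ultimately have "{c ! 0, c ! 2} \<in> edges (cycle_graph c)" by blast
    then obtain i where i: "i < length c" "{c ! 0, c ! 2} = {c ! i, c ! (Suc i mod length c)}"
      by (auto simp: cycle_graph_def)
    have m: "Suc i mod length c < length c" using l02 by (intro mod_less_divisor)
    have "(i = 0 \<and> Suc i mod length c = 2) \<or> (i = 2 \<and> Suc i mod length c = 0)"
    proof -
      have eq: "c ! j = c ! k \<longleftrightarrow> j = k" if "j < length c" "k < length c" for j k
        using that c(1) by (rule nth_eq_iff_index_eq[rotated])
      show ?thesis
        using i(2) eq[OF l02(1) i(1)] eq[OF l02(1) m] eq[OF l02(2) i(1)] eq[OF l02(2) m]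
        unfolding doubleton_eq_iff by metis
    qed
    then show False using l by (auto simp: mod_Suc)
  qed
  then have "card (set c) = 3" using c by (simp add: distinct_card)
  moreover have "vertices S = insert w (set c)"
    using assms(3) by (auto simp: S graph_union_simps vertices_cycle_graph)
  ultimately show ?thesis using assms(2) by simp
qed

lemma is_path_mem: "is_path x p y \<Longrightarrow> x \<in> set p \<and> y \<in> set p"
  using hd_in_set last_in_set unfolding is_path_def by blast

lemma ex_less_3: "(\<exists>i<3. Q i) \<longleftrightarrow> Q 0 \<or> Q 1 \<or> Q (2::nat)"
  using all_less_3[of "\<lambda>i. \<not> Q i"] by blast

lemma path_edges_mem: "{x, y} \<in> path_edges p \<Longrightarrow> x \<in> set p \<and> y \<in> set p"
  using path_edges_subset[of "{x, y}" p] by simp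

text \<open>Trihedra and prisms are never complete: interior vertices of two different paths,
  respectively \<open>x 0\<close> and \<open>y 1\<close>, are not adjacent. Complete pyramids and
  stamps are complete graphs on four vertices.\<close>

lemma complete_solid_graph_card:
  assumes "is_solid_graph S"
    and complete: "\<And>u v. u \<in> vertices S \<Longrightarrow> v \<in> vertices S \<Longrightarrow> u \<noteq> v \<Longrightarrow> {u, v} \<in> edges S"
  shows "card (vertices S) = 4"
  using assms(1) unfolding is_solid_graph_def
proof (elim disjE)
  assume "is_pyramid S"
  then obtain c w X where "is_cycle c" "w \<notin> set c" "X \<subseteq> set c"
    "S = graph_union (cycle_graph c) \<lparr>vertices = insert w X, edges = {{w, x} | x. x \<in> X}\<rparr>"
    unfolding is_pyramid_def by blast
  from complete_pyramid_card[OF this complete] show ?thesis .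
next
  assume "is_trihedron S"
  then obtain a b P where P: "a \<noteq> b" "\<And>i. i < 3 \<Longrightarrow> is_path a (P i) b \<and> 2 \<le> path_length (P i)"
    "\<And>i j. i < 3 \<Longrightarrow> j < 3 \<Longrightarrow> i \<noteq> j \<Longrightarrow> (set (P i) - {a, b}) \<inter> set (P j) = {}"
    and S: "S = graph_union (path_graph (P (0::nat))) (graph_union (path_graph (P 1)) (path_graph (P 2)))"
    unfolding is_trihedron_def by blast
  have inner: "\<exists>x\<in>set (P i). x \<noteq> a \<and> x \<noteq> b" if "i < 3" for i
  proof -
    have p: "distinct (P i)" "hd (P i) = a" "last (P i) = b" "3 \<le> length (P i)" "P i \<noteq> []"
      using P(2)[OF that] by (auto simp: is_path_def path_length_def)
    then have "P i ! 1 \<noteq> P i ! 0" "P i ! 1 \<noteq> P i ! (length (P i) - 1)"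
      by (auto simp: nth_eq_iff_index_eq)
    then show ?thesis using p by (intro bexI[of _ "P i ! 1"]) (auto simp: hd_conv_nth last_conv_nth)
  qed
  obtain x where x: "x \<in> set (P 0)" "x \<noteq> a" "x \<noteq> b" using inner[of 0]
    by (auto simp only: zero_less_numeral)
  have "(1::nat) < 3" by simp
  from inner[OF this] obtain y where y: "y \<in> set (P 1)" "y \<noteq> a" "y \<noteq> b" by blast
  have nx: "x \<notin> set (P 1)" "x \<notin> set (P 2)" using P(3)[of 0 1] P(3)[of 0 2] x by auto
  have ny: "y \<notin> set (P 0)" using P(3)[of 1 0] y by auto
  have "{x, y} \<in> edges S"
    using complete[of x y] x y nx by (auto simp: S graph_union_simps vertices_path_graph)
  then show ?thesis
    using nx ny by (auto simp: S graph_union_simps edges_path_graph dest!: path_edges_mem)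
next
  assume "is_stamp S"
  then obtain t x P where P: "is_cycle [t 0, t 1, t 2]" "x \<notin> {t 0, t 1, t 2}"
    "\<And>i. i < 3 \<Longrightarrow> is_path (t i) (P i) x \<and> 1 \<le> path_length (P i)"
    "\<And>i j. i < 3 \<Longrightarrow> j < 3 \<Longrightarrow> i \<noteq> j \<Longrightarrow> (set (P i) - {x}) \<inter> (set (P j) - {x}) = {}"
    "\<And>i. i < 3 \<Longrightarrow> set (P i) \<inter> {t 0, t 1, t 2} = {t i}"
    and S: "S = graph_union (cycle_graph [t 0, t 1, t 2]) (graph_union (path_graph (P (0::nat)))
      (graph_union (path_graph (P 1)) (path_graph (P 2))))"
    unfolding is_stamp_def by blast
  have t: "t 0 \<noteq> t 1" "t 1 \<noteq> t 2" "t 0 \<noteq> t 2" using P(1) by (auto simp: is_cycle_def)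
  have three: "i = 0 \<or> i = 1 \<or> i = 2" if "i < 3" for i :: nat using that by linarith
  \<comment> \<open>An interior vertex of \<open>P i\<close> is not adjacent to the triangle vertex
    of another path, so completeness shrinks every path to an edge.\<close>
  have sub: "set (P i) \<subseteq> {t i, x}" if i: "i < 3" for i
  proof
    fix y assume y: "y \<in> set (P i)"
    show "y \<in> {t i, x}"
    proof (rule ccontr)
      assume "y \<notin> {t i, x}"
      then have yT: "y \<noteq> x" "y \<notin> {t 0, t 1, t 2}" using P(5)[OF i] y by auto
      have "\<exists>j<3. j \<noteq> i \<and> t j \<noteq> t i" using three[OF i] t unfolding ex_less_3 by auto
      then obtain j where j: "j < 3" "j \<noteq> i" "t j \<noteq> t i" by blast
      have vs: "vertices S = {t 0, t 1, t 2} \<union> set (P 0) \<union> set (P 1) \<union> set (P 2)"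
        by (auto simp: S graph_union_simps vertices_path_graph vertices_cycle_graph)
      have tj: "t j \<in> {t 0, t 1, t 2}" using three[OF j(1)] by auto
      have "{y, t j} \<in> edges S"
        using complete[of y "t j"] y yT tj three[OF i] unfolding vs by auto
      moreover have "{y, t j} \<notin> edges (cycle_graph [t 0, t 1, t 2])"
        using yT unfolding edges_cycle_graph_3 by (auto simp: doubleton_eq_iff)
      ultimately have "\<exists>k<3. {y, t j} \<in> path_edges (P k)"
        unfolding ex_less_3 by (simp add: S graph_union_simps edges_path_graph)
      then obtain k where k: "k < 3" "{y, t j} \<in> path_edges (P k)" by blast
      note k = k(1) path_edges_mem[OF k(2), THEN conjunct1] path_edges_mem[OF k(2), THEN conjunct2]
      have "k = i" using P(4)[OF k(1) i] k(2) y yT(1) by blast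
      then show False using P(5)[OF i] k(3) tj j(3) by auto
    qed
  qed
  have ends: "{t i, x} \<subseteq> set (P i)" if "i < 3" for i
    using is_path_mem[of "t i" "P i" x] P(3)[OF that] by simp
  have "vertices S = {t 0, t 1, t 2, x}"
    using sub[of 0] sub[of 1] sub[of 2] ends[of 0]
    by (auto simp: S graph_union_simps vertices_path_graph vertices_cycle_graph)
  then show ?thesis using t P(2) by auto
next
  assume "is_prism S"
  then obtain x y P where P: "is_cycle [x 0, x 1, x 2]" "is_cycle [y 0, y 1, y 2]"
    "{x 0, x 1, x 2} \<inter> {y 0, y 1, y 2} = {}" "\<And>i. i < 3 \<Longrightarrow> is_path (x i) (P i) (y i)"
    "\<And>i j. i < 3 \<Longrightarrow> j < 3 \<Longrightarrow> i \<noteq> j \<Longrightarrow> set (P i) \<inter> set (P j) = {}"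
    and S: "S = graph_union (graph_union (cycle_graph [x 0, x 1, x 2]) (cycle_graph [y 0, y 1, y 2]))
      (graph_union (path_graph (P (0::nat))) (graph_union (path_graph (P 1)) (path_graph (P 2))))"
    unfolding is_prism_def by blast
  have m: "x 0 \<in> set (P 0)" "y 1 \<in> set (P 1)"
    using is_path_mem[OF P(4), of 0] is_path_mem[OF P(4), of 1] by simp_all
  have d: "x 0 \<notin> set (P 1)" "x 0 \<notin> set (P 2)" "y 1 \<notin> set (P 0)"
    using m P(5)[of 0 1] P(5)[of 0 2] by auto
  have "x 0 \<noteq> y 1" using P(3) by auto
  then have "{x 0, y 1} \<in> edges S"
    using complete m by (auto simp: S graph_union_simps vertices_path_graph)
  moreover have "{x 0, y 1} \<notin> edges (cycle_graph [x 0, x 1, x 2])"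
    "{x 0, y 1} \<notin> edges (cycle_graph [y 0, y 1, y 2])"
    using P(3) unfolding edges_cycle_graph_3 by (auto simp: doubleton_eq_iff)
  ultimately show ?thesis
    using d by (auto simp: S graph_union_simps edges_path_graph dest!: path_edges_mem)
qed

text \<open>For the third characteristic an upper bound suffices: the final comparison only requires
  that the value for the smaller complete graph is not too large. It holds since every solid of a
  complete graph has four vertices.\<close>

lemma beth_complete_graph:
  "beth1 (complete_graph t) = complete_beth1 t" "beth2 (complete_graph t) = complete_beth2 t"
    "beth3 (complete_graph t) \<le> complete_beth3 t"
proof -
  interpret sgraph "complete_graph t" by unfold_locales (rule simple_complete_graph)
  have V: "vertices (complete_graph t) = {..<t}" by (simp add: complete_graph_def)
  have a: "adj i j \<longleftrightarrow> i < t \<and> j < t \<and> i \<noteq> j" for i j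
    unfolding adj_def edges_complete_graph by (auto simp: card_insert_if)
  have sub: "card {U. U \<subseteq> {..<t} \<and> card U = k} = t choose k" for k
    using n_subsets[of "{..<t}" k] by simp
  have E: "card (edges (complete_graph t)) = t choose 2" using sub
    by (simp add: edges_complete_graph)
  have ic: "icycle U \<longleftrightarrow> card U = 3" if U: "U \<subseteq> {..<t}" for U
  proof
    assume c: "icycle U"
    then have "U \<noteq> {}" by (auto simp: icycle_def is_cycle_def induced_on_def cycle_graph_def)
    then obtain v where "v \<in> U" by blast
    from icycle_closes[OF c this] obtain p where p: "closes v p" "U = insert v (set p)" .
    then obtain x y zs where p': "p = x # y # zs"
      by (cases p rule: path_edges.cases) (auto simp: closes_def)
    \<comment> \<open>A vertex beyond the second one on the induced path would not be adjacent to
      \<open>x\<close>.\<close>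
    have "zs = []"
    proof (rule ccontr)
      assume "zs \<noteq> []"
      then obtain z where z: "z \<in> set zs" by (cases zs) auto
      then have "\<not> adj x z" "x \<noteq> z" using p(1) p' by (auto simp: closes_def)
      then show False using U p(2) p' z by (auto simp: a)
    qed
    moreover have "distinct p" "v \<notin> set p" using p ipath_distinct by (auto simp: closes_def)
    ultimately show "card U = 3" using p(2) p' by auto
  next
    assume "card U = 3"
    then obtain x y z where xyz: "U = {x, y, z}" "x \<noteq> y" "x \<noteq> z" "y \<noteq> z" by (auto simp: card_3_iff)
    then have "closes x [y, z]" using U by (auto simp: closes_def a)
    from closes_icycle[OF this] show "icycle U" using xyz by simp
  qed
  have "{U. U \<subseteq> {..<t} \<and> icycle U} = {U. U \<subseteq> {..<t} \<and> card U = 3}" using ic by blast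
  then have C: "card (induced_cycles (complete_graph t)) = t choose 3"
    using sub[of 3] by (simp add: card_induced_cycles ncycles_def V)
  have so: "card U = 4" if U: "U \<subseteq> {..<t}" "solid U" for U
  proof -
    obtain S :: "nat ugraph" and f where S: "is_solid_graph S" "bij_betw f U (vertices S)"
      "\<And>u v. u \<in> U \<Longrightarrow> v \<in> U \<Longrightarrow> {u, v} \<in> edges (induced_on (complete_graph t) U) \<longleftrightarrow> {f u, f v} \<in> edges S"
      using U(2) unfolding solid_def graph_isomorphic_def by auto
    have "card (vertices S) = 4"
    proof (rule complete_solid_graph_card[OF S(1)])
      fix u v assume uv: "u \<in> vertices S" "v \<in> vertices S" "u \<noteq> v"
      then obtain u' v' where u': "u' \<in> U" "v' \<in> U" "f u' = u" "f v' = v"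
        using S(2) by (metis bij_betw_imp_surj_on imageE)
      then have "{u', v'} \<in> edges (induced_on (complete_graph t) U)"
        using U uv by (auto simp: edges_induced_on edges_in_doubleton a)
      then show "{u, v} \<in> edges S" using S(3)[OF u'(1,2)] u' by simp
    qed
    then show ?thesis using bij_betw_same_card[OF S(2)] by simp
  qed
  have "nsolids {..<t} \<le> t choose 4"
    unfolding nsolids_def sub[of 4, symmetric]
    using so by (intro card_mono) (auto intro!: finite_subset[of _ "Pow {..<t}"])
  then have S: "card (solids (complete_graph t)) \<le> t choose 4" by (simp add: card_solids V)
  show "beth1 (complete_graph t) = complete_beth1 t" "beth2 (complete_graph t) = complete_beth2 t"
    "beth3 (complete_graph t) \<le> complete_beth3 t"
    using E C S
      by (simp_all add: beth1_def beth2_def beth3_def complete_beth1_def complete_beth2_def complete_beth3_def V)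
qed

section \<open>Small Hadwiger numbers and the conclusion\<close>

context sgraph
begin

text \<open>Each lower bound on the Hadwiger number rules out a colouring with that many colours,
  and this yields the next larger complete minor by way of an edge, an induced cycle and finally
  \<open>K\<^sup>4\<close>.\<close>

lemma hadwiger_ge_4:
  assumes conn: "graph_connected G" and chi: "hadwiger_number G < chromatic_number G"
  shows "4 \<le> hadwiger_number G"
proof -
  have V: "conn (vertices G)" using conn by (simp add: graph_connected_conn)
  have h1: "1 \<le> hadwiger_number G" using V by (intro hadwiger_ge_1) (simp add: conn_def)
  then have "\<not> colorable (vertices G) 1" using chi
    by (intro not_colorable_less_chromatic_number) simp
  then obtain x y where "adj x y" unfolding colorable_def by (meson less_one)
  then have h2: "2 \<le> hadwiger_number G" by (rule hadwiger_ge_2)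
  then have "\<not> colorable (vertices G) 2" using chi
    by (intro not_colorable_less_chromatic_number) simp
  \<comment> \<open>The first two characteristics add up to the number of induced cycles, and for
    \<open>K\<^sup>3\<close> the sum is 1. So the general bounds already provide a cycle.\<close>
  from beth_lower_bounds[OF finite_vertices V this]
  have "complete_beth1 3 + complete_beth2 3 \<le> int (ncycles (vertices G))" by simp
  moreover have "complete_beth1 3 + complete_beth2 3 = 1"
    by (simp add: complete_beth1_def complete_beth2_def)
  ultimately have "card {U. U \<subseteq> vertices G \<and> icycle U} \<noteq> 0" by (simp add: ncycles_def)
  then obtain U where "icycle U" by fastforce
  then have h3: "3 \<le> hadwiger_number G" by (rule hadwiger_ge_3)
  then have "\<not> colorable (vertices G) 3" using chi
    by (intro not_colorable_less_chromatic_number) simp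
  then show ?thesis using K4_minor_if_not_3_colorable[OF simple] by (intro hadwiger_ge)
qed

end

theorem theorem5p2p1:
  fixes G :: "'a ugraph"
  assumes "simple_graph G" and "graph_connected G"
    and "beth1 (complete_graph (hadwiger_number G)) = beth1 G \<or>
         beth2 (complete_graph (hadwiger_number G)) = beth2 G \<or>
         beth3 (complete_graph (hadwiger_number G)) = beth3 G"
  shows "G \<in> hadwiger_class"
proof (rule ccontr)
  interpret sgraph G by unfold_locales (rule assms)
  define h where "h = hadwiger_number G"
  define k where "k = chromatic_number G"
  assume "G \<notin> hadwiger_class"
  then have hk: "h < k" using assms by (simp add: hadwiger_class_def h_def k_def)
  then have "4 \<le> h" using hadwiger_ge_4 assms(2) by (simp add: h_def k_def)
  note strict = complete_beth_strict_mono[OF this hk]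
  \<comment> \<open>The lower bounds are one ahead: failure of \<open>k - 1\<close> colours gives
    the values at \<open>k\<close>, which is positive since it exceeds \<open>h\<close>.\<close>
  have "\<not> colorable (vertices G) (k - 1)"
    using hk by (intro not_colorable_less_chromatic_number) (simp add: k_def)
  moreover have "conn (vertices G)" using assms(2) by (simp add: graph_connected_conn)
  ultimately have "complete_beth1 k \<le> beth1 G \<and> complete_beth2 k \<le> beth2 G \<and> complete_beth3 k \<le> beth3 G"
    using beth_lower_bounds[of "vertices G" "k - 1"] finite_vertices hk
    by (simp add: beth1_def beth2_def beth3_def edges_in_vertices card_induced_cycles card_solids)
  then show False
    using assms(3) strict beth_complete_graph[of h] unfolding h_def[symmetric] by linarith
qed

end
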